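(* Let $(X,x)$ be an ergodic stationary random graph satisfying $$v(X,x)=\liminf_{r\to+\infty} r^{-1}\,\mathbb{E}\left(\log|B_r(x)|\right)<+\infty,$$ where $|B_r(x)|$ is the number of vertices of $X$ at distance $r$ or less from $x$. Then the entropy $h(X,x)$ is finite and satisfies $$\frac12\,\ell(X,x)^2\le h(X,x)\le \ell(X,x)\,v(X,x),$$ where $\ell(X,x)$ is the linear drift.
   Context: Graphs are connected, locally finite and undirected; multiple edges and loops are allowed. $d$ is the graph distance. One-step transition probabilities: $p(x,y)=\frac{\text{number of edges connecting }x\text{ to }y}{\deg(x)}$, where loops at $x$ are counted once in $\deg(x)$; $p^n$ denotes the $n$-step transition probabilities, and the simple random walk is the Markov chain with transition probabilities $p$. The space of isomorphism classes of rooted graphs carries the topology in which a sequence converges iff, for each fixed radius, the isomorphism type of the ball of that radius around the root is eventually constant (a Polish space). A random (rooted) graph $(X,x)$ is a random element of this space. The simple random walk on $(X,x)$ is a random element $(X,x,(x_0,x_1,\ldots))$ of the space of (isomorphism classes of) rooted graphs with a path starting at the root, such that conditionally on $(X,x)$ the path is a simple random walk on $X$ started at $x_0=x$. $(X,x)$ is stationary if $(X,x_1)$ has the same distribution as $(X,x)$. A stationary random graph is ergodic if the law of its simple random walk is ergodic for the shift $(X,x,(x_0,x_1,x_2,\ldots))\mapsto(X,x_1,(x_1,x_2,\ldots))$. For an ergodic stationary random graph, the linear drift is the constant $\ell(X,x)=\lim_{n\to+\infty}\frac{d(x_0,x_n)}{n}$ (the limit exists almost surely and in mean by Kingman's theorem),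 and the entropy is $h(X,x)=\lim_{n\to+\infty}-\frac1n\log p^n(x_0,x_n)$, which by Kingman's theorem exists almost surely and in $L^1$, and is a constant, whenever $-\mathbb{E}(\log p(x_0,x_1))<+\infty$ (in particular when $\mathbb{E}(\log\deg(x))<+\infty$); the growth hypothesis of the statement guarantees this integrability. *)

theory Defs
  imports "HOL-Probability.Probability"
begin

section \<open>Locally finite undirected multigraphs\<close>

text \<open>
  Edges are encoded by adjacency multisets: \<^term>\<open>count (nbrs G u) v\<close> is the number of edges
  connecting \<open>u\<close> and \<open>v\<close>, and a loop at \<open>u\<close> contributes once to \<^term>\<open>nbrs G u\<close>.
  Multisets being finite, the graph is locally finite and \<^term>\<open>size (nbrs G u)\<close> is the degree.
  A connected locally finite graph is countable, so natural numbers suffice as vertex labels.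
\<close>

record graph =
  verts :: "nat set"
  nbrs :: "nat \<Rightarrow> nat multiset"

definition connected_graph :: "graph \<Rightarrow> bool" where
  "connected_graph G \<longleftrightarrow>
     (\<forall>u v. count (nbrs G u) v = count (nbrs G v) u) \<and>
     (\<forall>u. u \<notin> verts G \<longrightarrow> nbrs G u = {#}) \<and>
     (\<forall>u\<in>verts G. \<forall>v\<in>verts G. (\<lambda>a b. b \<in># nbrs G a)\<^sup>*\<^sup>* u v)"

definition gdist :: "graph \<Rightarrow> nat \<Rightarrow> nat \<Rightarrow> nat" where
  "gdist G u v = (LEAST n. ((\<lambda>a b. b \<in># nbrs G a) ^^ n) u v)"

definition ball_verts :: "graph \<Rightarrow> nat \<Rightarrow> nat \<Rightarrow> nat set" where
  "ball_verts G x r = {u \<in> verts G. gdist G x u \<le> r}"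

definition ball_graph :: "graph \<Rightarrow> nat \<Rightarrow> nat \<Rightarrow> graph" where
  "ball_graph G x r =
     \<lparr>verts = ball_verts G x r,
      nbrs = (\<lambda>u. if u \<in> ball_verts G x r then filter_mset (\<lambda>v. v \<in> ball_verts G x r) (nbrs G u)
                  else {#})\<rparr>"

definition graph_iso :: "(nat \<Rightarrow> nat) \<Rightarrow> graph \<Rightarrow> graph \<Rightarrow> bool" where
  "graph_iso \<phi> G H \<longleftrightarrow> bij_betw \<phi> (verts G) (verts H) \<and>
     (\<forall>u\<in>verts G. \<forall>v\<in>verts G. count (nbrs H (\<phi> u)) (\<phi> v) = count (nbrs G u) v)"

text \<open>
  One step of the simple random walk: \<^term>\<open>pmf (step G u) v\<close> is the number of edges connecting
  \<open>u\<close> to \<open>v\<close> divided by the degree of \<open>u\<close>.  In a graph reduced to one vertex without edges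
  this quotient is not defined; there the walk stays put.
\<close>

definition step :: "graph \<Rightarrow> nat \<Rightarrow> nat pmf" where
  "step G u = (if nbrs G u = {#} then return_pmf u else pmf_of_multiset (nbrs G u))"

primrec steps :: "graph \<Rightarrow> nat \<Rightarrow> nat \<Rightarrow> nat pmf" where
  "steps G 0 u = return_pmf u"
| "steps G (Suc n) u = bind_pmf (step G u) (steps G n)"

text \<open>The law on vertex sequences of the Markov chain with transitions \<^const>\<open>step\<close> started at \<open>x\<close>.\<close>

definition chain_kernel :: "graph \<Rightarrow> nat \<Rightarrow> nat \<Rightarrow> (nat \<Rightarrow> nat) \<Rightarrow> nat measure" where
  "chain_kernel G x i \<omega> =
     measure_pmf (case i of 0 \<Rightarrow> return_pmf x | Suc j \<Rightarrow> step G (\<omega> j))"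

lemma Ionescu_Tulcea_chain: "Ionescu_Tulcea (chain_kernel G x) (\<lambda>_. count_space UNIV)"
proof (rule Ionescu_Tulcea.intro)
  fix i
  show "chain_kernel G x i
      \<in> (\<Pi>\<^sub>M i\<in>{0..<i}. count_space UNIV) \<rightarrow>\<^sub>M subprob_algebra (count_space UNIV)"
  proof (cases i)
    case 0
    have "measure_pmf (return_pmf x) \<in> space (subprob_algebra (count_space UNIV))"
      by (simp add: measure_pmf_in_subprob_algebra)
    then show ?thesis
      by (simp add: 0 chain_kernel_def[abs_def])
  next
    case (Suc j)
    have "(\<lambda>\<omega>. \<omega> j) \<in> (\<Pi>\<^sub>M i\<in>{0..<i}. count_space (UNIV :: nat set)) \<rightarrow>\<^sub>M count_space UNIV"
      by (rule measurable_component_singleton) (simp add: Suc)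
    moreover have "(\<lambda>u. measure_pmf (step G u))
        \<in> count_space UNIV \<rightarrow>\<^sub>M subprob_algebra (count_space UNIV)"
      by (auto simp: measure_pmf_in_subprob_algebra)
    ultimately show ?thesis
      unfolding Suc chain_kernel_def[abs_def] nat.case by (rule measurable_compose)
  qed
qed (simp add: chain_kernel_def prob_space_measure_pmf)

definition chain_law :: "graph \<Rightarrow> nat \<Rightarrow> (nat \<Rightarrow> nat) measure" where
  "chain_law G x = projective_family.lim UNIV
     (Ionescu_Tulcea.CI (chain_kernel G x) (\<lambda>_. count_space UNIV)) (\<lambda>_. count_space UNIV)"


section \<open>Isomorphisms preserve the local structure\<close>

lemma graph_iso_id: "graph_iso id G G"
  by (simp add: graph_iso_def)

lemma graph_iso_comp:
  assumes "graph_iso \<phi> G H" "graph_iso \<psi> H K"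
  shows "graph_iso (\<psi> \<circ> \<phi>) G K"
  using assms unfolding graph_iso_def
  by (auto intro: bij_betw_trans simp: bij_betw_apply)

lemma graph_iso_inv:
  assumes "graph_iso \<phi> G H"
  shows "graph_iso (inv_into (verts G) \<phi>) H G"
proof -
  let ?\<psi> = "inv_into (verts G) \<phi>"
  have b: "bij_betw \<phi> (verts G) (verts H)"
    and c: "\<And>u v. u \<in> verts G \<Longrightarrow> v \<in> verts G \<Longrightarrow> count (nbrs H (\<phi> u)) (\<phi> v) = count (nbrs G u) v"
    using assms by (auto simp: graph_iso_def)
  have "count (nbrs G (?\<psi> u)) (?\<psi> v) = count (nbrs H u) v" if "u \<in> verts H" "v \<in> verts H" for u v
    using c[of "?\<psi> u" "?\<psi> v"] that b
    by (simp add: bij_betw_inv_into_right bij_betwE[OF bij_betw_inv_into])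
  then show ?thesis
    using bij_betw_inv_into[OF b] by (simp add: graph_iso_def)
qed

lemma connected_graph_nbrs:
  assumes "connected_graph G" "v \<in># nbrs G u"
  shows "u \<in> verts G" "v \<in> verts G"
  using assms unfolding connected_graph_def
  by (metis empty_iff set_mset_empty, metis count_greater_zero_iff empty_iff set_mset_empty)

lemma graph_iso_relpowp:
  assumes "connected_graph G" "connected_graph H" "graph_iso \<phi> G H" "u \<in> verts G"
    "((\<lambda>a b. b \<in># nbrs G a) ^^ n) u v"
  shows "v \<in> verts G \<and> ((\<lambda>a b. b \<in># nbrs H a) ^^ n) (\<phi> u) (\<phi> v)"
  using assms(5)
proof (induction n arbitrary: v)
  case 0
  then show ?case using assms(4) by simp
next
  case (Suc n)
  then obtain w where w: "((\<lambda>a b. b \<in># nbrs G a) ^^ n) u w" "v \<in># nbrs G w" by auto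
  from Suc.IH[OF w(1)] have "w \<in> verts G" "((\<lambda>a b. b \<in># nbrs H a) ^^ n) (\<phi> u) (\<phi> w)" by auto
  moreover have "v \<in> verts G" using connected_graph_nbrs[OF assms(1) w(2)] by simp
  moreover from this \<open>w \<in> verts G\<close> w(2) assms(3) have "\<phi> v \<in># nbrs H (\<phi> w)"
    unfolding graph_iso_def by (metis count_greater_zero_iff)
  ultimately show ?case by auto
qed

lemma graph_iso_gdist:
  assumes "connected_graph G" "connected_graph H" "graph_iso \<phi> G H" "u \<in> verts G" "v \<in> verts G"
  shows "gdist H (\<phi> u) (\<phi> v) = gdist G u v"
proof -
  have b: "bij_betw \<phi> (verts G) (verts H)" using assms(3) by (simp add: graph_iso_def)
  have "\<phi> u \<in> verts H" using b assms(4) by (simp add: bij_betw_apply)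
  from graph_iso_relpowp[OF assms(2,1) graph_iso_inv[OF assms(3)] this]
  have "((\<lambda>a b. b \<in># nbrs H a) ^^ n) (\<phi> u) (\<phi> v) \<Longrightarrow> ((\<lambda>a b. b \<in># nbrs G a) ^^ n) u v" for n
    using bij_betw_inv_into_left[OF b] assms(4,5) by metis
  then have "((\<lambda>a b. b \<in># nbrs H a) ^^ n) (\<phi> u) (\<phi> v) = ((\<lambda>a b. b \<in># nbrs G a) ^^ n) u v" for n
    using graph_iso_relpowp[OF assms(1-4)] by blast
  then show ?thesis by (simp add: gdist_def)
qed

lemma graph_iso_ball_verts:
  assumes "connected_graph G" "connected_graph H" "graph_iso \<phi> G H" "x \<in> verts G"
  shows "ball_verts H (\<phi> x) r = \<phi> ` ball_verts G x r"
proof -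
  have b: "\<phi> ` verts G = verts H" using assms(3) by (simp add: graph_iso_def bij_betw_def)
  show ?thesis
    unfolding ball_verts_def b[symmetric] using graph_iso_gdist[OF assms] by auto
qed

lemma graph_iso_ball_graph:
  assumes "connected_graph G" "connected_graph H" "graph_iso \<phi> G H" "x \<in> verts G"
  shows "graph_iso \<phi> (ball_graph G x r) (ball_graph H (\<phi> x) r)"
proof -
  have b: "inj_on \<phi> (verts G)" using assms(3) by (simp add: graph_iso_def bij_betw_def)
  have s: "ball_verts G x r \<subseteq> verts G" by (auto simp: ball_verts_def)
  have "bij_betw \<phi> (ball_verts G x r) (ball_verts H (\<phi> x) r)"
    unfolding graph_iso_ball_verts[OF assms] using inj_on_subset[OF b s] by (rule inj_on_imp_bij_betw)
  then show ?thesis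
    using s assms(3) by (auto simp: graph_iso_def ball_graph_def bij_betw_apply subset_iff)
qed

lemma relpowp_ball_graph_imp:
  "((\<lambda>a b. b \<in># nbrs (ball_graph G x s) a) ^^ n) u v \<Longrightarrow> ((\<lambda>a b. b \<in># nbrs G a) ^^ n) u v"
proof (induction n arbitrary: v)
  case (Suc n)
  then obtain w where "((\<lambda>a b. b \<in># nbrs (ball_graph G x s) a) ^^ n) u w"
    "v \<in># nbrs (ball_graph G x s) w"
    by auto
  moreover from this have "v \<in># nbrs G w"
    by (simp add: ball_graph_def split: if_splits)
  ultimately show ?case
    using Suc.IH by (blast intro: relpowp_Suc_I)
qed simp

lemma relpowp_ball_graph:
  assumes "connected_graph G" "x \<in> verts G" "((\<lambda>a b. b \<in># nbrs G a) ^^ n) x v" "n \<le> s"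
  shows "v \<in> ball_verts G x s \<and> ((\<lambda>a b. b \<in># nbrs (ball_graph G x s) a) ^^ n) x v"
  using assms(3,4)
proof (induction n arbitrary: v)
  case 0
  then show ?case using assms(2) by (auto simp: ball_verts_def gdist_def)
next
  case (Suc n)
  then obtain w where w: "((\<lambda>a b. b \<in># nbrs G a) ^^ n) x w" "v \<in># nbrs G w" by auto
  with Suc have IH: "w \<in> ball_verts G x s" "((\<lambda>a b. b \<in># nbrs (ball_graph G x s) a) ^^ n) x w"
    by auto
  have "gdist G x v \<le> Suc n" unfolding gdist_def by (rule Least_le) (rule Suc.prems(1))
  then have v: "v \<in> ball_verts G x s"
    using Suc.prems connected_graph_nbrs[OF assms(1) w(2)] by (simp add: ball_verts_def)
  then have "v \<in># nbrs (ball_graph G x s) w" using w IH by (simp add: ball_graph_def)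
  then show ?case using v IH by auto
qed

lemma gdist_attained:
  assumes "connected_graph G" "u \<in> verts G" "v \<in> verts G"
  shows "((\<lambda>a b. b \<in># nbrs G a) ^^ gdist G u v) u v"
proof -
  have "(\<lambda>a b. b \<in># nbrs G a)\<^sup>*\<^sup>* u v" using assms by (simp add: connected_graph_def)
  then have "\<exists>n. ((\<lambda>a b. b \<in># nbrs G a) ^^ n) u v" by (rule rtranclp_imp_relpowp)
  then show ?thesis unfolding gdist_def by (rule LeastI_ex)
qed

lemma gdist_ball_graph:
  assumes "connected_graph G" "x \<in> verts G" "v \<in> ball_verts G x s"
  shows "gdist (ball_graph G x s) x v = gdist G x v"
proof -
  have v: "v \<in> verts G" "gdist G x v \<le> s" using assms(3) by (auto simp: ball_verts_def)
  have "((\<lambda>a b. b \<in># nbrs (ball_graph G x s) a) ^^ gdist G x v) x v"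
    using relpowp_ball_graph[OF assms(1,2) gdist_attained[OF assms(1,2) v(1)] v(2)] by simp
  moreover have "gdist G x v \<le> n" if "((\<lambda>a b. b \<in># nbrs (ball_graph G x s) a) ^^ n) x v" for n
    unfolding gdist_def by (rule Least_le) (rule relpowp_ball_graph_imp[OF that])
  ultimately show ?thesis unfolding gdist_def[of "ball_graph G x s"] by (rule Least_equality)
qed

lemma connected_ball_graph:
  assumes "connected_graph G" "x \<in> verts G"
  shows "connected_graph (ball_graph G x s)"
proof -
  let ?R = "\<lambda>a b. b \<in># nbrs (ball_graph G x s) a"
  have c: "count (nbrs (ball_graph G x s) u) v = count (nbrs (ball_graph G x s) v) u" for u v
    using assms(1) by (auto simp: ball_graph_def connected_graph_def)
  have "symp ?R"
    by (rule sympI) (simp only: count_greater_zero_iff[symmetric] c)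
  then have sym: "?R\<^sup>*\<^sup>* u v \<Longrightarrow> ?R\<^sup>*\<^sup>* v u" for u v
    by (metis symp_rtranclp sympD)
  have "?R\<^sup>*\<^sup>* x v" if "v \<in> ball_verts G x s" for v
    using relpowp_ball_graph[OF assms gdist_attained[OF assms, of v], of s] that
    by (auto simp: ball_verts_def dest: relpowp_imp_rtranclp)
  then have "?R\<^sup>*\<^sup>* u v" if "u \<in> ball_verts G x s" "v \<in> ball_verts G x s" for u v
    using that sym by (meson rtranclp_trans)
  then show ?thesis
    using c by (auto simp: connected_graph_def ball_graph_def)
qed

lemma ball_graph_ball_graph:
  assumes "connected_graph G" "x \<in> verts G" "r \<le> s"
  shows "ball_graph (ball_graph G x s) x r = ball_graph G x r"
proof -
  have "ball_verts (ball_graph G x s) x r = {u \<in> ball_verts G x s. gdist (ball_graph G x s) x u \<le> r}"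
    by (simp add: ball_verts_def[of "ball_graph G x s"]) (simp add: ball_graph_def)
  also have "\<dots> = ball_verts G x r"
    using assms gdist_ball_graph[OF assms(1,2)] by (auto simp: ball_verts_def)
  finally have e: "ball_verts (ball_graph G x s) x r = ball_verts G x r" .
  have s: "ball_verts G x r \<subseteq> ball_verts G x s" using assms(3) by (auto simp: ball_verts_def)
  show ?thesis
    unfolding ball_graph_def[of "ball_graph G x s"] ball_graph_def[of G x r] e
    using s by (auto simp: ball_graph_def filter_filter_mset fun_eq_iff intro!: filter_mset_cong)
qed

lemma graph_iso_ball_graph_antimono:
  assumes "connected_graph G" "x \<in> verts G" "connected_graph H" "y \<in> verts H"
    "graph_iso \<phi> (ball_graph G x s) (ball_graph H y s)" "\<phi> x = y" "r \<le> s"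
  shows "graph_iso \<phi> (ball_graph G x r) (ball_graph H y r)"
proof -
  have "x \<in> verts (ball_graph G x s)"
    using assms(2) by (simp add: ball_graph_def ball_verts_def gdist_def)
  from graph_iso_ball_graph[OF connected_ball_graph[OF assms(1,2)]
      connected_ball_graph[OF assms(3,4)] assms(5) this, of r]
  show ?thesis
    using assms by (simp add: ball_graph_ball_graph)
qed

lemma graph_iso_nbrs:
  assumes "connected_graph G" "connected_graph H" "graph_iso \<phi> G H" "u \<in> verts G"
  shows "nbrs H (\<phi> u) = image_mset \<phi> (nbrs G u)"
proof (rule multiset_eqI)
  fix w
  have b: "bij_betw \<phi> (verts G) (verts H)" using assms(3) by (simp add: graph_iso_def)
  have s: "set_mset (nbrs G u) \<subseteq> verts G" using connected_graph_nbrs(2)[OF assms(1)] by auto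
  show "count (nbrs H (\<phi> u)) w = count (image_mset \<phi> (nbrs G u)) w"
  proof (cases "w \<in> verts H")
    case True
    then obtain v where v: "v \<in> verts G" "w = \<phi> v" using b by (auto simp: bij_betw_def)
    have "\<phi> -` {w} \<inter> set_mset (nbrs G u) = (if v \<in># nbrs G u then {v} else {})"
      using v s b by (auto simp: bij_betw_def inj_on_def subset_iff)
    then have "count (image_mset \<phi> (nbrs G u)) w = count (nbrs G u) v"
      by (auto simp: count_image_mset not_in_iff)
    then show ?thesis using v assms(3,4) by (simp add: graph_iso_def)
  next
    case False
    then have "w \<notin># nbrs H (\<phi> u)" using connected_graph_nbrs(2)[OF assms(2)] by blast
    moreover have "w \<notin># image_mset \<phi> (nbrs G u)" using False s b by (auto simp: bij_betw_def)
    ultimately show ?thesis by (metis not_in_iff)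
  qed
qed

lemma set_pmf_step:
  assumes "connected_graph G" "u \<in> verts G"
  shows "set_pmf (step G u) \<subseteq> verts G"
  using assms connected_graph_nbrs(2)[OF assms(1), of _ u] by (auto simp: step_def)

lemma graph_iso_step:
  assumes "connected_graph G" "connected_graph H" "graph_iso \<phi> G H" "u \<in> verts G"
  shows "step H (\<phi> u) = map_pmf \<phi> (step G u)"
proof (cases "nbrs G u = {#}")
  case True
  then show ?thesis using graph_iso_nbrs[OF assms] by (simp add: step_def)
next
  case False
  have b: "inj_on \<phi> (verts G)" using assms(3) by (simp add: graph_iso_def bij_betw_def)
  have s: "set_mset (nbrs G u) \<subseteq> verts G" using connected_graph_nbrs(2)[OF assms(1)] by auto
  have n: "nbrs H (\<phi> u) = image_mset \<phi> (nbrs G u)" by (rule graph_iso_nbrs[OF assms])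
  have "pmf (step H (\<phi> u)) w = pmf (map_pmf \<phi> (step G u)) w" for w
  proof (cases "w \<in> \<phi> ` set_mset (nbrs G u)")
    case True
    then obtain v where v: "v \<in># nbrs G u" "w = \<phi> v" by auto
    have "\<phi> -` {w} \<inter> set_mset (nbrs G u) = {v}"
      using v s b by (auto simp: inj_on_def subset_iff)
    then have "pmf (step H (\<phi> u)) w = pmf (step G u) v"
      using False by (simp add: step_def n count_image_mset)
    also have "\<dots> = pmf (map_pmf \<phi> (step G u)) w"
      unfolding v(2)
      by (rule pmf_map_inj[symmetric])
        (use False v inj_on_subset[OF b s] in \<open>auto simp: step_def\<close>)
    finally show ?thesis .
  next
    case notin: False
    have "w \<notin> set_pmf (step H (\<phi> u))" "w \<notin> set_pmf (map_pmf \<phi> (step G u))"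
      using notin False by (auto simp: step_def n)
    then show ?thesis by (metis pmf_eq_0_set_pmf)
  qed
  then show ?thesis by (rule pmf_eqI)
qed

lemma graph_iso_steps:
  assumes "connected_graph G" "connected_graph H" "graph_iso \<phi> G H" "u \<in> verts G"
  shows "steps H n (\<phi> u) = map_pmf \<phi> (steps G n u) \<and> set_pmf (steps G n u) \<subseteq> verts G"
  using assms(4)
proof (induction n arbitrary: u)
  case 0
  then show ?case by simp
next
  case (Suc n)
  have IH: "steps H n (\<phi> v) = map_pmf \<phi> (steps G n v)" "set_pmf (steps G n v) \<subseteq> verts G"
    if "v \<in> set_pmf (step G u)" for v
    using Suc.IH[of v] set_pmf_step[OF assms(1) Suc.prems] that by auto
  have "steps H (Suc n) (\<phi> u) = bind_pmf (step G u) (\<lambda>v. steps H n (\<phi> v))"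
    by (simp add: graph_iso_step[OF assms(1-3) Suc.prems] bind_map_pmf)
  also have "\<dots> = bind_pmf (step G u) (\<lambda>v. map_pmf \<phi> (steps G n v))"
    by (rule bind_pmf_cong) (simp_all add: IH)
  finally show ?case
    using IH(2) by (auto simp: map_bind_pmf)
qed

lemma graph_iso_pmf_steps:
  assumes "connected_graph G" "connected_graph H" "graph_iso \<phi> G H" "u \<in> verts G" "v \<in> verts G"
  shows "pmf (steps H n (\<phi> u)) (\<phi> v) = pmf (steps G n u) v"
proof -
  have b: "inj_on \<phi> (verts G)" using assms(3) by (simp add: graph_iso_def bij_betw_def)
  have e: "steps H n (\<phi> u) = map_pmf \<phi> (steps G n u)" and s: "set_pmf (steps G n u) \<subseteq> verts G"
    using graph_iso_steps[OF assms(1-4)] by auto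
  show ?thesis
  proof (cases "v \<in> set_pmf (steps G n u)")
    case True
    then show ?thesis unfolding e by (rule pmf_map_inj[OF inj_on_subset[OF b s]])
  next
    case False
    then have "\<phi> v \<notin> set_pmf (map_pmf \<phi> (steps G n u))"
      using b s assms(5) by (auto simp: inj_on_def subset_iff)
    then show ?thesis using False unfolding e by (metis pmf_eq_0_set_pmf)
  qed
qed


section \<open>Isomorphism classes of rooted graphs\<close>

definition rooted_iso :: "graph \<times> nat \<Rightarrow> graph \<times> nat \<Rightarrow> bool" where
  "rooted_iso = (\<lambda>(G, x) (H, y).
     connected_graph G \<and> x \<in> verts G \<and> connected_graph H \<and> y \<in> verts H \<and>
     (\<exists>\<phi>. graph_iso \<phi> G H \<and> \<phi> x = y))"

lemma rooted_iso_ball_graph: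
  assumes "rooted_iso (G, x) (H, y)"
  shows "\<exists>\<phi>. graph_iso \<phi> (ball_graph G x r) (ball_graph H y r) \<and> \<phi> x = y"
proof -
  obtain \<phi> where \<phi>: "connected_graph G" "connected_graph H" "graph_iso \<phi> G H" "x \<in> verts G" "\<phi> x = y"
    using assms by (auto simp: rooted_iso_def)
  show ?thesis using graph_iso_ball_graph[OF \<phi>(1-4), of r] \<phi>(5) by auto
qed

lemma connected_graph_singleton: "connected_graph \<lparr>verts = {0}, nbrs = (\<lambda>_. {#})\<rparr>"
  by (simp add: connected_graph_def)

lemma part_equivp_rooted_iso: "part_equivp rooted_iso"
proof (rule part_equivpI)
  show "\<exists>g. rooted_iso g g"
    using connected_graph_singleton graph_iso_id
    by (intro exI[of _ "(\<lparr>verts = {0}, nbrs = (\<lambda>_. {#})\<rparr>, 0)"]) (auto simp: rooted_iso_def intro!: exI[of _ id])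
  show "symp rooted_iso"
  proof (rule sympI, clarsimp simp: rooted_iso_def)
    fix G x H \<phi>
    assume "graph_iso \<phi> G H" "x \<in> verts G"
    then show "\<exists>\<psi>. graph_iso \<psi> H G \<and> \<psi> (\<phi> x) = x"
      by (intro exI[of _ "inv_into (verts G) \<phi>"])
        (auto simp: graph_iso_inv, auto simp: graph_iso_def intro: bij_betw_inv_into_left)
  qed
  show "transp rooted_iso"
  proof (rule transpI, clarsimp simp: rooted_iso_def)
    fix G x H \<phi> K \<psi>
    assume "graph_iso \<phi> G H" "graph_iso \<psi> H K"
    then show "\<exists>\<theta>. graph_iso \<theta> G K \<and> \<theta> x = \<psi> (\<phi> x)"
      by (intro exI[of _ "\<psi> \<circ> \<phi>"]) (simp add: graph_iso_comp)
  qed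
qed

quotient_type rooted_graph = "graph \<times> nat" / partial: rooted_iso
  by (rule part_equivp_rooted_iso)

lift_definition ball_size :: "nat \<Rightarrow> rooted_graph \<Rightarrow> nat" is
  "\<lambda>r (G, x). card (ball_verts G x r)"
proof (clarsimp simp: rooted_iso_def)
  fix r G x H \<phi>
  assume a: "connected_graph G" "connected_graph H" "graph_iso \<phi> G H" "x \<in> verts G"
  have "inj_on \<phi> (ball_verts G x r)"
    by (rule inj_on_subset[of _ "verts G"])
      (use a in \<open>auto simp: graph_iso_def bij_betw_def ball_verts_def\<close>)
  then show "card (ball_verts G x r) = card (ball_verts H (\<phi> x) r)"
    unfolding graph_iso_ball_verts[OF a] by (simp add: card_image)
qed

text \<open>The balls of radius \<open>r\<close> around the roots are isomorphic as rooted graphs.\<close>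

lift_definition same_ball :: "nat \<Rightarrow> rooted_graph \<Rightarrow> rooted_graph \<Rightarrow> bool" is
  "\<lambda>r (G, x) (H, y). \<exists>\<phi>. graph_iso \<phi> (ball_graph G x r) (ball_graph H y r) \<and> \<phi> x = y"
proof -
  have main: "\<exists>\<psi>. graph_iso \<psi> (ball_graph G' x' r) (ball_graph H' y' r) \<and> \<psi> x' = y'"
    if isos: "rooted_iso (G', x') (G, x)" "rooted_iso (H, y) (H', y')"
      "graph_iso \<phi> (ball_graph G x r) (ball_graph H y r)" "\<phi> x = y"
    for G x H y G' x' H' y' \<phi> and r :: nat
  proof -
    obtain \<alpha> where \<alpha>: "graph_iso \<alpha> (ball_graph G' x' r) (ball_graph G x r)" "\<alpha> x' = x"
      using rooted_iso_ball_graph[OF isos(1), of r] by blast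
    obtain \<beta> where \<beta>: "graph_iso \<beta> (ball_graph H y r) (ball_graph H' y' r)" "\<beta> y = y'"
      using rooted_iso_ball_graph[OF isos(2), of r] by blast
    have "graph_iso (\<beta> \<circ> (\<phi> \<circ> \<alpha>)) (ball_graph G' x' r) (ball_graph H' y' r)"
      by (intro graph_iso_comp[OF _ \<beta>(1)] graph_iso_comp[OF \<alpha>(1) isos(3)])
    then show ?thesis using \<alpha>(2) \<beta>(2) isos(4) by (intro exI[of _ "\<beta> \<circ> (\<phi> \<circ> \<alpha>)"]) simp
  qed
  have sym: "rooted_iso g h \<Longrightarrow> rooted_iso h g" for g h
    using part_equivp_symp[OF part_equivp_rooted_iso] .
  fix r and g g' h h' :: "graph \<times> nat"
  assume iso: "rooted_iso g g'" "rooted_iso h h'"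
  obtain G x G' x' H y H' y'
    where p: "g = (G, x)" "g' = (G', x')" "h = (H, y)" "h' = (H', y')"
    by (metis surj_pair)
  show "(case g of (G, x) \<Rightarrow> \<lambda>(H, y). \<exists>\<phi>. graph_iso \<phi> (ball_graph G x r) (ball_graph H y r) \<and> \<phi> x = y) h =
    (case g' of (G, x) \<Rightarrow> \<lambda>(H, y). \<exists>\<phi>. graph_iso \<phi> (ball_graph G x r) (ball_graph H y r) \<and> \<phi> x = y) h'"
    unfolding p prod.case
    by (rule iffI; elim exE conjE)
      (rule main[OF sym[OF iso(1)[unfolded p]] iso(2)[unfolded p]]
        main[OF iso(1)[unfolded p] sym[OF iso(2)[unfolded p]]], assumption+)+
qed

lemma same_ball_antimono:
  assumes "same_ball s g h" "r \<le> s"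
  shows "same_ball r g h"
  using assms
proof (transfer, clarsimp simp: rooted_iso_def)
  fix s r G x H \<phi>
  assume a: "connected_graph G" "x \<in> verts G" "connected_graph H" "\<phi> x \<in> verts H"
    "graph_iso \<phi> (ball_graph G x s) (ball_graph H (\<phi> x) s)" "r \<le> s"
  have "graph_iso \<phi> (ball_graph G x r) (ball_graph H (\<phi> x) r)"
    by (rule graph_iso_ball_graph_antimono[OF a(1-5) refl a(6)])
  then show "\<exists>\<psi>. graph_iso \<psi> (ball_graph G x r) (ball_graph H (\<phi> x) r) \<and> \<psi> x = \<phi> x"
    by blast
qed

text \<open>
  A sequence converges in this topology iff, for each \<open>r\<close>, the isomorphism type of the ball of
  radius \<open>r\<close> around the root is eventually that of the limit.
\<close>

instantiation rooted_graph :: topological_space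
begin

definition open_rooted_graph :: "rooted_graph set \<Rightarrow> bool" where
  "open_rooted_graph U \<longleftrightarrow> (\<forall>g\<in>U. \<exists>r. \<forall>h. same_ball r g h \<longrightarrow> h \<in> U)"

instance
proof
  show "open (UNIV :: rooted_graph set)" by (simp add: open_rooted_graph_def)
next
  fix U V :: "rooted_graph set"
  assume UV: "open U" "open V"
  show "open (U \<inter> V)"
    unfolding open_rooted_graph_def
  proof
    fix g assume "g \<in> U \<inter> V"
    then obtain r s where "\<forall>h. same_ball r g h \<longrightarrow> h \<in> U" "\<forall>h. same_ball s g h \<longrightarrow> h \<in> V"
      using UV unfolding open_rooted_graph_def by blast
    then show "\<exists>r. \<forall>h. same_ball r g h \<longrightarrow> h \<in> U \<inter> V"
      using same_ball_antimono[OF _ max.cobounded1] same_ball_antimono[OF _ max.cobounded2] by (metis IntI)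
  qed
next
  fix \<U> :: "rooted_graph set set"
  assume "\<forall>U\<in>\<U>. open U"
  then show "open (\<Union>\<U>)"
    unfolding open_rooted_graph_def by (metis UnionE UnionI)
qed

end


section \<open>Isomorphism classes of rooted graphs with a path starting at the root\<close>

text \<open>A path is the sequence \<open>\<omega>\<close> of its vertices, and the root is \<open>\<omega> 0\<close>.\<close>

definition is_path :: "graph \<Rightarrow> (nat \<Rightarrow> nat) \<Rightarrow> bool" where
  "is_path G \<omega> \<longleftrightarrow> \<omega> 0 \<in> verts G \<and> (\<forall>n. \<omega> (Suc n) \<in> set_pmf (step G (\<omega> n)))"

lemma is_path_verts:
  assumes "connected_graph G" "is_path G \<omega>"
  shows "\<omega> n \<in> verts G"
  using assms set_pmf_step[OF assms(1)] by (induction n) (auto simp: is_path_def)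

definition path_iso :: "graph \<times> (nat \<Rightarrow> nat) \<Rightarrow> graph \<times> (nat \<Rightarrow> nat) \<Rightarrow> bool" where
  "path_iso = (\<lambda>(G, \<omega>) (H, \<eta>).
     connected_graph G \<and> is_path G \<omega> \<and> connected_graph H \<and> is_path H \<eta> \<and>
     (\<exists>\<phi>. graph_iso \<phi> G H \<and> (\<forall>n. \<phi> (\<omega> n) = \<eta> n)))"

lemma part_equivp_path_iso: "part_equivp path_iso"
proof (rule part_equivpI)
  show "\<exists>g. path_iso g g"
    using connected_graph_singleton graph_iso_id
    by (intro exI[of _ "(\<lparr>verts = {0}, nbrs = (\<lambda>_. {#})\<rparr>, \<lambda>_. 0)"])
      (auto simp: path_iso_def is_path_def step_def intro!: exI[of _ id])
  show "symp path_iso"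
  proof (rule sympI, clarsimp simp: path_iso_def)
    fix G \<omega> H \<eta> \<phi>
    assume a: "graph_iso \<phi> G H" "connected_graph G" "is_path G \<omega>" "\<forall>n. \<phi> (\<omega> n) = \<eta> n"
    then have "inv_into (verts G) \<phi> (\<eta> n) = \<omega> n" for n
      using is_path_verts[OF a(2,3), of n]
      by (metis bij_betw_inv_into_left graph_iso_def)
    then show "\<exists>\<psi>. graph_iso \<psi> H G \<and> (\<forall>n. \<psi> (\<eta> n) = \<omega> n)"
      using graph_iso_inv[OF a(1)] by blast
  qed
  show "transp path_iso"
  proof (rule transpI, clarsimp simp: path_iso_def)
    fix G \<omega> H \<eta> \<phi> K \<zeta> \<psi>
    assume "graph_iso \<phi> G H" "graph_iso \<psi> H K" "\<forall>n. \<phi> (\<omega> n) = \<eta> n" "\<forall>n. \<psi> (\<eta> n) = \<zeta> n"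
    then show "\<exists>\<theta>. graph_iso \<theta> G K \<and> (\<forall>n. \<theta> (\<omega> n) = \<zeta> n)"
      by (intro exI[of _ "\<psi> \<circ> \<phi>"]) (simp add: graph_iso_comp)
  qed
qed

quotient_type path_graph = "graph \<times> (nat \<Rightarrow> nat)" / partial: path_iso
  by (rule part_equivp_path_iso)

lift_definition root_at :: "nat \<Rightarrow> path_graph \<Rightarrow> rooted_graph" is
  "\<lambda>n (G, \<omega>). (G, \<omega> n)"
  by (auto simp: path_iso_def rooted_iso_def is_path_verts)

lift_definition shift :: "path_graph \<Rightarrow> path_graph" is
  "\<lambda>(G, \<omega>). (G, \<lambda>n. \<omega> (Suc n))"
proof (clarsimp simp: path_iso_def)
  fix G \<omega> H \<eta> \<phi>
  assume "connected_graph G" "connected_graph H" "is_path G \<omega>" "is_path H \<eta>"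
    "graph_iso \<phi> G H" "\<forall>n. \<phi> (\<omega> n) = \<eta> n"
  moreover from this have "is_path G (\<lambda>n. \<omega> (Suc n))" "is_path H (\<lambda>n. \<eta> (Suc n))"
    using is_path_verts by (auto simp: is_path_def)
  ultimately show "is_path G (\<lambda>n. \<omega> (Suc n)) \<and> is_path H (\<lambda>n. \<eta> (Suc n)) \<and>
      (\<exists>\<phi>. graph_iso \<phi> G H \<and> (\<forall>n. \<phi> (\<omega> (Suc n)) = \<eta> (Suc n)))"
    by blast
qed

lift_definition path_dist :: "nat \<Rightarrow> path_graph \<Rightarrow> nat" is
  "\<lambda>n (G, \<omega>). gdist G (\<omega> 0) (\<omega> n)"
proof (clarsimp simp: path_iso_def)
  fix n G \<omega> H \<eta> \<phi>
  assume a: "connected_graph G" "connected_graph H" "is_path G \<omega>" "graph_iso \<phi> G H" "\<forall>n. \<phi> (\<omega> n) = \<eta> n"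
  show "gdist G (\<omega> 0) (\<omega> n) = gdist H (\<eta> 0) (\<eta> n)"
    using graph_iso_gdist[OF a(1,2,4) is_path_verts[OF a(1,3), of 0] is_path_verts[OF a(1,3), of n]] a(5)
    by simp
qed

lift_definition path_prob :: "nat \<Rightarrow> path_graph \<Rightarrow> real" is
  "\<lambda>n (G, \<omega>). pmf (steps G n (\<omega> 0)) (\<omega> n)"
proof (clarsimp simp: path_iso_def)
  fix n G \<omega> H \<eta> \<phi>
  assume a: "connected_graph G" "connected_graph H" "is_path G \<omega>" "graph_iso \<phi> G H" "\<forall>n. \<phi> (\<omega> n) = \<eta> n"
  show "pmf (steps G n (\<omega> 0)) (\<omega> n) = pmf (steps H n (\<eta> 0)) (\<eta> n)"
    using graph_iso_pmf_steps[OF a(1,2,4) is_path_verts[OF a(1,3), of 0] is_path_verts[OF a(1,3), of n]] a(5)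
    by simp
qed

lemma path_iso_ball_graph:
  assumes "path_iso (G, \<omega>) (H, \<eta>)"
  shows "\<exists>\<phi>. graph_iso \<phi> (ball_graph G (\<omega> 0) r) (ball_graph H (\<eta> 0) r) \<and> (\<forall>n\<le>r. \<phi> (\<omega> n) = \<eta> n)"
proof -
  obtain \<phi> where \<phi>: "connected_graph G" "connected_graph H" "graph_iso \<phi> G H" "\<omega> 0 \<in> verts G"
    "\<And>n. \<phi> (\<omega> n) = \<eta> n"
    using assms by (auto simp: path_iso_def is_path_def)
  show ?thesis using graph_iso_ball_graph[OF \<phi>(1-4), of r] \<phi>(5) by auto
qed

text \<open>
  The balls of radius \<open>r\<close> around the roots are isomorphic by an isomorphism that matches the first
  \<open>r\<close> steps of the two paths, all of which take place in these balls.
\<close>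

lift_definition same_path_ball :: "nat \<Rightarrow> path_graph \<Rightarrow> path_graph \<Rightarrow> bool" is
  "\<lambda>r (G, \<omega>) (H, \<eta>). \<exists>\<phi>. graph_iso \<phi> (ball_graph G (\<omega> 0) r) (ball_graph H (\<eta> 0) r) \<and>
     (\<forall>n\<le>r. \<phi> (\<omega> n) = \<eta> n)"
proof -
  have main: "\<exists>\<psi>. graph_iso \<psi> (ball_graph G' (\<omega>' 0) r) (ball_graph H' (\<eta>' 0) r) \<and>
      (\<forall>n\<le>r. \<psi> (\<omega>' n) = \<eta>' n)"
    if isos: "path_iso (G', \<omega>') (G, \<omega>)" "path_iso (H, \<eta>) (H', \<eta>')"
      "graph_iso \<phi> (ball_graph G (\<omega> 0) r) (ball_graph H (\<eta> 0) r)" "\<forall>n\<le>r. \<phi> (\<omega> n) = \<eta> n"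
    for G \<omega> H \<eta> G' \<omega>' H' \<eta>' \<phi> and r :: nat
  proof -
    obtain \<alpha> where \<alpha>: "graph_iso \<alpha> (ball_graph G' (\<omega>' 0) r) (ball_graph G (\<omega> 0) r)"
      "\<forall>n\<le>r. \<alpha> (\<omega>' n) = \<omega> n"
      using path_iso_ball_graph[OF isos(1), of r] by blast
    obtain \<beta> where \<beta>: "graph_iso \<beta> (ball_graph H (\<eta> 0) r) (ball_graph H' (\<eta>' 0) r)"
      "\<forall>n\<le>r. \<beta> (\<eta> n) = \<eta>' n"
      using path_iso_ball_graph[OF isos(2), of r] by blast
    have "graph_iso (\<beta> \<circ> (\<phi> \<circ> \<alpha>)) (ball_graph G' (\<omega>' 0) r) (ball_graph H' (\<eta>' 0) r)"
      by (intro graph_iso_comp[OF _ \<beta>(1)] graph_iso_comp[OF \<alpha>(1) isos(3)])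
    then show ?thesis using \<alpha>(2) \<beta>(2) isos(4) by (intro exI[of _ "\<beta> \<circ> (\<phi> \<circ> \<alpha>)"]) simp
  qed
  have sym: "path_iso g h \<Longrightarrow> path_iso h g" for g h
    using part_equivp_symp[OF part_equivp_path_iso] .
  fix r and g g' h h' :: "graph \<times> (nat \<Rightarrow> nat)"
  assume iso: "path_iso g g'" "path_iso h h'"
  obtain G \<omega> G' \<omega>' H \<eta> H' \<eta>'
    where p: "g = (G, \<omega>)" "g' = (G', \<omega>')" "h = (H, \<eta>)" "h' = (H', \<eta>')"
    by (metis surj_pair)
  show "(case g of (G, \<omega>) \<Rightarrow> \<lambda>(H, \<eta>). \<exists>\<phi>. graph_iso \<phi> (ball_graph G (\<omega> 0) r) (ball_graph H (\<eta> 0) r) \<and>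
      (\<forall>n\<le>r. \<phi> (\<omega> n) = \<eta> n)) h =
    (case g' of (G, \<omega>) \<Rightarrow> \<lambda>(H, \<eta>). \<exists>\<phi>. graph_iso \<phi> (ball_graph G (\<omega> 0) r) (ball_graph H (\<eta> 0) r) \<and>
      (\<forall>n\<le>r. \<phi> (\<omega> n) = \<eta> n)) h'"
    unfolding p prod.case
    by (rule iffI; elim exE conjE)
      (rule main[OF sym[OF iso(1)[unfolded p]] iso(2)[unfolded p]]
        main[OF iso(1)[unfolded p] sym[OF iso(2)[unfolded p]]], assumption+)+
qed

lemma same_path_ball_antimono:
  assumes "same_path_ball s g h" "r \<le> s"
  shows "same_path_ball r g h"
  using assms
proof (transfer, clarsimp simp: path_iso_def)
  fix s r G \<omega> H \<eta> \<phi>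
  assume a: "connected_graph G" "is_path G \<omega>" "connected_graph H" "is_path H \<eta>"
    "graph_iso \<phi> (ball_graph G (\<omega> 0) s) (ball_graph H (\<eta> 0) s)" "\<forall>n\<le>s. \<phi> (\<omega> n) = \<eta> n" "r \<le> s"
  have v: "\<omega> 0 \<in> verts G" "\<eta> 0 \<in> verts H" "\<phi> (\<omega> 0) = \<eta> 0"
    using a(2,4,6) by (auto simp: is_path_def)
  have "graph_iso \<phi> (ball_graph G (\<omega> 0) r) (ball_graph H (\<eta> 0) r)"
    by (rule graph_iso_ball_graph_antimono[OF a(1) v(1) a(3) v(2) a(5) v(3) a(7)])
  then show "\<exists>\<psi>. graph_iso \<psi> (ball_graph G (\<omega> 0) r) (ball_graph H (\<eta> 0) r) \<and> (\<forall>n\<le>r. \<psi> (\<omega> n) = \<eta> n)"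
    using a(6,7) by (intro exI[of _ \<phi>]) auto
qed

instantiation path_graph :: topological_space
begin

definition open_path_graph :: "path_graph set \<Rightarrow> bool" where
  "open_path_graph U \<longleftrightarrow> (\<forall>g\<in>U. \<exists>r. \<forall>h. same_path_ball r g h \<longrightarrow> h \<in> U)"

instance
proof
  show "open (UNIV :: path_graph set)" by (simp add: open_path_graph_def)
next
  fix U V :: "path_graph set"
  assume UV: "open U" "open V"
  show "open (U \<inter> V)"
    unfolding open_path_graph_def
  proof
    fix g assume "g \<in> U \<inter> V"
    then obtain r s where "\<forall>h. same_path_ball r g h \<longrightarrow> h \<in> U" "\<forall>h. same_path_ball s g h \<longrightarrow> h \<in> V"
      using UV unfolding open_path_graph_def by blast
    then show "\<exists>r. \<forall>h. same_path_ball r g h \<longrightarrow> h \<in> U \<inter> V"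
      using same_path_ball_antimono[OF _ max.cobounded1] same_path_ball_antimono[OF _ max.cobounded2] by (metis IntI)
  qed
next
  fix \<U> :: "path_graph set set"
  assume "\<forall>U\<in>\<U>. open U"
  then show "open (\<Union>\<U>)"
    unfolding open_path_graph_def by (metis UnionE UnionI)
qed

end


section \<open>Stationary random graphs\<close>

text \<open>
  The law of a random rooted graph is a Borel probability measure on \<^typ>\<open>rooted_graph\<close>.  The law
  of its simple random walk is the mixture of the laws of the walks on the realizations; the law
  of the walk on an isomorphism class does not depend on the representative.
\<close>

definition srw_from :: "rooted_graph \<Rightarrow> path_graph measure" where
  "srw_from g = (case rep_rooted_graph g of (G, x) \<Rightarrow>
     distr (chain_law G x) borel (\<lambda>\<omega>. abs_path_graph (G, \<omega>)))"

definition srw_law :: "rooted_graph measure \<Rightarrow> path_graph measure" where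
  "srw_law \<mu> = \<mu> \<bind> srw_from"

definition random_graph :: "rooted_graph measure \<Rightarrow> bool" where
  "random_graph \<mu> \<longleftrightarrow> prob_space \<mu> \<and> sets \<mu> = sets borel"

definition stationary :: "rooted_graph measure \<Rightarrow> bool" where
  "stationary \<mu> \<longleftrightarrow> distr (srw_law \<mu>) borel (root_at 1) = \<mu>"

definition ergodic_under :: "'a measure \<Rightarrow> ('a \<Rightarrow> 'a) \<Rightarrow> bool" where
  "ergodic_under M T \<longleftrightarrow> T \<in> M \<rightarrow>\<^sub>M M \<and> distr M M T = M \<and>
     (\<forall>A\<in>sets M. T -` A \<inter> space M = A \<longrightarrow> measure M A = 0 \<or> measure M A = 1)"

definition ergodic_stationary :: "rooted_graph measure \<Rightarrow> bool" where
  "ergodic_stationary \<mu> \<longleftrightarrow>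
     random_graph \<mu> \<and> stationary \<mu> \<and> ergodic_under (srw_law \<mu>) shift"


section \<open>Growth, drift and entropy\<close>

definition growth :: "rooted_graph measure \<Rightarrow> ereal" where
  "growth \<mu> = liminf (\<lambda>r. enn2ereal (\<integral>\<^sup>+g. ennreal (ln (real (ball_size r g))) \<partial>\<mu>) / ereal (real r))"

text \<open>Almost sure and mean convergence to a constant.\<close>

definition converges_to_const :: "'a measure \<Rightarrow> (nat \<Rightarrow> 'a \<Rightarrow> real) \<Rightarrow> real \<Rightarrow> bool" where
  "converges_to_const M f c \<longleftrightarrow>
     (AE \<omega> in M. (\<lambda>n. f n \<omega>) \<longlonglongrightarrow> c) \<and>
     (\<lambda>n. \<integral>\<^sup>+\<omega>. ennreal \<bar>f n \<omega> - c\<bar> \<partial>M) \<longlonglongrightarrow> 0"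

definition speed :: "nat \<Rightarrow> path_graph \<Rightarrow> real" where
  "speed n w = real (path_dist n w) / real n"

definition info_rate :: "nat \<Rightarrow> path_graph \<Rightarrow> real" where
  "info_rate n w = - ln (path_prob n w) / real n"

text \<open>
  The drift and the entropy are the constants to which these sequences converge almost surely.
  The entropy is a priori an extended real number.
\<close>

definition linear_drift :: "rooted_graph measure \<Rightarrow> real" where
  "linear_drift \<mu> = (THE l. AE w in srw_law \<mu>. (\<lambda>n. speed n w) \<longlonglongrightarrow> l)"

definition srw_entropy :: "rooted_graph measure \<Rightarrow> ereal" where
  "srw_entropy \<mu> = (THE h. AE w in srw_law \<mu>. (\<lambda>n. ereal (info_rate n w)) \<longlonglongrightarrow> h)"

end

theory Submission
  imports Defs
begin

text \<open>
  The distance \<open>d(x\<^sub>0, x\<^sub>n)\<close> and the information \<open>- log p\<^sup>n(x\<^sub>0, x\<^sub>n)\<close> are nonnegative subadditive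
  cocycles over the shift, so that Kingman's theorem provides the drift \<open>\<ell>\<close> and the entropy \<open>h\<close>.  The
  information of the first step has mean at most \<open>\<bbbE> log |B\<^sub>1|\<close>, by the concavity of the logarithm and
  irrespective of the multiplicities of the edges, and this is finite because \<open>|B\<^sub>r|\<close> increases with \<open>r\<close>.

  Lower bound: the Varopoulos-Carne inequality \<open>p\<^sup>n(x, y) \<le> 2 (deg y / deg x)\<^sup>1\<^sup>/\<^sup>2 cosh(\<lambda>)\<^sup>n exp(- \<lambda> d(x, y))\<close>
  holds on every graph.  Take \<open>\<lambda> = \<ell>\<close> and use \<open>cosh \<lambda> \<le> exp(\<lambda>\<^sup>2 / 2)\<close>; by stationarity \<open>log (deg x\<^sub>n) / n\<close>
  tends to \<open>0\<close> in probability, hence almost surely along a subsequence.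

  Upper bound: with probability close to \<open>1\<close>, the walk is at time \<open>n\<close> in the ball of radius
  \<open>r = (\<ell> + \<epsilon>) n\<close>, at a vertex of probability at most \<open>exp(- (h - \<epsilon>) n)\<close>.  Given the graph, this event
  has probability at most \<open>min(1, |B\<^sub>r| exp(- (h - \<epsilon>) n)) \<le> exp(- \<epsilon> n) + log |B\<^sub>r| / ((h - 2 \<epsilon>) n)\<close>.
  Integrating gives \<open>\<bbbE> log |B\<^sub>r| \<ge> (h - 2 \<epsilon> - o(1)) n\<close>.
\<close>

section \<open>Ergodic theorems\<close>

text \<open>Edge multiplicities are not controlled by ball sizes, so the logarithm of the degree
  need not be integrable. Therefore the first step is compared with the number of its possible
  endpoints, and in the lower bound the degree of the endpoint is treated only in probability. A
  subsequence is then enough, since the whole sequence of information rates is already known to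
  converge. The growth is a liminf over all radii, so the upper bound has to hold at every large
  radius r. The time is chosen as a function of r, the integer part of r / (\<ell> + \<epsilon>),
  instead of the radius as a function of the time. The laws live on isomorphism classes, and the
  walk on a class is defined through a chosen representative. Its measurability rests on cylinders:
  r steps of the walk are determined by the ball of radius r, so the probability of a cylinder of
  radius r is locally constant in the graph.\<close>

locale ergodic_system = prob_space M for M :: "'a measure" +
  fixes T :: "'a \<Rightarrow> 'a"
  assumes ergodic: "ergodic_under M T"
begin

definition birkhoff_sum :: "('a \<Rightarrow> real) \<Rightarrow> nat \<Rightarrow> 'a \<Rightarrow> real" where
  "birkhoff_sum g n w = (\<Sum>i<n. g ((T ^^ i) w))"

lemma T_measurable [measurable]: "T \<in> M \<rightarrow>\<^sub>M M"
  using ergodic by (simp add: ergodic_under_def)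

lemma T_funpow_measurable [measurable]: "T ^^ n \<in> M \<rightarrow>\<^sub>M M"
  by (induction n) (auto intro: measurable_comp)

lemma T_space: "w \<in> space M \<Longrightarrow> (T ^^ n) w \<in> space M"
  using measurable_space[OF T_funpow_measurable] .

lemma distr_T_funpow: "distr M M (T ^^ n) = M"
proof (induction n)
  case 0
  then show ?case by (simp add: distr_id)
next
  case (Suc n)
  have "distr M M (T ^^ Suc n) = distr (distr M M (T ^^ n)) M T"
    by (simp add: distr_distr)
  also have "\<dots> = M"
    unfolding Suc using ergodic by (simp add: ergodic_under_def)
  finally show ?case .
qed

lemma integrable_T_funpow:
  fixes g :: "'a \<Rightarrow> real"
  assumes "integrable M g"
  shows "integrable M (\<lambda>w. g ((T ^^ n) w))"
  by (rule integrable_distr[OF T_funpow_measurable]) (simp add: distr_T_funpow assms)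

lemma expectation_T_funpow:
  fixes g :: "'a \<Rightarrow> real"
  assumes "g \<in> borel_measurable M"
  shows "expectation (\<lambda>w. g ((T ^^ n) w)) = expectation g"
  using integral_distr[OF T_funpow_measurable[of n], of g] assms by (simp add: distr_T_funpow)

lemma prob_T_funpow:
  assumes "A \<in> sets M"
  shows "prob {w \<in> space M. (T ^^ n) w \<in> A} = prob A"
proof -
  have "prob A = measure (distr M M (T ^^ n)) A" by (simp add: distr_T_funpow)
  also have "\<dots> = prob ((T ^^ n) -` A \<inter> space M)"
    using assms by (intro measure_distr) auto
  also have "(T ^^ n) -` A \<inter> space M = {w \<in> space M. (T ^^ n) w \<in> A}" by auto
  finally show ?thesis by simp
qed

text \<open>Forward invariance makes the preimages of \<open>A\<close> increase. They all have the
  probability of \<open>A\<close>, and their union is exactly invariant, which is what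
  \<open>ergodic_under\<close> asks for.\<close>

lemma prob_forward_invariant:
  assumes A: "A \<in> sets M" and inv: "\<And>w. w \<in> A \<Longrightarrow> T w \<in> A"
  shows "prob A = 0 \<or> prob A = 1"
proof -
  define B where "B n = {w \<in> space M. (T ^^ n) w \<in> A}" for n
  have sets: "B n \<in> sets M" for n
    unfolding B_def using A by measurable
  have mono: "incseq B"
    by (rule incseq_SucI) (auto simp: B_def inv)
  have "T -` (\<Union>n. B n) \<inter> space M = (\<Union>n. B n)"
  proof (intro equalityI subsetI)
    fix w assume "w \<in> T -` (\<Union>n. B n) \<inter> space M"
    then obtain n where "w \<in> space M" "(T ^^ Suc n) w \<in> A"
      by (auto simp: B_def funpow_swap1)
    then show "w \<in> (\<Union>n. B n)" unfolding B_def by blast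
  next
    fix w assume "w \<in> (\<Union>n. B n)"
    then obtain n where n: "w \<in> space M" "(T ^^ n) w \<in> A" by (auto simp: B_def)
    then have "(T ^^ n) (T w) \<in> A" using inv by (simp add: funpow_swap1[symmetric])
    moreover have "T w \<in> space M" using T_space[OF n(1), of 1] by simp
    ultimately show "w \<in> T -` (\<Union>n. B n) \<inter> space M"
      using n by (auto simp: B_def)
  qed
  moreover have "(\<Union>n. B n) \<in> sets M" using sets by blast
  ultimately have "prob (\<Union>n. B n) = 0 \<or> prob (\<Union>n. B n) = 1"
    using ergodic unfolding ergodic_under_def by blast
  moreover have "(\<lambda>n. prob (B n)) \<longlonglongrightarrow> prob (\<Union>n. B n)"
    by (rule finite_Lim_measure_incseq) (use sets mono in auto)
  then have "prob (\<Union>n. B n) = prob A"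
    using prob_T_funpow[OF A] by (simp add: B_def LIMSEQ_const_iff)
  ultimately show ?thesis by simp
qed

text \<open>
  Starting from \<open>w\<close>, one jumps ahead by some \<open>n \<le> N\<close> with \<open>f n \<le> 0\<close> if there is one, and by a
  single step otherwise; the latter happens on a set \<open>B\<close> that is negligible for large \<open>N\<close>.
\<close>
lemma subadditive_covering:
  fixes f :: "nat \<Rightarrow> 'a \<Rightarrow> real"
  assumes f0: "\<And>w. w \<in> space M \<Longrightarrow> f 0 w = 0"
    and sub: "\<And>m n w. w \<in> space M \<Longrightarrow> f (m + n) w \<le> f m w + f n ((T ^^ m) w)"
    and int: "\<And>n. integrable M (f n)"
    and neg: "AE w in M. \<exists>n\<ge>1. f n w \<le> 0"
    and "0 < \<epsilon>"
  shows "\<exists>K. \<forall>n. expectation (f n) \<le> \<epsilon> * real n + K"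
proof -
  have [measurable]: "f n \<in> borel_measurable M" for n using int by auto
  define g where "g w = max 0 (f 1 w)" for w
  have g: "integrable M g" unfolding g_def using int[of 1] by auto
  have [measurable]: "g \<in> borel_measurable M" using g by auto
  define B where "B N = {w \<in> space M. \<forall>n\<in>{1..N}. 0 < f n w}" for N
  have [measurable]: "B N \<in> sets M" for N unfolding B_def by measurable
  have "(\<lambda>N. \<integral>w. indicator (B N) w * g w \<partial>M) \<longlonglongrightarrow> (\<integral>w. 0 \<partial>M)"
  proof (rule integral_dominated_convergence)
    show "integrable M g" by (rule g)
    show "AE w in M. norm (indicator (B N) w * g w) \<le> g w" for N
      by (auto simp: g_def indicator_def)
    show "AE w in M. (\<lambda>N. indicator (B N) w * g w) \<longlonglongrightarrow> 0"
      using neg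
    proof eventually_elim
      case (elim w)
      then obtain n where "n \<ge> 1" "f n w \<le> 0" by blast
      then have "\<forall>\<^sub>F N in sequentially. indicator (B N) w * g w = 0"
        by (intro eventually_sequentiallyI[of n]) (force simp: B_def indicator_def)
      then show ?case by (rule tendsto_eventually)
    qed
  qed simp_all
  then have "\<forall>\<^sub>F N in sequentially. (\<integral>w. indicator (B N) w * g w \<partial>M) < \<epsilon>"
    using \<open>0 < \<epsilon>\<close> by (intro order_tendstoD(2)) auto
  then obtain N where N: "(\<integral>w. indicator (B N) w * g w \<partial>M) < \<epsilon>"
    by (auto simp: eventually_sequentially)
  define b where "b w = indicator (B N) w * g w" for w
  have b: "integrable M b"
    unfolding b_def using integrable_real_mult_indicator[OF _ g, of "B N"] by (simp add: mult.commute)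
  have nonneg: "0 \<le> g w" "0 \<le> b w" for w by (simp_all add: g_def b_def)
  \<comment> \<open>Cost charged to position \<open>i\<close> of \<open>[0, n)\<close>:
    \<open>b\<close> pays for a single step, and \<open>g\<close> covers each of the last
    \<open>N\<close> positions, where a jump might overshoot \<open>n\<close>.\<close>
  define c where "c n i w = b ((T ^^ i) w) + (if n \<le> i + N then g ((T ^^ i) w) else 0)" for n i w
  have c_nonneg: "0 \<le> c n i w" for n i w using nonneg by (simp add: c_def)
  \<comment> \<open>The cost depends on \<open>i\<close> only through the point reached and the
    distance \<open>n - i\<close> to the end, so the costs after a jump form a tail of the original
    ones.\<close>
  have c_shift: "(\<Sum>i<n - m. c (n - m) i ((T ^^ m) w)) \<le> (\<Sum>i<n. c n i w)" if "m \<le> n" for m n w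
  proof -
    have "(\<Sum>i<n - m. c (n - m) i ((T ^^ m) w)) = (\<Sum>i<n - m. c n (i + m) w)"
      by (rule sum.cong[OF refl]) (use that in \<open>auto simp: c_def funpow_add\<close>)
    also have "\<dots> = (\<Sum>i\<in>(\<lambda>i. i + m) ` {..<n - m}. c n i w)"
      by (subst sum.reindex) (auto simp: inj_on_def)
    also have "\<dots> \<le> (\<Sum>i<n. c n i w)"
      by (rule sum_mono2) (use that c_nonneg in auto)
    finally show ?thesis .
  qed
  have main: "f n w \<le> (\<Sum>i<n. c n i w)" if "w \<in> space M" for n w
    using that
  proof (induction n arbitrary: w rule: less_induct)
    case (less n)
    have step: "f n w \<le> f m w + (\<Sum>i<n - m. c (n - m) i ((T ^^ m) w))" if "1 \<le> m" "m \<le> n" for m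
      using sub[OF less.prems, of m "n - m"] less.IH[OF _ T_space[OF less.prems], of "n - m" m] that
      by auto
    \<comment> \<open>In the last case the jump would pass \<open>n\<close>; then
      \<open>n < N\<close>, every position carries the cost \<open>g\<close>, and the trivial bound
      by values of \<open>f 1\<close> is enough.\<close>
    consider "n = 0" | "0 < n" "w \<in> B N" | m where "1 \<le> m" "m \<le> n" "f m w \<le> 0"
      | m where "0 < n" "n < m" "m \<le> N"
      using less.prems unfolding B_def by (force simp: not_less not_le)
    then show ?case
    proof cases
      case 1
      then show ?thesis by (simp add: f0 less.prems)
    next
      case 2
      have "(\<Sum>i<n. c n i w) = c n 0 w + (\<Sum>i<n - 1. c n (Suc i) w)"
        using 2(1) by (cases n) (simp_all only: sum.lessThan_Suc_shift, simp_all)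
      also have "(\<Sum>i<n - 1. c n (Suc i) w) = (\<Sum>i<n - 1. c (n - 1) i ((T ^^ 1) w))"
        by (rule sum.cong[OF refl]) (use 2(1) in \<open>auto simp: c_def funpow_swap1\<close>)
      finally have "(\<Sum>i<n. c n i w) = c n 0 w + \<dots>" .
      moreover have "f 1 w \<le> c n 0 w"
        using 2(2) by (auto simp: c_def b_def g_def max_def)
      ultimately show ?thesis using step[of 1] 2(1) by simp
    next
      case 3
      then show ?thesis using step[of m] c_shift[of m n w] by simp
    next
      case 4
      have "f k w \<le> (\<Sum>i<k. f 1 ((T ^^ i) w))" for k
      proof (induction k)
        case (Suc k)
        then show ?case using sub[OF less.prems, of k 1] by simp
      qed (simp add: f0 less.prems)
      also have "(\<Sum>i<n. f 1 ((T ^^ i) w)) \<le> (\<Sum>i<n. c n i w)"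
        using 4 by (intro sum_mono) (auto simp: c_def g_def intro: add_increasing nonneg)
      finally show ?thesis .
    qed
  qed
  have int_c: "integrable M (c n i)" for n i
    unfolding c_def[abs_def]
    using integrable_T_funpow[OF b] integrable_T_funpow[OF g] by (cases "n \<le> i + N") auto
  have exp_c: "expectation (c n i) = expectation b + (if n \<le> i + N then expectation g else 0)" for n i
    unfolding c_def[abs_def]
    using integrable_T_funpow[OF b, of i] integrable_T_funpow[OF g, of i]
      expectation_T_funpow[of b i] expectation_T_funpow[of g i] b by (auto simp: prob_space)
  have "expectation (f n) \<le> \<epsilon> * real n + real N * expectation g" for n
  proof -
    have "expectation (f n) \<le> expectation (\<lambda>w. \<Sum>i<n. c n i w)"
      using int int_c main by (intro integral_mono) auto
    also have "\<dots> = real n * expectation b + (\<Sum>i<n. if n \<le> i + N then expectation g else 0)"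
      using int_c by (simp add: exp_c sum.distrib)
    also have "(\<Sum>i<n. if n \<le> i + N then expectation g else 0)
        = (\<Sum>i\<in>{i. i < n \<and> n \<le> i + N}. expectation g)"
      by (rule sum.mono_neutral_cong_right) auto
    also have "\<dots> = real (card {i. i < n \<and> n \<le> i + N}) * expectation g" by simp
    also have "\<dots> \<le> real N * expectation g"
    proof (rule mult_right_mono)
      have "card {i. i < n \<and> n \<le> i + N} \<le> card {n - N..<n}" by (rule card_mono) auto
      then show "real (card {i. i < n \<and> n \<le> i + N}) \<le> real N" by simp
      show "0 \<le> expectation g" using nonneg by simp
    qed
    also have "real n * expectation b \<le> real n * \<epsilon>"
      using N unfolding b_def by (intro mult_left_mono) auto
    finally show ?thesis by (simp add: mult.commute)
  qed
  then show ?thesis by blast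
qed

text \<open>For \<open>a < c\<close> the event that the liminf of \<open>f n / n\<close> is at least
  \<open>a\<close> is forward invariant, hence trivial. Were it null,
  \<open>subadditive_covering\<close> applied to \<open>f n - a * n\<close> would make the means
  grow with slope at most \<open>(a + c) / 2\<close>, below \<open>c\<close>. No sign is imposed on
  \<open>f\<close>, so the lemma applies to Birkhoff sums and to their negatives.\<close>

lemma subadditive_liminf_ge:
  fixes f :: "nat \<Rightarrow> 'a \<Rightarrow> real"
  assumes f0: "\<And>w. w \<in> space M \<Longrightarrow> f 0 w = 0"
    and sub: "\<And>m n w. w \<in> space M \<Longrightarrow> f (m + n) w \<le> f m w + f n ((T ^^ m) w)"
    and int: "\<And>n. integrable M (f n)"
    and c: "\<And>n. c * real n \<le> expectation (f n)"
  shows "AE w in M. \<forall>a<c. \<forall>\<^sub>F n in sequentially. a < f n w / real n"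
proof -
  have [measurable]: "f n \<in> borel_measurable M" for n using int by auto
  have *: "AE w in M. \<forall>j::nat. \<forall>\<^sub>F n in sequentially. a - 1 / real (Suc j) < f n w / real n"
    if "a < c" for a
  proof -
    \<comment> \<open>The tolerance \<open>1 / real (Suc j)\<close> is what makes \<open>A\<close>
      forward invariant: replacing \<open>w\<close> by \<open>T w\<close> costs a bounded amount,
      hence an arbitrarily small fraction of \<open>n\<close>.\<close>
    define A where "A = {w \<in> space M. \<forall>j::nat. \<exists>N. \<forall>n\<ge>N. a - 1 / real (Suc j) < f n w / real n}"
    have [measurable]: "A \<in> sets M" unfolding A_def by measurable
    have "T w \<in> A" if w: "w \<in> A" for w
    proof -
      have "\<forall>\<^sub>F n in sequentially. a - 1 / real (Suc j) < f n (T w) / real n" for j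
      proof -
        \<comment> \<open>Half of the tolerance at index \<open>j\<close>: one half comes from
          \<open>w\<close>, the other absorbs \<open>f 1 w\<close> and the shift of \<open>n\<close>
          by one.\<close>
        define d where "d = 1 / real (Suc (2 * j + 1))"
        have d: "0 < d" "1 / real (Suc j) = 2 * d" by (auto simp: d_def field_simps)
        have "\<forall>\<^sub>F n in sequentially. a - d < f n w / real n"
          using w unfolding A_def d_def eventually_sequentially by blast
        then have "\<forall>\<^sub>F n in sequentially. a - d < f (Suc n) w / real (Suc n)"
          by (rule eventually_compose_filterlim[OF _ filterlim_Suc])
        moreover have "\<forall>\<^sub>F n in sequentially. (\<bar>a\<bar> + d + \<bar>f 1 w\<bar>) / d < real n"
          using filterlim_real_sequentially filterlim_at_top_dense by blast
        moreover have "\<forall>\<^sub>F n in sequentially. (0::nat) < n" by (rule eventually_gt_at_top)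
        ultimately show ?thesis
        proof eventually_elim
          case (elim n)
          have "(a - d) * real (Suc n) < f (Suc n) w" using elim(1) by (simp add: field_simps)
          also have "\<dots> \<le> f 1 w + f n (T w)"
            using sub[of w 1 n] w by (simp add: A_def)
          finally have "(a - 2 * d) * real n < f n (T w)"
            using elim(2) d(1) by (simp add: field_simps)
          then show ?case using elim(3) unfolding d(2) by (simp add: pos_less_divide_eq)
        qed
      qed
      then show ?thesis
        using w T_space[of w 1] by (auto simp: A_def eventually_sequentially)
    qed
    then have "prob A = 0 \<or> prob A = 1" by (intro prob_forward_invariant) auto
    moreover have "prob A \<noteq> 0"
    proof
      assume "prob A = 0"
      then have "AE w in M. w \<notin> A"
        by (intro AE_not_in) (simp add: null_setsI emeasure_eq_measure)
      then have "AE w in M. \<exists>n\<ge>1. f n w - a * real n \<le> 0"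
      proof (rule AE_mp, intro AE_I2 impI)
        fix w assume "w \<in> space M" "w \<notin> A"
        then obtain j where "\<forall>N. \<exists>n\<ge>N. f n w / real n \<le> a - 1 / real (Suc j)"
          unfolding A_def by (auto simp: not_less)
        then obtain n where n: "n \<ge> 1" "f n w / real n \<le> a - 1 / real (Suc j)" by blast
        then have "f n w / real n \<le> a"
          by (smt (verit) divide_nonneg_nonneg of_nat_0_le_iff)
        then show "\<exists>n\<ge>1. f n w - a * real n \<le> 0"
          using n(1) by (intro exI[of _ n]) (simp add: field_simps)
      qed
      then have "\<exists>K. \<forall>n. expectation (\<lambda>w. f n w - a * real n) \<le> (c - a) / 2 * real n + K"
        using f0 sub int \<open>a < c\<close>
        by (intro subadditive_covering) (auto simp: algebra_simps)
      then obtain K where K: "\<And>n. expectation (f n) - a * real n \<le> (c - a) / 2 * real n + K"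
        using int by (auto simp: prob_space)
      obtain n :: nat where "K / ((c - a) / 2) < real n" using reals_Archimedean2 by blast
      then show False
        using K[of n] c[of n] \<open>a < c\<close> by (simp add: field_simps)
    qed
    ultimately have "AE w in M. w \<in> A" by (subst prob_eq_1[symmetric]) auto
    then show ?thesis by eventually_elim (auto simp: A_def eventually_sequentially)
  qed
  have "AE w in M. \<forall>i::nat. \<forall>j::nat. \<forall>\<^sub>F n in sequentially.
      (c - 1 / real (Suc i)) - 1 / real (Suc j) < f n w / real n"
    by (subst AE_all_countable) (intro allI *, simp)
  then show ?thesis
  proof eventually_elim
    case (elim w)
    show ?case
    proof (intro allI impI)
      fix a assume "a < c"
      then obtain j :: nat where j: "inverse (real (Suc j)) < (c - a) / 2"
        using reals_Archimedean[of "(c - a) / 2"] by auto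
      have "\<forall>\<^sub>F n in sequentially. (c - 1 / real (Suc j)) - 1 / real (Suc j) < f n w / real n"
        using elim by blast
      then show "\<forall>\<^sub>F n in sequentially. a < f n w / real n"
        by eventually_elim (use j in \<open>simp add: inverse_eq_divide\<close>)
    qed
  qed
qed

lemma birkhoff_sum_add:
  "birkhoff_sum g (m + n) w = birkhoff_sum g m w + birkhoff_sum g n ((T ^^ m) w)"
proof (induction n)
  case (Suc n)
  moreover have "(T ^^ (m + n)) w = (T ^^ n) ((T ^^ m) w)"
    by (simp add: add.commute[of m] funpow_add)
  ultimately show ?case by (simp add: birkhoff_sum_def)
qed (simp add: birkhoff_sum_def)

text \<open>A Birkhoff sum is an additive cocycle with mean exactly \<open>n\<close> times that of
  \<open>g\<close>, so \<open>subadditive_liminf_ge\<close> for \<open>g\<close> and for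
  \<open>- g\<close> bounds both the liminf and the limsup.\<close>

lemma birkhoff:
  assumes g: "integrable M g"
  shows "AE w in M. (\<lambda>n. birkhoff_sum g n w / real n) \<longlonglongrightarrow> expectation g"
proof -
  have int: "integrable M (birkhoff_sum g n)"
    and ex: "expectation (birkhoff_sum g n) = expectation g * real n" for n
    using integrable_T_funpow[OF g] expectation_T_funpow[of g] g
    by (auto simp: birkhoff_sum_def[abs_def])
  have "AE w in M. \<forall>a<expectation g. \<forall>\<^sub>F n in sequentially. a < birkhoff_sum g n w / real n"
    by (rule subadditive_liminf_ge)
      (use int ex in \<open>auto simp: birkhoff_sum_add, auto simp: birkhoff_sum_def\<close>)
  moreover have "AE w in M. \<forall>a<(- expectation g).
      \<forall>\<^sub>F n in sequentially. a < - birkhoff_sum g n w / real n"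
    by (rule subadditive_liminf_ge)
      (use int ex in \<open>auto simp: birkhoff_sum_add, auto simp: birkhoff_sum_def\<close>)
  ultimately show ?thesis
  proof eventually_elim
    case (elim w)
    show ?case
    proof (rule order_tendstoI)
      fix a assume "expectation g < a"
      then have "- a < - expectation g" by simp
      with elim(2) have "\<forall>\<^sub>F n in sequentially. - a < - birkhoff_sum g n w / real n" by blast
      then show "\<forall>\<^sub>F n in sequentially. birkhoff_sum g n w / real n < a"
        by eventually_elim simp
    qed (use elim(1) in blast)
  qed
qed

end

section \<open>Fekete's lemma and Kingman's theorem for nonnegative cocycles\<close>

lemma fekete_nonneg:
  fixes a :: "nat \<Rightarrow> real"
  assumes sub: "\<And>m n. a (m + n) \<le> a m + a n" and nonneg: "\<And>n. 0 \<le> a n" and a0: "a 0 = 0"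
  shows "(\<lambda>n. a n / real n) \<longlonglongrightarrow> (INF n\<in>{1..}. a n / real n)"
proof (rule order_tendstoI)
  have bdd: "bdd_below ((\<lambda>n. a n / real n) ` {1..})"
    using nonneg by (intro bdd_belowI2[of _ 0]) simp
  fix b assume b: "b < (INF n\<in>{1..}. a n / real n)"
  show "\<forall>\<^sub>F n in sequentially. b < a n / real n"
    by (intro eventually_sequentiallyI[of 1] less_le_trans[OF b] cINF_lower[OF bdd]) auto
next
  have mult: "a (q * k) \<le> real q * a k" for q k
  proof (induction q)
    case (Suc q)
    then show ?case using sub[of k "q * k"] by (simp add: algebra_simps)
  qed (simp add: a0)
  fix b assume "(INF n\<in>{1..}. a n / real n) < b"
  then obtain k where k: "k \<ge> 1" "a k / real k < b"
    by (subst (asm) cINF_less_iff) (auto intro!: bdd_belowI2[of _ 0] nonneg divide_nonneg_nonneg)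
  have "(\<lambda>n. a k / real k + (real k * a 1) / real n) \<longlonglongrightarrow> a k / real k + 0"
    by (intro tendsto_intros lim_const_over_n)
  then have "\<forall>\<^sub>F n in sequentially. a k / real k + (real k * a 1) / real n < b"
    using k by (intro order_tendstoD) auto
  then show "\<forall>\<^sub>F n in sequentially. a n / real n < b"
    using eventually_gt_at_top[of 0]
  proof eventually_elim
    case (elim n)
    have "a n \<le> a (n div k * k) + a (n mod k * 1)"
      using sub[of "n div k * k" "n mod k"] by simp
    also have "\<dots> \<le> real (n div k) * a k + real (n mod k) * a 1"
      by (intro add_mono mult)
    also have "\<dots> \<le> real n / real k * a k + real k * a 1"
      using k by (intro add_mono mult_right_mono nonneg)
        (auto simp: of_nat_div_le_of_nat less_imp_le)
    finally have "a n / real n \<le> (real n / real k * a k + real k * a 1) / real n"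
      by (rule divide_right_mono) simp
    also have "\<dots> = a k / real k + real k * a 1 / real n"
      using elim(2) by (simp add: field_simps)
    finally show ?case using elim(1) by simp
  qed
qed

context ergodic_system
begin

text \<open>Split \<open>[0, n)\<close> into blocks of length \<open>k\<close>, and average over the \<open>k\<close> positions of the blocks.\<close>
lemma subadditive_le_birkhoff_sum:
  fixes f :: "nat \<Rightarrow> 'a \<Rightarrow> real"
  assumes f0: "\<And>w. w \<in> space M \<Longrightarrow> f 0 w = 0"
    and sub: "\<And>m n w. w \<in> space M \<Longrightarrow> f (m + n) w \<le> f m w + f n ((T ^^ m) w)"
    and nonneg: "\<And>n w. w \<in> space M \<Longrightarrow> 0 \<le> f n w"
    and w: "w \<in> space M" and "1 \<le> k" "k \<le> n"
  shows "real k * f n w \<le> real k * birkhoff_sum (f 1) k w + birkhoff_sum (f k) n w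
    + real k * (birkhoff_sum (f 1) n w - birkhoff_sum (f 1) (n - k) w)"
proof -
  have blocks: "f (m * j) v \<le> (\<Sum>q<m. f j ((T ^^ (q * j)) v))" if "v \<in> space M" for m j v
  proof (induction m)
    case (Suc m)
    then show ?case using sub[OF that, of "m * j" j] by (simp add: add.commute)
  qed (simp add: f0 that)
  have unit: "f m v \<le> birkhoff_sum (f 1) m v" if "v \<in> space M" for m v
    using blocks[OF that, of m 1] by (simp add: birkhoff_sum_def)
  have mono: "birkhoff_sum (f 1) m w \<le> birkhoff_sum (f 1) m' w" if "m \<le> m'" for m m'
    unfolding birkhoff_sum_def using that nonneg[OF T_space[OF w]] by (intro sum_mono2) auto
  \<comment> \<open>Number of complete blocks of length \<open>k\<close> after the offset
    \<open>i\<close>; the uncovered head and tail have length at most \<open>k\<close>.\<close>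
  define q where "q i = (n - i) div k" for i
  have q: "i + q i * k \<le> n" "n - k \<le> i + q i * k" if "i < k" for i
  proof -
    have "q i * k \<le> n - i" by (simp add: q_def)
    then show "i + q i * k \<le> n" using that assms by simp
    have "n - i < q i * k + k" unfolding q_def using assms(5) by (simp add: dividend_less_div_times add.commute)
    then show "n - k \<le> i + q i * k" by simp
  qed
  have split: "f n w \<le> birkhoff_sum (f 1) k w + (\<Sum>j<q i. f k ((T ^^ (i + j * k)) w))
      + (birkhoff_sum (f 1) n w - birkhoff_sum (f 1) (n - k) w)" if i: "i < k" for i
  proof -
    let ?v = "(T ^^ i) w" and ?m = "i + q i * k"
    have v: "?v \<in> space M" using T_space w .
    have "f n w \<le> f ?m w + f (n - ?m) ((T ^^ ?m) w)"
      using sub[OF w, of ?m "n - ?m"] q[OF i] by simp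
    also have "f (n - ?m) ((T ^^ ?m) w) \<le> birkhoff_sum (f 1) (n - ?m) ((T ^^ ?m) w)"
      by (intro unit T_space w)
    also have "\<dots> = birkhoff_sum (f 1) n w - birkhoff_sum (f 1) ?m w"
      using birkhoff_sum_add[of "f 1" ?m "n - ?m" w] q[OF i] by simp
    also have "\<dots> \<le> birkhoff_sum (f 1) n w - birkhoff_sum (f 1) (n - k) w"
      using mono q[OF i] by simp
    also have "f ?m w \<le> f i w + f (q i * k) ?v" by (rule sub[OF w])
    also have "f i w \<le> birkhoff_sum (f 1) k w"
      using unit[OF w, of i] mono[of i k] i by simp
    also have "f (q i * k) ?v \<le> (\<Sum>j<q i. f k ((T ^^ (j * k)) ?v))" by (rule blocks[OF v])
    also have "\<dots> = (\<Sum>j<q i. f k ((T ^^ (i + j * k)) w))"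
      by (simp add: add.commute[of i] funpow_add)
    finally show ?thesis by simp
  qed
  have "real k * f n w = (\<Sum>i<k. f n w)" by simp
  also have "\<dots> \<le> (\<Sum>i<k. birkhoff_sum (f 1) k w + (\<Sum>j<q i. f k ((T ^^ (i + j * k)) w))
      + (birkhoff_sum (f 1) n w - birkhoff_sum (f 1) (n - k) w))"
    by (intro sum_mono split) simp
  also have "\<dots> = real k * birkhoff_sum (f 1) k w
      + (\<Sum>i<k. \<Sum>j<q i. f k ((T ^^ (i + j * k)) w))
      + real k * (birkhoff_sum (f 1) n w - birkhoff_sum (f 1) (n - k) w)"
    by (simp add: sum.distrib)
  \<comment> \<open>Offset and block index are the remainder and the quotient modulo
    \<open>k\<close> of the starting time, so each time in \<open>[0, n)\<close> starts at most one
    block.\<close>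
  also have "(\<Sum>i<k. \<Sum>j<q i. f k ((T ^^ (i + j * k)) w)) \<le> birkhoff_sum (f k) n w"
  proof -
    let ?S = "Sigma {..<k} (\<lambda>i. {..<q i})" and ?h = "\<lambda>(i, j). i + j * k"
    have "inj_on ?h ?S"
    proof (rule inj_onI, clarsimp)
      fix i j i' j' assume *: "i + j * k = i' + j' * k" "i < k" "i' < k"
      have "i = (i + j * k) mod k" using *(2) by simp
      also have "\<dots> = i'" unfolding *(1) using *(3) by simp
      finally show "i = i' \<and> j = j'" using * by simp
    qed
    have "?h ` ?S \<subseteq> {..<n}"
    proof clarsimp
      fix i j assume *: "i < k" "j < q i"
      then have "Suc j * k \<le> q i * k" by (intro mult_right_mono) auto
      then show "i + j * k < n" using q(1)[OF *(1)] assms(5) by simp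
    qed
    have "(\<Sum>i<k. \<Sum>j<q i. f k ((T ^^ (i + j * k)) w)) = (\<Sum>p\<in>?S. f k ((T ^^ ?h p) w))"
      by (subst sum.Sigma) (auto simp: split_def)
    also have "\<dots> = (\<Sum>m\<in>?h ` ?S. f k ((T ^^ m) w))"
      by (subst sum.reindex[OF \<open>inj_on ?h ?S\<close>]) simp
    also have "\<dots> \<le> birkhoff_sum (f k) n w"
      unfolding birkhoff_sum_def
      by (rule sum_mono2) (use \<open>?h ` ?S \<subseteq> {..<n}\<close> nonneg[OF T_space[OF w]] in auto)
    finally show ?thesis .
  qed
  finally show ?thesis by simp
qed

text \<open>The liminf is bounded below by \<open>subadditive_liminf_ge\<close>. The limsup is
  bounded above by Birkhoff's theorem for each \<open>f k\<close>, through the averaged blocks. Mean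
  convergence is Scheffe's argument: the negative part of the deviation is bounded, because
  \<open>f\<close> is nonnegative, and the means converge.\<close>

lemma kingman:
  fixes f :: "nat \<Rightarrow> 'a \<Rightarrow> real"
  assumes f0: "\<And>w. w \<in> space M \<Longrightarrow> f 0 w = 0"
    and sub: "\<And>m n w. w \<in> space M \<Longrightarrow> f (m + n) w \<le> f m w + f n ((T ^^ m) w)"
    and nonneg: "\<And>n w. w \<in> space M \<Longrightarrow> 0 \<le> f n w"
    and meas: "\<And>n. f n \<in> borel_measurable M"
    and int1: "integrable M (f 1)"
  shows "\<exists>\<gamma>. converges_to_const M (\<lambda>n w. f n w / real n) \<gamma>"
proof -
  note [measurable] = meas
  have int_sum: "integrable M (birkhoff_sum (f 1) n)" for n
    unfolding birkhoff_sum_def[abs_def] using integrable_T_funpow[OF int1] by auto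
  have unit: "f n w \<le> birkhoff_sum (f 1) n w" if "w \<in> space M" for n w
  proof (induction n)
    case (Suc n)
    then show ?case using sub[OF that, of n 1] by (simp add: birkhoff_sum_def)
  qed (simp add: f0 that birkhoff_sum_def)
  have int: "integrable M (f n)" for n
    by (rule Bochner_Integration.integrable_bound[OF int_sum[of n]])
      (auto intro!: AE_I2 order_trans[OF unit abs_ge_self] simp: nonneg simp del: One_nat_def)
  define a where "a n = expectation (f n)" for n
  define \<gamma> where "\<gamma> = (INF n\<in>{1..}. a n / real n)"
  have a_nonneg: "0 \<le> a n" for n
    unfolding a_def by (intro integral_nonneg_AE AE_I2 nonneg)
  have a0: "a 0 = 0"
  proof -
    have "a 0 = expectation (\<lambda>w. 0)"
      unfolding a_def by (rule Bochner_Integration.integral_cong) (simp_all add: f0)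
    then show ?thesis by simp
  qed
  have a_sub: "a (m + n) \<le> a m + a n" for m n
  proof -
    have "a (m + n) \<le> expectation (\<lambda>w. f m w + f n ((T ^^ m) w))"
      unfolding a_def using sub int integrable_T_funpow[OF int] by (intro integral_mono) auto
    also have "\<dots> = a m + a n"
      unfolding a_def using int integrable_T_funpow[OF int] expectation_T_funpow[OF meas] by auto
    finally show ?thesis .
  qed
  have a_lim: "(\<lambda>n. a n / real n) \<longlonglongrightarrow> \<gamma>"
    unfolding \<gamma>_def by (rule fekete_nonneg[OF a_sub a_nonneg a0])
  have bdd: "bdd_below ((\<lambda>n. a n / real n) ` {1..})"
    using a_nonneg by (intro bdd_belowI2[of _ 0]) simp
  have a_ge: "\<gamma> * real n \<le> a n" for n
  proof (cases "n = 0")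
    case False
    then have "\<gamma> \<le> a n / real n" unfolding \<gamma>_def by (intro cINF_lower[OF bdd]) auto
    then show ?thesis using False by (simp add: field_simps)
  qed (simp add: a0)
  have "0 \<le> \<gamma>"
    unfolding \<gamma>_def by (intro cINF_greatest) (auto intro: a_nonneg divide_nonneg_nonneg)
  have "AE w in M. \<forall>b<\<gamma>. \<forall>\<^sub>F n in sequentially. b < f n w / real n"
    by (rule subadditive_liminf_ge) (use f0 sub int a_ge in \<open>auto simp: a_def\<close>)
  moreover have "AE w in M. \<forall>k. (\<lambda>n. birkhoff_sum (f k) n w / real n) \<longlonglongrightarrow> a k"
    unfolding a_def by (subst AE_all_countable) (intro allI birkhoff int)
  ultimately have lim: "AE w in M. (\<lambda>n. f n w / real n) \<longlonglongrightarrow> \<gamma>"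
    using AE_space
  proof eventually_elim
    case (elim w)
    show ?case
    proof (rule order_tendstoI)
      fix b assume "\<gamma> < b"
      then obtain k where k: "k \<ge> 1" "a k / real k < b"
        using cINF_less_iff[OF _ bdd, of b] unfolding \<gamma>_def by auto
      let ?S = "\<lambda>n. birkhoff_sum (f 1) n w"
      have S: "(\<lambda>n. ?S n / real n) \<longlonglongrightarrow> a 1" using elim by blast
      \<comment> \<open>The boundary term of the block estimate vanishes after division by
        \<open>n\<close>, since both normalized sums tend to \<open>a 1\<close>.\<close>
      have "(\<lambda>n. ?S (n - k) / real (n - k) * (real (n - k) / real n)) \<longlonglongrightarrow> a 1 * 1"
      proof (rule tendsto_mult)
        show "(\<lambda>n. ?S (n - k) / real (n - k)) \<longlonglongrightarrow> a 1"
          by (rule filterlim_compose[OF S filterlim_minus_const_nat_at_top])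
        have "(\<lambda>n. 1 - real k / real n) \<longlonglongrightarrow> 1 - 0"
          by (intro tendsto_intros lim_const_over_n)
        moreover have "\<forall>\<^sub>F n in sequentially. 1 - real k / real n = real (n - k) / real n"
          using eventually_ge_at_top[of k] eventually_gt_at_top[of 0]
          by eventually_elim (simp add: of_nat_diff field_simps)
        ultimately show "(\<lambda>n. real (n - k) / real n) \<longlonglongrightarrow> 1"
          by (simp add: tendsto_cong)
      qed
      moreover have "\<forall>\<^sub>F n in sequentially.
          ?S (n - k) / real (n - k) * (real (n - k) / real n) = ?S (n - k) / real n"
        using eventually_gt_at_top[of k] by eventually_elim simp
      ultimately have "(\<lambda>n. ?S (n - k) / real n) \<longlonglongrightarrow> a 1 * 1"
        by (rule Lim_transform_eventually)
      then have S': "(\<lambda>n. ?S (n - k) / real n) \<longlonglongrightarrow> a 1" by simp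
      have "(\<lambda>n. ?S k / real n + birkhoff_sum (f k) n w / real n / real k
          + (?S n / real n - ?S (n - k) / real n)) \<longlonglongrightarrow> 0 + a k / real k + (a 1 - a 1)"
        using elim(2) k by (intro tendsto_intros lim_const_over_n S S') auto
      then have "\<forall>\<^sub>F n in sequentially. ?S k / real n + birkhoff_sum (f k) n w / real n / real k
          + (?S n / real n - ?S (n - k) / real n) < b"
        using k by (intro order_tendstoD) auto
      then show "\<forall>\<^sub>F n in sequentially. f n w / real n < b"
        using eventually_ge_at_top[of k]
      proof eventually_elim
        case (elim n)
        have "f n w / real n = (real k * f n w) / (real k * real n)" using k by simp
        also have "\<dots> \<le> (real k * ?S k + birkhoff_sum (f k) n w
            + real k * (?S n - ?S (n - k))) / (real k * real n)"
          by (intro divide_right_mono subadditive_le_birkhoff_sum f0 sub nonneg k elim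
              \<open>w \<in> space M\<close>) auto
        also have "\<dots> = ?S k / real n + birkhoff_sum (f k) n w / real n / real k
          + (?S n / real n - ?S (n - k) / real n)"
          using k elim by (simp add: field_simps)
        finally show ?case using elim by simp
      qed
    qed (use elim(1) in blast)
  qed
  \<comment> \<open>Only the negative part is dominated, by \<gamma>; the absolute value is
    recovered from \<open>\<bar>t\<bar> = t + 2 * max 0 (- t)\<close> and
    \<open>a_lim\<close>.\<close>
  have "(\<lambda>n. expectation (\<lambda>w. max 0 (\<gamma> - f n w / real n))) \<longlonglongrightarrow> expectation (\<lambda>w. 0)"
  proof (rule integral_dominated_convergence[where w="\<lambda>_. \<gamma>"])
    show "AE w in M. (\<lambda>n. max 0 (\<gamma> - f n w / real n)) \<longlonglongrightarrow> 0"
      using lim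
    proof eventually_elim
      case (elim w)
      have "(\<lambda>n. max 0 (\<gamma> - f n w / real n)) \<longlonglongrightarrow> max 0 (\<gamma> - \<gamma>)"
        by (intro tendsto_intros elim)
      then show ?case by simp
    qed
    show "AE w in M. norm (max 0 (\<gamma> - f n w / real n)) \<le> \<gamma>" for n
      using nonneg \<open>0 \<le> \<gamma>\<close> by (intro AE_I2) (auto simp: max_def)
  qed simp_all
  then have "(\<lambda>n. (a n / real n - \<gamma>) + 2 * expectation (\<lambda>w. max 0 (\<gamma> - f n w / real n)))
      \<longlonglongrightarrow> (\<gamma> - \<gamma>) + 2 * 0"
    by (intro tendsto_intros a_lim) simp
  moreover have "(a n / real n - \<gamma>) + 2 * expectation (\<lambda>w. max 0 (\<gamma> - f n w / real n))
      = expectation (\<lambda>w. \<bar>f n w / real n - \<gamma>\<bar>)" for n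
  proof -
    have i: "integrable M (\<lambda>w. f n w / real n - \<gamma>)" using int by auto
    have "integrable M (\<lambda>w. max 0 (\<gamma> - f n w / real n))"
      using int by auto
    then have "(a n / real n - \<gamma>) + 2 * expectation (\<lambda>w. max 0 (\<gamma> - f n w / real n))
      = expectation (\<lambda>w. (f n w / real n - \<gamma>) + 2 * max 0 (\<gamma> - f n w / real n))"
      using i int by (simp add: a_def prob_space)
    also have "\<dots> = expectation (\<lambda>w. \<bar>f n w / real n - \<gamma>\<bar>)"
      by (rule Bochner_Integration.integral_cong) (auto simp: max_def)
    finally show ?thesis .
  qed
  ultimately have "(\<lambda>n. expectation (\<lambda>w. \<bar>f n w / real n - \<gamma>\<bar>)) \<longlonglongrightarrow> 0" by simp
  then have "(\<lambda>n. ennreal (expectation (\<lambda>w. \<bar>f n w / real n - \<gamma>\<bar>))) \<longlonglongrightarrow> ennreal 0"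
    by (rule tendsto_ennrealI)
  moreover have "(\<integral>\<^sup>+w. ennreal \<bar>f n w / real n - \<gamma>\<bar> \<partial>M)
      = ennreal (expectation (\<lambda>w. \<bar>f n w / real n - \<gamma>\<bar>))" for n
    using int by (intro nn_integral_eq_integral) auto
  ultimately show ?thesis
    using lim by (auto simp: converges_to_const_def)
qed

end

section \<open>The Varopoulos-Carne inequality\<close>

text \<open>Row sums may be less than 1, so that a walk killed outside a finite set \<open>B\<close>
  is covered. With \<open>B\<close> finite, all inner products are finite sums.\<close>

locale reversible_kernel =
  fixes B :: "'v set" and \<pi> :: "'v \<Rightarrow> real" and p :: "'v \<Rightarrow> 'v \<Rightarrow> real"
  assumes finite_B: "finite B"
    and \<pi>_pos: "u \<in> B \<Longrightarrow> 0 < \<pi> u"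
    and p_nonneg: "0 \<le> p u v"
    and p_sum: "u \<in> B \<Longrightarrow> (\<Sum>v\<in>B. p u v) \<le> 1"
    and p_rev: "u \<in> B \<Longrightarrow> v \<in> B \<Longrightarrow> \<pi> u * p u v = \<pi> v * p v u"
begin

definition Q :: "('v \<Rightarrow> real) \<Rightarrow> 'v \<Rightarrow> real" where
  "Q f u = (\<Sum>v\<in>B. p u v * f v)"

definition ip :: "('v \<Rightarrow> real) \<Rightarrow> ('v \<Rightarrow> real) \<Rightarrow> real" where
  "ip f g = (\<Sum>u\<in>B. \<pi> u * f u * g u)"

lemma Q_add: "Q (\<lambda>u. f u + g u) = (\<lambda>u. Q f u + Q g u)"
  by (simp add: Q_def algebra_simps sum.distrib fun_eq_iff)

lemma Q_diff: "Q (\<lambda>u. f u - g u) = (\<lambda>u. Q f u - Q g u)"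
  by (simp add: Q_def algebra_simps sum_subtractf fun_eq_iff)

lemma Q_mult: "Q (\<lambda>u. a * f u) = (\<lambda>u. a * Q f u)"
  by (simp add: Q_def sum_distrib_left algebra_simps fun_eq_iff)

lemma Q_funpow_add: "(Q ^^ n) (\<lambda>u. f u + g u) = (\<lambda>u. (Q ^^ n) f u + (Q ^^ n) g u)"
  by (induction n) (simp_all add: Q_add)

lemma Q_funpow_mult: "(Q ^^ n) (\<lambda>u. a * f u) = (\<lambda>u. a * (Q ^^ n) f u)"
  by (induction n) (simp_all add: Q_mult)

lemma ip_commute: "ip f g = ip g f"
  by (simp add: ip_def ac_simps)

lemma ip_add: "ip (\<lambda>u. f u + g u) h = ip f h + ip g h"
  by (simp add: ip_def algebra_simps sum.distrib)

lemma ip_diff: "ip (\<lambda>u. f u - g u) h = ip f h - ip g h"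
  by (simp add: ip_def algebra_simps sum_subtractf)

lemma ip_add_right: "ip h (\<lambda>u. f u + g u) = ip h f + ip h g"
  by (simp add: ip_commute[of h] ip_add)

lemma ip_diff_right: "ip h (\<lambda>u. f u - g u) = ip h f - ip h g"
  by (simp add: ip_commute[of h] ip_diff)

lemma Q_self_adjoint: "ip (Q f) g = ip f (Q g)"
proof -
  have "ip (Q f) g = (\<Sum>u\<in>B. \<Sum>v\<in>B. \<pi> u * p u v * f v * g u)"
    by (simp add: ip_def Q_def sum_distrib_left sum_distrib_right ac_simps)
  also have "\<dots> = (\<Sum>v\<in>B. \<Sum>u\<in>B. \<pi> u * p u v * f v * g u)" by (rule sum.swap)
  also have "\<dots> = (\<Sum>v\<in>B. \<Sum>u\<in>B. \<pi> v * p v u * f v * g u)"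
    by (intro sum.cong refl) (simp add: p_rev)
  also have "\<dots> = ip f (Q g)"
    by (simp add: ip_def Q_def sum_distrib_left ac_simps)
  finally show ?thesis .
qed

text \<open>Cauchy-Schwarz on each row, then reversibility turns column sums into row sums, so that
  \<open>p_sum\<close> applies twice.\<close>

lemma Q_contraction: "ip (Q f) (Q f) \<le> ip f f"
proof -
  have cs: "(Q f u)\<^sup>2 \<le> (\<Sum>v\<in>B. p u v * (f v)\<^sup>2)" if "u \<in> B" for u
  proof -
    have "(Q f u)\<^sup>2 = (\<Sum>v\<in>B. sqrt (p u v) * (sqrt (p u v) * f v))\<^sup>2"
      by (simp add: Q_def mult.assoc[symmetric] p_nonneg)
    also have "\<dots> \<le> (\<Sum>v\<in>B. (sqrt (p u v))\<^sup>2) * (\<Sum>v\<in>B. (sqrt (p u v) * f v)\<^sup>2)"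
      by (rule Cauchy_Schwarz_ineq_sum)
    also have "\<dots> = (\<Sum>v\<in>B. p u v) * (\<Sum>v\<in>B. p u v * (f v)\<^sup>2)"
      by (simp add: power_mult_distrib p_nonneg)
    also have "\<dots> \<le> 1 * (\<Sum>v\<in>B. p u v * (f v)\<^sup>2)"
      by (intro mult_right_mono p_sum that sum_nonneg mult_nonneg_nonneg p_nonneg) simp
    finally show ?thesis by simp
  qed
  have "ip (Q f) (Q f) = (\<Sum>u\<in>B. \<pi> u * (Q f u)\<^sup>2)"
    by (simp add: ip_def power2_eq_square ac_simps)
  also have "\<dots> \<le> (\<Sum>u\<in>B. \<pi> u * (\<Sum>v\<in>B. p u v * (f v)\<^sup>2))"
    by (intro sum_mono mult_left_mono cs less_imp_le[OF \<pi>_pos])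
  also have "\<dots> = (\<Sum>u\<in>B. \<Sum>v\<in>B. \<pi> v * p v u * (f v)\<^sup>2)"
    unfolding sum_distrib_left by (intro sum.cong refl) (simp add: p_rev[symmetric])
  also have "\<dots> = (\<Sum>v\<in>B. \<pi> v * (f v)\<^sup>2 * (\<Sum>u\<in>B. p v u))"
    by (subst sum.swap) (simp add: sum_distrib_left sum_distrib_right ac_simps)
  also have "\<dots> \<le> (\<Sum>v\<in>B. \<pi> v * (f v)\<^sup>2 * 1)"
    by (intro sum_mono mult_left_mono p_sum mult_nonneg_nonneg less_imp_le[OF \<pi>_pos]) auto
  also have "\<dots> = ip f f" by (simp add: ip_def power2_eq_square ac_simps)
  finally show ?thesis .
qed

text \<open>
  \<open>cheb f k = (T\<^sub>k(Q) f, U\<^sub>k\<^sub>-\<^sub>1(Q) f)\<close>, with the Chebyshev polynomials of the first and second kind.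
\<close>
primrec cheb :: "('v \<Rightarrow> real) \<Rightarrow> nat \<Rightarrow> ('v \<Rightarrow> real) \<times> ('v \<Rightarrow> real)" where
  "cheb f 0 = (f, \<lambda>_. 0)"
| "cheb f (Suc k) = (case cheb f k of (c, s) \<Rightarrow> (\<lambda>u. Q c u - (s u - Q (Q s) u), \<lambda>u. Q s u + c u))"

text \<open>The Pell equation \<open>T\<^sub>k\<^sup>2 + (1 - X\<^sup>2) U\<^sub>k\<^sub>-\<^sub>1\<^sup>2 = 1\<close>.\<close>
lemma cheb_pell:
  assumes "cheb f k = (c, s)"
  shows "ip c c + ip s s - ip (Q s) (Q s) = ip f f"
  using assms
proof (induction k arbitrary: c s)
  case 0
  then show ?case by (auto simp: ip_def Q_def)
next
  case (Suc k)
  obtain c0 s0 where cs: "cheb f k = (c0, s0)" by fastforce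
  have c: "c = (\<lambda>u. Q c0 u - (s0 u - Q (Q s0) u))" and s: "s = (\<lambda>u. Q s0 u + c0 u)"
    using Suc.prems cs by auto
  have Qs: "Q s = (\<lambda>u. Q (Q s0) u + Q c0 u)" unfolding s by (rule Q_add)
  have comm: "ip s0 (Q c0) = ip (Q c0) s0" "ip (Q (Q s0)) (Q c0) = ip (Q c0) (Q (Q s0))"
    "ip s0 (Q (Q s0)) = ip (Q (Q s0)) s0" "ip (Q s0) c0 = ip c0 (Q s0)"
    by (rule ip_commute)+
  have "ip (Q c0) s0 = ip c0 (Q s0)" "ip (Q (Q s0)) s0 = ip (Q s0) (Q s0)"
    by (rule Q_self_adjoint)+
  moreover have "ip c c = ip (Q c0) (Q c0) + ip s0 s0 + ip (Q (Q s0)) (Q (Q s0))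
      - 2 * ip (Q c0) s0 + 2 * ip (Q c0) (Q (Q s0)) - 2 * ip (Q (Q s0)) s0"
    unfolding c by (simp add: ip_diff ip_diff_right ip_add ip_add_right comm)
  moreover have "ip s s = ip (Q s0) (Q s0) + 2 * ip c0 (Q s0) + ip c0 c0"
    unfolding s by (simp add: ip_add ip_add_right comm)
  moreover have "ip (Q s) (Q s) = ip (Q (Q s0)) (Q (Q s0)) + 2 * ip (Q c0) (Q (Q s0)) + ip (Q c0) (Q c0)"
    unfolding Qs by (simp add: ip_add ip_add_right comm)
  ultimately show ?case using Suc.IH[OF cs] by simp
qed

text \<open>Contraction makes the \<open>U\<close> part of the Pell identity nonnegative, so
  \<open>T\<^sub>k(Q)\<close> is a contraction; this takes the place of the spectral bound
  \<open>\<bar>T\<^sub>k\<bar> \<le> 1\<close> on \<open>[-1, 1]\<close>.\<close>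

lemma ip_cheb_le: "ip (fst (cheb f k)) (fst (cheb f k)) \<le> ip f f"
  using cheb_pell[of f k "fst (cheb f k)" "snd (cheb f k)"] Q_contraction[of "snd (cheb f k)"] by simp

lemma cheb_rec: "fst (cheb f (Suc (Suc k))) u + fst (cheb f k) u = 2 * Q (fst (cheb f (Suc k))) u"
  by (simp add: split_def Q_add Q_diff)

lemma cheb_1: "fst (cheb f (Suc 0)) u = Q f u"
  by (simp add: Q_def)

text \<open>Each application of \<open>Q\<close> reaches one step further, and the two polynomials
  have degrees \<open>k\<close> and \<open>k - 1\<close>. The strict bound on the second component
  pays for its double application of \<open>Q\<close> in the recursion.\<close>

lemma cheb_support:
  fixes d :: "'v \<Rightarrow> nat"
  assumes lip: "\<And>u v. v \<in> B \<Longrightarrow> p u v \<noteq> 0 \<Longrightarrow> d u \<le> Suc (d v)"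
    and f: "\<And>u. f u \<noteq> 0 \<Longrightarrow> d u = 0"
  shows "(fst (cheb f k) u \<noteq> 0 \<longrightarrow> d u \<le> k) \<and> (snd (cheb f k) u \<noteq> 0 \<longrightarrow> d u < k)"
proof (induction k arbitrary: u)
  case 0
  then show ?case using f by simp
next
  case (Suc k)
  have Q: "\<exists>v. d u \<le> Suc (d v) \<and> g v \<noteq> 0" if "Q g u \<noteq> 0" for g u
  proof -
    have "\<not> (\<forall>v\<in>B. p u v * g v = 0)"
      using that unfolding Q_def by (metis (mono_tags) sum.neutral)
    then obtain v where "v \<in> B" "p u v * g v \<noteq> 0" by blast
    then show ?thesis using lip[of v u] by auto
  qed
  show ?case
  proof (intro conjI impI)
    assume "fst (cheb f (Suc k)) u \<noteq> 0"
    then have "Q (fst (cheb f k)) u - (snd (cheb f k) u - Q (Q (snd (cheb f k))) u) \<noteq> 0"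
      by (simp add: split_def)
    then consider "Q (fst (cheb f k)) u \<noteq> 0" | "snd (cheb f k) u \<noteq> 0" | "Q (Q (snd (cheb f k))) u \<noteq> 0"
      by fastforce
    then show "d u \<le> Suc k"
    proof cases
      case 1
      then obtain v where "d u \<le> Suc (d v)" "fst (cheb f k) v \<noteq> 0" using Q by blast
      then show ?thesis using Suc.IH[of v] by simp
    next
      case 2
      then show ?thesis using Suc.IH[of u] by simp
    next
      case 3
      then obtain v v' where "d u \<le> Suc (d v)" "d v \<le> Suc (d v')" "snd (cheb f k) v' \<noteq> 0"
        using Q by blast
      then show ?thesis using Suc.IH[of v'] by simp
    qed
  next
    assume "snd (cheb f (Suc k)) u \<noteq> 0"
    then have "Q (snd (cheb f k)) u + fst (cheb f k) u \<noteq> 0"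
      by (simp add: split_def)
    then consider "Q (snd (cheb f k)) u \<noteq> 0" | "fst (cheb f k) u \<noteq> 0"
      by fastforce
    then show "d u < Suc k"
    proof cases
      case 1
      then obtain v where "d u \<le> Suc (d v)" "snd (cheb f k) v \<noteq> 0" using Q by blast
      then show ?thesis using Suc.IH[of v] by simp
    next
      case 2
      then show ?thesis using Suc.IH[of u] by simp
    qed
  qed
qed

text \<open>
  Since \<open>2 Q T\<^sub>m = T\<^sub>m\<^sub>+\<^sub>1 + T\<^sub>m\<^sub>-\<^sub>1\<close>, the index \<open>m\<close> performs a simple random walk, of which
  \<open>exp (\<lambda> m) + exp (- \<lambda> m)\<close> is an eigenfunction.
\<close>
lemma Q_funpow_cheb_bound:
  fixes C l :: real
  assumes bound: "\<And>m. \<bar>fst (cheb f m) x\<bar> \<le> C" and zero: "\<And>m. m < d \<Longrightarrow> fst (cheb f m) x = 0"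
    and l: "0 \<le> l"
  shows "\<bar>(Q ^^ n) (fst (cheb f m)) x\<bar>
    \<le> C * cosh l ^ n * exp (- l * real d) * (exp (l * real m) + exp (- l * real m))"
proof (induction n arbitrary: m)
  have C: "0 \<le> C" using bound[of 0] by simp
  {
    case 0
    show ?case
    proof (cases "m < d")
      case True
      then show ?thesis using zero C by simp
    next
      case False
      have "1 \<le> exp (- l * real d) * exp (l * real m)"
        using False l by (simp add: exp_add[symmetric] mult_left_mono)
      also have "\<dots> \<le> exp (- l * real d) * (exp (l * real m) + exp (- l * real m))"
        by (intro mult_left_mono) auto
      finally have "C * 1 \<le> C * (exp (- l * real d) * (exp (l * real m) + exp (- l * real m)))"
        using C by (rule mult_left_mono)
      then show ?thesis using bound[of m] by (simp add: mult.assoc)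
    qed
  next
    case (Suc n)
    let ?K = "C * cosh l ^ n * exp (- l * real d)"
    have avg: "\<bar>1/2 * (a + b)\<bar> \<le> 1/2 * (a' + b')" if "\<bar>a\<bar> \<le> a'" "\<bar>b\<bar> \<le> b'" for a b a' b' :: real
      using abs_triangle_ineq[of a b] that by (simp add: abs_mult)
    show ?case
    \<comment> \<open>The index walk is reflected at 0, as
      \<open>T\<^sub>-\<^sub>1 = T\<^sub>1\<close>; the exponential sum is even in \<open>m\<close>
      and so remains an eigenfunction there.\<close>
    proof (cases m)
      case 0
      have "Q (fst (cheb f m)) = fst (cheb f (Suc 0))"
        using cheb_1[of f] by (simp add: 0 fun_eq_iff)
      then have "\<bar>(Q ^^ Suc n) (fst (cheb f m)) x\<bar> = \<bar>(Q ^^ n) (fst (cheb f (Suc 0))) x\<bar>"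
        by (simp add: funpow_swap1)
      also have "\<dots> \<le> ?K * (exp l + exp (- l))"
        using Suc.IH[of "Suc 0"] by simp
      also have "\<dots> = C * cosh l ^ Suc n * exp (- l * real d) * (exp (l * real m) + exp (- l * real m))"
        by (simp add: 0 cosh_field_def)
      finally show ?thesis .
    next
      case m: (Suc j)
      have "Q (fst (cheb f m)) = (\<lambda>u. 1/2 * (fst (cheb f (Suc m)) u + fst (cheb f j) u))"
        unfolding m cheb_rec by (rule ext) simp
      then have "(Q ^^ Suc n) (fst (cheb f m)) x
          = 1/2 * ((Q ^^ n) (fst (cheb f (Suc m))) x + (Q ^^ n) (fst (cheb f j)) x)"
        unfolding funpow_Suc_right o_def by (simp only: Q_funpow_mult Q_funpow_add)
      also have "\<bar>\<dots>\<bar> \<le> 1/2 * (?K * (exp (l * real (Suc m)) + exp (- l * real (Suc m)))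
          + ?K * (exp (l * real j) + exp (- l * real j)))"
        by (intro avg Suc.IH)
      also have "\<dots> = C * cosh l ^ Suc n * exp (- l * real d) * (exp (l * real m) + exp (- l * real m))"
      proof -
        have "exp (l * real (Suc m)) + exp (- l * real (Suc m)) + (exp (l * real j) + exp (- l * real j))
            = (exp l + exp (- l)) * (exp (l * real m) + exp (- l * real m))"
          by (simp add: m distrib_left distrib_right exp_add[symmetric] algebra_simps)
        note eq = this
        have "1/2 * (?K * (exp (l * real (Suc m)) + exp (- l * real (Suc m)))
          + ?K * (exp (l * real j) + exp (- l * real j)))
          = 1/2 * ?K * ((exp l + exp (- l)) * (exp (l * real m) + exp (- l * real m)))"
          unfolding eq[symmetric] by (simp only: distrib_left mult.assoc)
        also have "\<dots> = C * cosh l ^ Suc n * exp (- l * real d) * (exp (l * real m) + exp (- l * real m))"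
          by (simp add: cosh_field_def algebra_simps)
        finally show ?thesis .
      qed
      finally show ?thesis .
    qed
  }
qed

text \<open>\<open>indicator {y}\<close> is \<open>T\<^sub>0(Q)\<close> of itself, with square norm
  \<open>\<pi> y\<close>. The contraction bounds \<open>T\<^sub>m(Q)\<close> of it at
  \<open>x\<close> by the square root of \<open>\<pi> y / \<pi> x\<close>, and finite propagation
  makes it vanish for \<open>m < d x\<close>. The factor 2 is the exponential sum at
  \<open>m = 0\<close>.\<close>

lemma varopoulos_carne_kernel:
  fixes d :: "'v \<Rightarrow> nat" and l :: real
  assumes lip: "\<And>u v. v \<in> B \<Longrightarrow> p u v \<noteq> 0 \<Longrightarrow> d u \<le> Suc (d v)"
    and "x \<in> B" "y \<in> B" "d y = 0" "0 \<le> l"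
  shows "\<bar>(Q ^^ n) (indicator {y}) x\<bar> \<le> 2 * sqrt (\<pi> y / \<pi> x) * cosh l ^ n * exp (- l * real (d x))"
proof -
  let ?f = "indicator {y} :: 'v \<Rightarrow> real"
  have "\<bar>fst (cheb ?f m) x\<bar> \<le> sqrt (\<pi> y / \<pi> x)" for m
  proof (rule real_le_rsqrt)
    let ?c = "fst (cheb ?f m)"
    have "\<pi> x * (?c x)\<^sup>2 \<le> (\<Sum>u\<in>B. \<pi> u * (?c u)\<^sup>2)"
      by (rule member_le_sum[OF \<open>x \<in> B\<close> _ finite_B])
        (simp add: less_imp_le[OF \<pi>_pos])
    also have "\<dots> = ip ?c ?c" by (simp add: ip_def power2_eq_square ac_simps)
    also have "\<dots> \<le> ip ?f ?f" by (rule ip_cheb_le)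
    also have "\<dots> = \<pi> y"
      using \<open>y \<in> B\<close> finite_B
      by (simp add: ip_def indicator_def if_distrib sum.If_cases)
    finally show "\<bar>?c x\<bar>\<^sup>2 \<le> \<pi> y / \<pi> x"
      using \<pi>_pos[OF \<open>x \<in> B\<close>] by (simp add: field_simps)
  qed
  moreover have "fst (cheb ?f m) x = 0" if "m < d x" for m
    using cheb_support[of d ?f m x] lip that \<open>d y = 0\<close> by (auto simp: indicator_def)
  ultimately have "\<bar>(Q ^^ n) (fst (cheb ?f 0)) x\<bar> \<le> sqrt (\<pi> y / \<pi> x) * cosh l ^ n
      * exp (- l * real (d x)) * (exp (l * real 0) + exp (- l * real 0))"
    using \<open>0 \<le> l\<close> by (intro Q_funpow_cheb_bound) auto
  then show ?thesis by simp
qed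

end

section \<open>The Varopoulos-Carne inequality for the walk on a graph\<close>

lemma finite_set_pmf_step: "finite (set_pmf (step G u))"
  by (simp add: step_def)

lemma finite_set_pmf_steps: "finite (set_pmf (steps G n u))"
  by (induction n arbitrary: u) (simp_all add: finite_set_pmf_step)

lemma set_pmf_steps_verts:
  assumes "connected_graph G" "u \<in> verts G"
  shows "set_pmf (steps G n u) \<subseteq> verts G"
  using graph_iso_steps[OF assms(1,1) graph_iso_id assms(2)] by simp

lemma gdist_le: "((\<lambda>a b. b \<in># nbrs G a) ^^ n) u v \<Longrightarrow> gdist G u v \<le> n"
  unfolding gdist_def by (rule Least_le)

lemma gdist_step_le:
  assumes "connected_graph G" "v \<in> verts G" "y \<in> verts G" "v \<in> set_pmf (step G u)"
  shows "gdist G u y \<le> Suc (gdist G v y)"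
proof (cases "nbrs G u = {#}")
  case True
  then show ?thesis using assms(4) by (simp add: step_def)
next
  case False
  then have "v \<in># nbrs G u" using assms(4) by (simp add: step_def)
  then have "((\<lambda>a b. b \<in># nbrs G a) ^^ Suc (gdist G v y)) u y"
    using gdist_attained[OF assms(1-3)] by (rule relpowp_Suc_I2)
  then show ?thesis by (rule gdist_le)
qed

text \<open>
  The reversible measure of the walk is the degree, except at an isolated vertex, where the walk
  stays put and the degree has to be replaced by a positive number.
\<close>
definition weight :: "graph \<Rightarrow> nat \<Rightarrow> real" where
  "weight G u = real (max 1 (size (nbrs G u)))"

lemma weight_pos: "0 < weight G u"
  by (simp add: weight_def)

lemma step_reversible:
  assumes "connected_graph G"
  shows "weight G u * pmf (step G u) v = weight G v * pmf (step G v) u"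
proof -
  have *: "weight G u * pmf (step G u) v = real (count (nbrs G u) v)" if "u \<noteq> v" for u v
  proof (cases "nbrs G u = {#}")
    case True
    then show ?thesis using that by (simp add: step_def)
  next
    case False
    then have "0 < size (nbrs G u)" using nonempty_has_size by blast
    then have "weight G u = real (size (nbrs G u))" by (simp add: weight_def max_def)
    with weight_pos[of G u] show ?thesis using False by (simp add: step_def)
  qed
  show ?thesis
  proof (cases "u = v")
    case False
    then show ?thesis using *[of u v] *[of v u] assms by (simp add: connected_graph_def)
  qed simp
qed

text \<open>\<open>B\<close> is the finite set of points reachable from \<open>x\<close> in at most
  \<open>n\<close> steps. Killing outside \<open>B\<close> is invisible up to time \<open>n\<close>,
  so \<open>Q ^^ n\<close> gives the true transition probability.\<close>

lemma varopoulos_carne: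
  assumes G: "connected_graph G" and x: "x \<in> verts G" and y: "y \<in> verts G" and "0 \<le> l"
  shows "pmf (steps G n x) y
    \<le> 2 * sqrt (weight G y / weight G x) * cosh l ^ n * exp (- l * real (gdist G x y))"
proof -
  define B where "B = (\<Union>j\<le>n. set_pmf (steps G j x))"
  show ?thesis
  proof (cases "y \<in> B")
    case False
    then have "pmf (steps G n x) y = 0" by (auto simp: B_def pmf_eq_0_set_pmf)
    then show ?thesis using weight_pos by (simp add: less_imp_le)
  next
    case True
    have verts: "B \<subseteq> verts G" using set_pmf_steps_verts[OF G x] by (auto simp: B_def)
    interpret reversible_kernel B "weight G" "\<lambda>u v. pmf (step G u) v"
    proof
      show fin: "finite B" by (simp add: B_def finite_set_pmf_steps)
      show "(\<Sum>v\<in>B. pmf (step G u) v) \<le> 1" for u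
        using measure_pmf.prob_le_1[of "step G u" B] measure_measure_pmf_finite[OF fin] by metis
    qed (simp_all add: weight_pos step_reversible[OF G])
    \<comment> \<open>The hypothesis on all times up to \<open>k\<close> is inherited by the
      possible successors of \<open>u\<close>, with one step less.\<close>
    have Q_steps: "(Q ^^ k) (indicator {y}) u = pmf (steps G k u) y"
      if "\<forall>j\<le>k. set_pmf (steps G j u) \<subseteq> B" for k u
      using that
    proof (induction k arbitrary: u)
      case 0
      then show ?case by (simp add: indicator_def)
    next
      case (Suc k)
      have sub: "set_pmf (steps G j v) \<subseteq> B" if "v \<in> set_pmf (step G u)" "j \<le> k" for v j
        using Suc.prems[rule_format, of "Suc j"] that by auto
      have "(Q ^^ Suc k) (indicator {y}) u = (\<Sum>v\<in>B. pmf (step G u) v * (Q ^^ k) (indicator {y}) v)"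
        by (simp add: Q_def)
      also have "\<dots> = (\<Sum>v\<in>B. pmf (steps G k v) y * pmf (step G u) v)"
      proof (rule sum.cong[OF refl])
        fix v
        show "pmf (step G u) v * (Q ^^ k) (indicator {y}) v = pmf (steps G k v) y * pmf (step G u) v"
          using Suc.IH[of v] sub[of v] by (cases "v \<in> set_pmf (step G u)") (auto simp: pmf_eq_0_set_pmf)
      qed
      also have "\<dots> = (\<integral>v. pmf (steps G k v) y \<partial>measure_pmf (step G u))"
        by (rule integral_measure_pmf_real[symmetric, OF finite_B])
          (use sub[of _ 0] in auto)
      also have "\<dots> = pmf (steps G (Suc k) u) y" by (simp add: pmf_bind)
      finally show ?case .
    qed
    have "\<bar>(Q ^^ n) (indicator {y}) x\<bar>
        \<le> 2 * sqrt (weight G y / weight G x) * cosh l ^ n * exp (- l * real (gdist G x y))"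
    proof (rule varopoulos_carne_kernel[of "\<lambda>u. gdist G u y"])
      show "gdist G u y \<le> Suc (gdist G v y)" if "v \<in> B" "pmf (step G u) v \<noteq> 0" for u v
        using that verts by (intro gdist_step_le[OF G _ y]) (auto simp: set_pmf_iff)
      show "x \<in> B" unfolding B_def by (rule UN_I[of 0]) auto
      show "gdist G y y = 0" using gdist_le[of 0 G y y] by simp
    qed fact+
    moreover have "(Q ^^ n) (indicator {y}) x = pmf (steps G n x) y"
      by (rule Q_steps) (auto simp: B_def)
    ultimately show ?thesis by simp
  qed
qed

section \<open>The Gaussian bound for the hyperbolic cosine\<close>

lemma tanh_le_self:
  fixes t :: real
  assumes "0 \<le> t"
  shows "tanh t \<le> t"
proof -
  have "0 - tanh 0 \<le> t - tanh t"
  proof (rule DERIV_nonneg_imp_nondecreasing[OF assms])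
    fix s :: real
    have "((\<lambda>s. s - tanh s) has_real_derivative 1 - (1 - tanh s ^ 2)) (at s)"
      by (rule derivative_eq_intros refl | simp)+
    then show "\<exists>y. ((\<lambda>s. s - tanh s) has_real_derivative y) (at s) \<and> 0 \<le> y"
      by (intro exI[of _ "1 - (1 - tanh s ^ 2)"]) simp
  qed
  then show ?thesis by simp
qed

lemma cosh_le_exp_half_square:
  fixes t :: real
  assumes "0 \<le> t"
  shows "cosh t \<le> exp (t\<^sup>2 / 2)"
proof -
  have "0\<^sup>2 / 2 - ln (cosh 0) \<le> t\<^sup>2 / 2 - ln (cosh t)"
  proof (rule DERIV_nonneg_imp_nondecreasing[OF assms])
    fix s :: real assume "0 \<le> s"
    have "((\<lambda>s. s\<^sup>2 / 2 - ln (cosh s)) has_real_derivative s - tanh s) (at s)"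
      by (rule derivative_eq_intros refl | simp add: cosh_real_pos tanh_def)+
    then show "\<exists>y. ((\<lambda>s. s\<^sup>2 / 2 - ln (cosh s)) has_real_derivative y) (at s) \<and> 0 \<le> y"
      using tanh_le_self[OF \<open>0 \<le> s\<close>] by (intro exI[of _ "s - tanh s"]) simp
  qed
  then have "ln (cosh t) \<le> t\<^sup>2 / 2" by simp
  moreover have "cosh t = exp (ln (cosh t))" by (simp add: cosh_real_pos)
  ultimately show ?thesis by (metis exp_le_cancel_iff)
qed

section \<open>Finite-dimensional distributions of the walk\<close>

text \<open>Law of the first \<open>n + 1\<close> vertices. Lists form a countable type, so these
  laws are probability mass functions; the lists grow at the end, as the kernels of
  \<open>chain_law\<close> do.\<close>

primrec walk :: "graph \<Rightarrow> nat \<Rightarrow> nat \<Rightarrow> nat list pmf" where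
  "walk G x 0 = return_pmf [x]"
| "walk G x (Suc n) = bind_pmf (walk G x n) (\<lambda>l. map_pmf (\<lambda>v. l @ [v]) (step G (last l)))"

text \<open>The index set \<open>J\<close> is arbitrary because both the infinite product and the
  finite windows of the Ionescu-Tulcea construction are used.\<close>

lemma measurable_map_upt [measurable]:
  assumes "{0..<n} \<subseteq> J"
  shows "(\<lambda>\<omega>. map \<omega> [0..<n]) \<in> (\<Pi>\<^sub>M i\<in>J. count_space (UNIV :: nat set)) \<rightarrow>\<^sub>M count_space UNIV"
proof -
  have "(\<lambda>\<omega>. map \<omega> [0..<n]) -` {l} \<inter> space (\<Pi>\<^sub>M i\<in>J. count_space (UNIV :: nat set))
      \<in> sets (\<Pi>\<^sub>M i\<in>J. count_space (UNIV :: nat set))" for l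
  proof (cases "length l = n")
    case True
    have "map \<omega> [0..<n] = l \<longleftrightarrow> (\<forall>i\<in>{0..<n}. \<omega> i = l ! i)" for \<omega>
      by (subst list_eq_iff_nth_eq) (auto simp: True)
    then have "(\<lambda>\<omega>. map \<omega> [0..<n]) -` {l} \<inter> space (\<Pi>\<^sub>M i\<in>J. count_space (UNIV :: nat set))
        = {\<omega> \<in> space (\<Pi>\<^sub>M i\<in>J. count_space UNIV). \<forall>i\<in>{0..<n}. \<omega> i = l ! i}"
      by blast
    also have "\<dots> \<in> sets (\<Pi>\<^sub>M i\<in>J. count_space (UNIV :: nat set))"
    proof (rule sets.sets_Collect_finite_All)
      fix i assume "i \<in> {0..<n}"
      then have "(\<lambda>\<omega>. \<omega> i) \<in> (\<Pi>\<^sub>M i\<in>J. count_space (UNIV :: nat set)) \<rightarrow>\<^sub>M count_space UNIV"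
        using assms by (intro measurable_component_singleton) auto
      then have "(\<lambda>\<omega>. \<omega> i) -` {l ! i} \<inter> space (\<Pi>\<^sub>M i\<in>J. count_space UNIV)
          \<in> sets (\<Pi>\<^sub>M i\<in>J. count_space (UNIV :: nat set))"
        by (rule measurable_sets) simp
      also have "(\<lambda>\<omega>. \<omega> i) -` {l ! i} \<inter> space (\<Pi>\<^sub>M i\<in>J. count_space UNIV)
          = {\<omega> \<in> space (\<Pi>\<^sub>M i\<in>J. count_space UNIV). \<omega> i = l ! i}" by blast
      finally show "{\<omega> \<in> space (\<Pi>\<^sub>M i\<in>J. count_space UNIV). \<omega> i = l ! i}
          \<in> sets (\<Pi>\<^sub>M i\<in>J. count_space (UNIV :: nat set))" .
    qed simp
    finally show ?thesis .
  next
    case False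
    then have "(\<lambda>\<omega>. map \<omega> [0..<n]) -` {l} = {}" by auto
    then show ?thesis by simp
  qed
  then show ?thesis
    unfolding measurable_count_space_eq2_countable by simp
qed

lemma prob_space_chain_law: "prob_space (chain_law G x)"
proof -
  interpret IT: Ionescu_Tulcea "chain_kernel G x" "\<lambda>_. count_space UNIV"
    by (rule Ionescu_Tulcea_chain)
  \<comment> \<open>The marginal on the empty index set already carries the total mass.\<close>
  have "prob_space (distr IT.PF.lim (\<Pi>\<^sub>M i\<in>{}. count_space UNIV) (\<lambda>\<omega>. restrict \<omega> {}))"
    unfolding IT.distr_lim[OF finite.emptyI] by (rule IT.PF.prob_space_P) auto
  then show ?thesis
    unfolding chain_law_def
    by (rule prob_space_distrD[rotated])
      (auto simp: measurable_cong_sets[OF IT.PF.sets_lim refl] intro!: measurable_restrict_subset)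
qed

lemma sets_chain_law [measurable_cong]:
  "sets (chain_law G x) = sets (\<Pi>\<^sub>M i\<in>UNIV. count_space UNIV)"
proof -
  interpret IT: Ionescu_Tulcea "chain_kernel G x" "\<lambda>_. count_space UNIV"
    by (rule Ionescu_Tulcea_chain)
  show ?thesis unfolding chain_law_def by (rule IT.PF.sets_lim)
qed

lemma distr_chain_law_walk:
  "distr (chain_law G x) (count_space UNIV) (\<lambda>\<omega>. map \<omega> [0..<Suc n]) = measure_pmf (walk G x n)"
proof -
  interpret IT: Ionescu_Tulcea "chain_kernel G x" "\<lambda>_. count_space UNIV"
    by (rule Ionescu_Tulcea_chain)
  let ?M = "\<lambda>J :: nat set. \<Pi>\<^sub>M i\<in>J. count_space (UNIV :: nat set)"
  let ?C = "\<lambda>n. IT.C 0 n (\<lambda>_. undefined)"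
  define D where "D n = distr (?C n) (count_space UNIV) (\<lambda>\<omega>. map \<omega> [0..<n])" for n
  \<comment> \<open>The initial vertex counts as the transition out of the empty list, in agreement
    with \<open>chain_kernel\<close> at index 0. This shifts the count by one:
    \<open>walk G x n\<close> is \<open>D (Suc n)\<close>.\<close>
  define K where "K l = map_pmf (\<lambda>v. l @ [v]) (if l = [] then return_pmf x else step G (last l))" for l
  have u: "(\<lambda>_. undefined) \<in> space (?M {0..<0})" by (simp add: space_PiM)
  have sets_C: "sets (?C n) = sets (?M {0..<n})" for n
    using IT.sets_C[OF u] by simp
  have up_to: "IT.up_to {0..<n} = n" for n
    using IT.up_to_iff_Ico[of "{0..<n}" n] IT.up_to[of "{0..<n}"] by (cases n) auto
  have lim: "distr (chain_law G x) (count_space UNIV) (\<lambda>\<omega>. map \<omega> [0..<n]) = D n" for n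
  proof -
    have r: "restrict f {0..<n} = f" if "f \<in> space (?M {0..<n})" for f
      using that by (auto simp: space_PiM PiE_def extensional_restrict)
    have "distr (chain_law G x) (count_space UNIV) (\<lambda>\<omega>. map \<omega> [0..<n])
        = distr (distr IT.PF.lim (?M {0..<n}) (\<lambda>\<omega>. restrict \<omega> {0..<n})) (count_space UNIV) (\<lambda>\<omega>. map \<omega> [0..<n])"
      unfolding chain_law_def
      by (subst distr_distr) (auto simp: measurable_cong_sets[OF IT.PF.sets_lim] comp_def
          intro!: measurable_restrict_subset distr_cong)
    also have "\<dots> = distr (IT.CI {0..<n}) (count_space UNIV) (\<lambda>\<omega>. map \<omega> [0..<n])"
      by (subst IT.distr_lim) auto
    also have "IT.CI {0..<n} = distr (?C n) (?M {0..<n}) (\<lambda>f. f)"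
      unfolding IT.CI_def up_to
      by (rule distr_cong) (auto simp: r sets_eq_imp_space_eq[OF sets_C])
    also have "\<dots> = ?C n" by (rule distr_id2) (simp add: sets_C)
    finally show ?thesis by (simp add: D_def)
  qed
  have D_Suc: "D (Suc n) = D n \<bind> (\<lambda>l. measure_pmf (K l))" for n
  proof -
    have ne: "space (?C n) \<noteq> {}" by (simp add: sets_eq_imp_space_eq[OF sets_C])
    have "D (Suc n) = distr (?C n \<bind> IT.eP n) (count_space UNIV) (\<lambda>\<omega>. map \<omega> [0..<Suc n])"
      by (simp add: D_def)
    also have "\<dots> = ?C n \<bind> (\<lambda>\<omega>. distr (IT.eP n \<omega>) (count_space UNIV) (\<lambda>\<omega>. map \<omega> [0..<Suc n]))"
      by (rule distr_bind[OF _ ne, of _ "?M {0..<Suc n}"])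
        (auto simp: measurable_cong_sets[OF sets_C refl] simp del: upt_Suc)
    also have "\<dots> = ?C n \<bind> (\<lambda>\<omega>. measure_pmf (K (map \<omega> [0..<n])))"
    proof (rule bind_cong[OF refl])
      fix \<omega> assume "\<omega> \<in> space (?C n)"
      then have \<omega>: "\<omega> \<in> space (?M {0..<n})" by (simp add: sets_eq_imp_space_eq[OF sets_C])
      have "fun_upd \<omega> n \<in> count_space UNIV \<rightarrow>\<^sub>M ?M {0..<Suc n}"
        using \<omega> by (auto simp: space_PiM PiE_iff extensional_def)
      then have "distr (IT.eP n \<omega>) (count_space UNIV) (\<lambda>\<omega>. map \<omega> [0..<Suc n])
          = distr (chain_kernel G x n \<omega>) (count_space UNIV) (\<lambda>v. map (fun_upd \<omega> n v) [0..<Suc n])"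
        unfolding IT.eP_def
        by (subst distr_distr) (auto simp: chain_kernel_def comp_def simp del: upt_Suc)
      also have "(\<lambda>v. map (fun_upd \<omega> n v) [0..<Suc n]) = (\<lambda>v. map \<omega> [0..<n] @ [v])"
        by (auto simp: fun_eq_iff)
      also have "distr (chain_kernel G x n \<omega>) (count_space UNIV) \<dots> = measure_pmf (K (map \<omega> [0..<n]))"
        by (cases n) (simp_all add: chain_kernel_def K_def map_pmf_rep_eq[symmetric])
      finally show "distr (IT.eP n \<omega>) (count_space UNIV) (\<lambda>\<omega>. map \<omega> [0..<Suc n])
          = measure_pmf (K (map \<omega> [0..<n]))" .
    qed
    also have "\<dots> = D n \<bind> (\<lambda>l. measure_pmf (K l))"
      unfolding D_def
      by (rule bind_distr[symmetric, OF _ _ ne, of _ _ _ "count_space UNIV"])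
        (auto simp: measurable_cong_sets[OF sets_C refl] measure_pmf_in_subprob_algebra)
    finally show ?thesis .
  qed
  \<comment> \<open>Nonemptiness is carried along because \<open>K\<close> follows
    \<open>step\<close> only on nonempty lists.\<close>
  have "D (Suc n) = measure_pmf (walk G x n) \<and> (\<forall>l\<in>set_pmf (walk G x n). l \<noteq> [])"
  proof (induction n)
    case 0
    have "D 0 = measure_pmf (return_pmf [])"
      by (simp add: D_def distr_return return_pmf.rep_eq u[simplified])
    then show ?case
      unfolding D_Suc by (simp add: measure_pmf_bind[symmetric] bind_return_pmf K_def)
  next
    case (Suc n)
    then have "D (Suc (Suc n)) = measure_pmf (bind_pmf (walk G x n) K)"
      unfolding D_Suc[of "Suc n"] by (simp add: measure_pmf_bind)
    also have "bind_pmf (walk G x n) K = walk G x (Suc n)"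
      unfolding walk.simps using Suc by (intro bind_pmf_cong) (auto simp: K_def)
    finally show ?case using Suc by auto
  qed
  then show ?thesis unfolding lim by blast
qed

lemma length_walk: "l \<in> set_pmf (walk G x n) \<Longrightarrow> length l = Suc n"
  by (induction n arbitrary: l) auto

lemma hd_walk: "l \<in> set_pmf (walk G x n) \<Longrightarrow> l ! 0 = x"
  by (induction n arbitrary: l) (auto simp: nth_append, metis length_walk list.size(3) nat.distinct(1))

lemma steps_Suc_right: "steps G (Suc n) u = bind_pmf (steps G n u) (step G)"
proof (induction n arbitrary: u)
  case 0
  have "steps G 0 = return_pmf" by (simp add: fun_eq_iff)
  then show ?case by (simp add: bind_return_pmf bind_return_pmf')
next
  case (Suc n)
  have "steps G (Suc (Suc n)) u = bind_pmf (step G u) (steps G (Suc n))" by simp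
  also have "\<dots> = bind_pmf (step G u) (\<lambda>v. bind_pmf (steps G n v) (step G))"
    by (intro bind_pmf_cong refl Suc)
  finally show ?case by (simp add: bind_assoc_pmf)
qed

lemma map_last_walk: "map_pmf last (walk G x n) = steps G n x"
proof (induction n)
  case (Suc n)
  have "map_pmf last (walk G x (Suc n)) = bind_pmf (map_pmf last (walk G x n)) (step G)"
    by (simp add: map_bind_pmf bind_map_pmf pmf.map_comp o_def)
  then show ?case using Suc by (simp only: steps_Suc_right)
qed simp

lemma AE_chain_law_walk:
  "(AE \<omega> in chain_law G x. P (map \<omega> [0..<Suc n])) \<longleftrightarrow> (\<forall>l\<in>set_pmf (walk G x n). P l)"
proof -
  have "(AE \<omega> in chain_law G x. P (map \<omega> [0..<Suc n]))
      \<longleftrightarrow> (AE l in distr (chain_law G x) (count_space UNIV) (\<lambda>\<omega>. map \<omega> [0..<Suc n]). P l)"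
    by (rule AE_distr_iff[symmetric])
      (auto simp: measurable_cong_sets[OF sets_chain_law refl] simp del: upt_Suc)
  then show ?thesis unfolding distr_chain_law_walk AE_measure_pmf_iff .
qed

lemma AE_chain_law_path:
  assumes "x \<in> verts G"
  shows "AE \<omega> in chain_law G x. \<omega> 0 = x \<and> is_path G \<omega>"
proof -
  have "AE \<omega> in chain_law G x. map \<omega> [0..<Suc 0] ! 0 = x"
    by (subst AE_chain_law_walk) simp
  moreover have "AE \<omega> in chain_law G x. \<forall>n. \<omega> (Suc n) \<in> set_pmf (step G (\<omega> n))"
  proof (subst AE_all_countable, rule allI)
    fix n
    have "l ! Suc n \<in> set_pmf (step G (l ! n))" if walk: "l \<in> set_pmf (walk G x (Suc n))" for l
    proof -
      obtain l' v where l: "l = l' @ [v]" "l' \<in> set_pmf (walk G x n)" "v \<in> set_pmf (step G (last l'))"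
        using walk by auto
      moreover have "length l' = Suc n" using l(2) by (rule length_walk)
      moreover from this have "last l' = l' ! n" by (subst last_conv_nth) auto
      ultimately show ?thesis by (simp add: nth_append)
    qed
    then have "AE \<omega> in chain_law G x. map \<omega> [0..<Suc (Suc n)] ! Suc n
        \<in> set_pmf (step G (map \<omega> [0..<Suc (Suc n)] ! n))"
      by (subst AE_chain_law_walk) auto
    then show "AE \<omega> in chain_law G x. \<omega> (Suc n) \<in> set_pmf (step G (\<omega> n))"
      by (simp add: nth_append)
  qed
  ultimately show ?thesis
    by eventually_elim (use assms in \<open>auto simp: is_path_def\<close>)
qed

lemma distr_chain_law_steps:
  "distr (chain_law G x) (count_space UNIV) (\<lambda>\<omega>. \<omega> n) = measure_pmf (steps G n x)"
proof -
  have "measure_pmf (steps G n x)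
      = distr (distr (chain_law G x) (count_space UNIV) (\<lambda>\<omega>. map \<omega> [0..<Suc n])) (count_space UNIV) last"
    by (simp only: distr_chain_law_walk map_pmf_rep_eq[symmetric] map_last_walk)
  also have "\<dots> = distr (chain_law G x) (count_space UNIV) (\<lambda>\<omega>. \<omega> n)"
    by (subst distr_distr)
      (auto simp: measurable_cong_sets[OF sets_chain_law refl] comp_def simp del: upt_Suc,
       simp add: comp_def)
  finally show ?thesis by simp
qed

section \<open>Balls and representatives\<close>

lemma path_iso_refl: "path_iso (G, \<omega>) (G, \<omega>) \<longleftrightarrow> connected_graph G \<and> is_path G \<omega>"
  using graph_iso_id by (auto simp: path_iso_def intro!: exI[of _ id])

lemma rep_path_graphE:
  obtains G \<omega> where "rep_path_graph w = (G, \<omega>)" "w = abs_path_graph (G, \<omega>)"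
    "connected_graph G" "is_path G \<omega>"
proof -
  obtain G \<omega> where rep: "rep_path_graph w = (G, \<omega>)" by fastforce
  have "path_iso (G, \<omega>) (G, \<omega>)"
    using Quotient_rep_reflp[OF Quotient_path_graph, of w] by (simp add: rep)
  moreover have "w = abs_path_graph (G, \<omega>)"
    using Quotient_abs_rep[OF Quotient_path_graph, of w] by (simp add: rep)
  ultimately show ?thesis using that rep by (simp add: path_iso_refl)
qed

lemma rep_rooted_graphE:
  obtains G x where "rep_rooted_graph g = (G, x)" "g = abs_rooted_graph (G, x)"
    "connected_graph G" "x \<in> verts G"
proof -
  obtain G x where rep: "rep_rooted_graph g = (G, x)" by fastforce
  have "rooted_iso (G, x) (G, x)"
    using Quotient_rep_reflp[OF Quotient_rooted_graph, of g] by (simp add: rep)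
  moreover have "g = abs_rooted_graph (G, x)"
    using Quotient_abs_rep[OF Quotient_rooted_graph, of g] by (simp add: rep)
  ultimately show ?thesis using that rep by (simp add: rooted_iso_def)
qed

lemma rooted_iso_refl: "rooted_iso (G, x) (G, x) \<longleftrightarrow> connected_graph G \<and> x \<in> verts G"
  using graph_iso_id by (auto simp: rooted_iso_def intro!: exI[of _ id])

text \<open>\<open>chain_law\<close> lives on all sequences of labels, also on those that are not
  paths. These are related to nothing, so the abstraction function of the partial quotient sends
  them all to one default value. This settles their share in the measurability of
  \<open>abs_path_graph\<close>.\<close>

lemma abs_path_graph_not_path:
  assumes "\<not> is_path G \<omega>" "\<not> is_path G \<eta>"
  shows "abs_path_graph (G, \<omega>) = abs_path_graph (G, \<eta>)"
proof -
  have "Collect (path_iso (G, \<omega>)) = Collect (path_iso (G, \<eta>))"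
    using assms by (auto simp: path_iso_def)
  moreover have "quot_type path_iso Abs_path_graph rep"
    if "rep = Rep_path_graph" for rep
    using that part_equivp_path_iso type_definition.Rep[OF type_definition_path_graph]
      type_definition.Rep_inverse[OF type_definition_path_graph]
      type_definition.Abs_inverse[OF type_definition_path_graph]
      type_definition.Rep_inject[OF type_definition_path_graph]
    by (intro quot_type.intro) auto
  ultimately show ?thesis
    by (simp add: abs_path_graph_def quot_type.abs_def)
qed

lemma gdist_self: "gdist G x x = 0"
  using gdist_le[of 0 G x x] by simp

lemma gdist_step_le_right:
  assumes "connected_graph G" "x \<in> verts G" "u \<in> verts G" "v \<in> set_pmf (step G u)"
  shows "gdist G x v \<le> Suc (gdist G x u)"
proof (cases "nbrs G u = {#}")
  case True
  then show ?thesis using assms(4) by (simp add: step_def)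
next
  case False
  then have "v \<in># nbrs G u" using assms(4) by (simp add: step_def)
  with gdist_attained[OF assms(1-3)] have "((\<lambda>a b. b \<in># nbrs G a) ^^ Suc (gdist G x u)) x v"
    by (rule relpowp_Suc_I)
  then show ?thesis by (rule gdist_le)
qed

lemma gdist_triangle:
  assumes "connected_graph G" "u \<in> verts G" "v \<in> verts G" "w \<in> verts G"
  shows "gdist G u w \<le> gdist G u v + gdist G v w"
  using gdist_attained[OF assms(1-3)] gdist_attained[OF assms(1,3,4)]
  by (intro gdist_le) (auto simp: relpowp_add)

lemma is_path_gdist_le:
  assumes "connected_graph G" "is_path G \<omega>"
  shows "gdist G (\<omega> 0) (\<omega> n) \<le> n"
proof (induction n)
  case (Suc n)
  have "gdist G (\<omega> 0) (\<omega> (Suc n)) \<le> Suc (gdist G (\<omega> 0) (\<omega> n))"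
    using assms is_path_verts[OF assms]
    by (intro gdist_step_le_right) (auto simp: is_path_def)
  then show ?case using Suc by simp
qed (simp add: gdist_self)

lemma is_path_ball_verts:
  assumes "connected_graph G" "is_path G \<omega>" "n \<le> r"
  shows "\<omega> n \<in> ball_verts G (\<omega> 0) r"
  using is_path_gdist_le[OF assms(1,2), of n] is_path_verts[OF assms(1,2), of n] assms(3)
  by (simp add: ball_verts_def)

lemma verts_ball_graph [simp]: "verts (ball_graph G x r) = ball_verts G x r"
  by (simp add: ball_graph_def)

lemma root_in_ball_verts: "x \<in> verts G \<Longrightarrow> x \<in> ball_verts G x r"
  by (simp add: ball_verts_def gdist_self)

text \<open>The inequality is strict because a vertex at distance \<open>r\<close> may lose the
  edges that leave the ball.\<close>

lemma nbrs_ball_graph: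
  assumes "connected_graph G" "x \<in> verts G" "u \<in> verts G" "gdist G x u < r"
  shows "nbrs (ball_graph G x r) u = nbrs G u"
proof -
  have "v \<in> ball_verts G x r" if "v \<in># nbrs G u" for v
  proof -
    have "v \<in> set_pmf (step G u)" using that by (auto simp: step_def)
    then show ?thesis
      using gdist_step_le_right[OF assms(1-3)] connected_graph_nbrs(2)[OF assms(1) that] assms(4)
      by (fastforce simp: ball_verts_def)
  qed
  moreover have "u \<in> ball_verts G x r" using assms by (simp add: ball_verts_def)
  ultimately show ?thesis by (simp add: ball_graph_def filter_mset_eq_conv)
qed

lemma step_ball_graph:
  assumes "connected_graph G" "x \<in> verts G" "u \<in> verts G" "gdist G x u < r"
  shows "step (ball_graph G x r) u = step G u"
  unfolding step_def nbrs_ball_graph[OF assms] ..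

text \<open>Only the endpoint of the \<open>n\<close> steps can lie on the boundary sphere, and its
  neighbours are not read.\<close>

lemma steps_ball_graph:
  assumes "connected_graph G" "x \<in> verts G" "u \<in> verts G" "gdist G x u + n \<le> r"
  shows "steps (ball_graph G x r) n u = steps G n u"
  using assms(3,4)
proof (induction n arbitrary: u)
  case (Suc n)
  have "steps (ball_graph G x r) (Suc n) u = bind_pmf (step G u) (steps (ball_graph G x r) n)"
    using Suc.prems by (simp add: step_ball_graph[OF assms(1,2)])
  also have "\<dots> = bind_pmf (step G u) (steps G n)"
  proof (rule bind_pmf_cong[OF refl])
    fix v assume v: "v \<in> set_pmf (step G u)"
    have "gdist G x v + n \<le> r"
      using gdist_step_le_right[OF assms(1,2) Suc.prems(1) v] Suc.prems(2) by simp
    moreover have "v \<in> verts G" using set_pmf_step[OF assms(1) Suc.prems(1)] v by auto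
    ultimately show "steps (ball_graph G x r) n v = steps G n v" by (intro Suc.IH)
  qed
  finally show ?case by simp
qed simp

lemma walk_nonempty: "l \<in> set_pmf (walk G x n) \<Longrightarrow> l \<noteq> []"
  using length_walk by fastforce

lemma walk_verts:
  assumes "connected_graph G" "x \<in> verts G" "l \<in> set_pmf (walk G x n)"
  shows "last l \<in> ball_verts G x n \<and> set l \<subseteq> ball_verts G x n"
  using assms(3)
proof (induction n arbitrary: l)
  case 0
  then show ?case using assms(2) root_in_ball_verts by auto
next
  case (Suc n)
  then obtain l' v where l: "l = l' @ [v]" "l' \<in> set_pmf (walk G x n)" "v \<in> set_pmf (step G (last l'))"
    by auto
  have IH: "last l' \<in> ball_verts G x n" "set l' \<subseteq> ball_verts G x n"
    using Suc.IH[OF l(2)] by auto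
  then have u: "last l' \<in> verts G" "gdist G x (last l') \<le> n" by (auto simp: ball_verts_def)
  have "v \<in> ball_verts G x (Suc n)"
    using gdist_step_le_right[OF assms(1,2) u(1) l(3)] u(2) set_pmf_step[OF assms(1) u(1)] l(3)
    by (auto simp: ball_verts_def)
  moreover have "ball_verts G x n \<subseteq> ball_verts G x (Suc n)" by (auto simp: ball_verts_def)
  ultimately show ?case using IH l(1) by auto
qed

lemma walk_ball_graph:
  assumes "connected_graph G" "x \<in> verts G" "n \<le> r"
  shows "walk (ball_graph G x r) x n = walk G x n"
  using assms(3)
proof (induction n)
  case (Suc n)
  then have IH: "walk (ball_graph G x r) x n = walk G x n" by simp
  have "step (ball_graph G x r) (last l) = step G (last l)" if "l \<in> set_pmf (walk G x n)" for l
    using walk_verts[OF assms(1,2) that] Suc.prems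
    by (intro step_ball_graph[OF assms(1,2)]) (auto simp: ball_verts_def)
  then show ?case unfolding walk.simps IH by (intro bind_pmf_cong) auto
qed simp

lemma graph_iso_walk:
  assumes "connected_graph G" "connected_graph H" "graph_iso \<phi> G H" "x \<in> verts G"
  shows "walk H (\<phi> x) n = map_pmf (map \<phi>) (walk G x n)"
proof (induction n)
  case (Suc n)
  have "walk H (\<phi> x) (Suc n) = bind_pmf (walk G x n)
      (\<lambda>l. map_pmf (\<lambda>v. map \<phi> l @ [v]) (step H (last (map \<phi> l))))"
    by (simp add: Suc bind_map_pmf)
  also have "\<dots> = bind_pmf (walk G x n) (\<lambda>l. map_pmf (map \<phi>) (map_pmf (\<lambda>v. l @ [v]) (step G (last l))))"
  proof (rule bind_pmf_cong[OF refl])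
    fix l assume l: "l \<in> set_pmf (walk G x n)"
    have "last l \<in> verts G" using walk_verts[OF assms(1,4) l] by (simp add: ball_verts_def)
    then have "step H (last (map \<phi> l)) = map_pmf \<phi> (step G (last l))"
      using graph_iso_step[OF assms(1-3)] by (simp add: last_map walk_nonempty[OF l])
    then show "map_pmf (\<lambda>v. map \<phi> l @ [v]) (step H (last (map \<phi> l)))
        = map_pmf (map \<phi>) (map_pmf (\<lambda>v. l @ [v]) (step G (last l)))"
      by (simp add: pmf.map_comp o_def)
  qed
  finally show ?case by (simp add: map_bind_pmf)
qed simp

lemma finite_ball_verts:
  assumes "connected_graph G" "x \<in> verts G"
  shows "finite (ball_verts G x r)"
proof (induction r)
  case 0
  have "ball_verts G x 0 \<subseteq> {x}"
  proof
    fix v assume "v \<in> ball_verts G x 0"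
    then have "v \<in> verts G" "gdist G x v = 0" by (auto simp: ball_verts_def)
    then show "v \<in> {x}" using gdist_attained[OF assms, of v] by simp
  qed
  then show ?case by (rule finite_subset) simp
next
  case (Suc r)
  have "ball_verts G x (Suc r) \<subseteq> ball_verts G x r \<union> (\<Union>u\<in>ball_verts G x r. set_mset (nbrs G u))"
  proof
    fix v assume v: "v \<in> ball_verts G x (Suc r)"
    then have "v \<in> verts G" "gdist G x v \<le> Suc r" by (auto simp: ball_verts_def)
    show "v \<in> ball_verts G x r \<union> (\<Union>u\<in>ball_verts G x r. set_mset (nbrs G u))"
    proof (cases "gdist G x v \<le> r")
      case True
      then show ?thesis using v by (simp add: ball_verts_def)
    next
      case False
      then have "gdist G x v = Suc r" using \<open>gdist G x v \<le> Suc r\<close> by simp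
      then obtain u where u: "((\<lambda>a b. b \<in># nbrs G a) ^^ r) x u" "v \<in># nbrs G u"
        using gdist_attained[OF assms \<open>v \<in> verts G\<close>] by auto
      then show ?thesis
        using gdist_le[OF u(1)] connected_graph_nbrs(1)[OF assms(1) u(2)] by (auto simp: ball_verts_def)
    qed
  qed
  then show ?case by (rule finite_subset) (simp add: Suc)
qed

section \<open>Functions of a ball are measurable\<close>

lemma same_path_ball_abs:
  assumes "connected_graph G" "is_path G \<omega>" "connected_graph H" "is_path H \<eta>"
  shows "same_path_ball r (abs_path_graph (G, \<omega>)) (abs_path_graph (H, \<eta>)) \<longleftrightarrow>
    (\<exists>\<phi>. graph_iso \<phi> (ball_graph G (\<omega> 0) r) (ball_graph H (\<eta> 0) r) \<and> (\<forall>n\<le>r. \<phi> (\<omega> n) = \<eta> n))"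
  using assms by (subst same_path_ball.abs_eq) (simp_all add: path_iso_refl)

lemma same_path_ball_refl: "same_path_ball r w w"
proof -
  obtain G \<omega> where w: "w = abs_path_graph (G, \<omega>)" "connected_graph G" "is_path G \<omega>"
    using rep_path_graphE by blast
  show ?thesis
    using w graph_iso_id by (auto simp: same_path_ball_abs intro!: exI[of _ id])
qed

lemma same_path_ball_sym:
  assumes "same_path_ball r w w'"
  shows "same_path_ball r w' w"
proof -
  obtain G \<omega> where w: "w = abs_path_graph (G, \<omega>)" "connected_graph G" "is_path G \<omega>"
    using rep_path_graphE by blast
  obtain H \<eta> where w': "w' = abs_path_graph (H, \<eta>)" "connected_graph H" "is_path H \<eta>"
    using rep_path_graphE by blast
  obtain \<phi> where \<phi>: "graph_iso \<phi> (ball_graph G (\<omega> 0) r) (ball_graph H (\<eta> 0) r)" "\<forall>n\<le>r. \<phi> (\<omega> n) = \<eta> n"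
    using assms w w' by (auto simp: same_path_ball_abs)
  have "inv_into (ball_verts G (\<omega> 0) r) \<phi> (\<eta> n) = \<omega> n" if "n \<le> r" for n
    using \<phi> is_path_ball_verts[OF w(2,3) that] that unfolding graph_iso_def
    by (metis bij_betw_inv_into_left verts_ball_graph)
  then show ?thesis
    using graph_iso_inv[OF \<phi>(1)] w w' by (auto simp: same_path_ball_abs)
qed

lemma same_path_ball_trans:
  assumes "same_path_ball r u v" "same_path_ball r v w"
  shows "same_path_ball r u w"
proof -
  obtain G \<omega> where u: "u = abs_path_graph (G, \<omega>)" "connected_graph G" "is_path G \<omega>"
    using rep_path_graphE by blast
  obtain H \<eta> where v: "v = abs_path_graph (H, \<eta>)" "connected_graph H" "is_path H \<eta>"
    using rep_path_graphE by blast
  obtain K \<zeta> where w: "w = abs_path_graph (K, \<zeta>)" "connected_graph K" "is_path K \<zeta>"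
    using rep_path_graphE by blast
  obtain \<phi> where \<phi>: "graph_iso \<phi> (ball_graph G (\<omega> 0) r) (ball_graph H (\<eta> 0) r)" "\<forall>n\<le>r. \<phi> (\<omega> n) = \<eta> n"
    using assms(1) u v by (auto simp: same_path_ball_abs)
  obtain \<psi> where \<psi>: "graph_iso \<psi> (ball_graph H (\<eta> 0) r) (ball_graph K (\<zeta> 0) r)" "\<forall>n\<le>r. \<psi> (\<eta> n) = \<zeta> n"
    using assms(2) v w by (auto simp: same_path_ball_abs)
  show ?thesis
    using graph_iso_comp[OF \<phi>(1) \<psi>(1)] \<phi>(2) \<psi>(2) u w
    by (auto simp: same_path_ball_abs intro!: exI[of _ "\<psi> \<circ> \<phi>"])
qed

text \<open>Such a function is locally constant, so the preimage of every set is open, whatever the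
  type of its values.\<close>

lemma measurable_path_ball_function:
  assumes "\<And>w w'. same_path_ball r w w' \<Longrightarrow> F w = F w'"
  shows "F \<in> borel \<rightarrow>\<^sub>M count_space UNIV"
proof (rule measurableI)
  fix A
  have "open (F -` A)" unfolding open_path_graph_def using assms by fastforce
  then show "F -` A \<inter> space borel \<in> sets borel" by simp
qed simp

lemma measurable_rooted_ball_function:
  assumes "\<And>g h. same_ball r g h \<Longrightarrow> F g = F h"
  shows "F \<in> borel \<rightarrow>\<^sub>M count_space UNIV"
proof (rule measurableI)
  fix A
  have "open (F -` A)" unfolding open_rooted_graph_def using assms by fastforce
  then show "F -` A \<inter> space borel \<in> sets borel" by simp
qed simp

lift_definition root_weight :: "path_graph \<Rightarrow> real" is "\<lambda>(G, \<omega>). weight G (\<omega> 0)"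
proof (clarsimp simp: path_iso_def)
  fix G \<omega> H \<eta> \<phi>
  assume "connected_graph G" "connected_graph H" "is_path G \<omega>" "graph_iso \<phi> G H" "\<forall>n. \<phi> (\<omega> n) = \<eta> n"
  then show "weight G (\<omega> 0) = weight H (\<eta> 0)"
    using graph_iso_nbrs[of G H \<phi> "\<omega> 0"] by (simp add: weight_def is_path_def)
qed

lemma same_path_ballE:
  assumes "same_path_ball r w w'"
  obtains G \<omega> H \<eta> \<phi> where "w = abs_path_graph (G, \<omega>)" "connected_graph G" "is_path G \<omega>"
    "w' = abs_path_graph (H, \<eta>)" "connected_graph H" "is_path H \<eta>"
    "connected_graph (ball_graph G (\<omega> 0) r)" "connected_graph (ball_graph H (\<eta> 0) r)"
    "graph_iso \<phi> (ball_graph G (\<omega> 0) r) (ball_graph H (\<eta> 0) r)" "\<And>n. n \<le> r \<Longrightarrow> \<phi> (\<omega> n) = \<eta> n"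
    "\<And>n. n \<le> r \<Longrightarrow> \<omega> n \<in> ball_verts G (\<omega> 0) r" "\<And>n. n \<le> r \<Longrightarrow> \<eta> n \<in> ball_verts H (\<eta> 0) r"
proof -
  obtain G \<omega> where w: "w = abs_path_graph (G, \<omega>)" "connected_graph G" "is_path G \<omega>"
    using rep_path_graphE by blast
  obtain H \<eta> where w': "w' = abs_path_graph (H, \<eta>)" "connected_graph H" "is_path H \<eta>"
    using rep_path_graphE by blast
  obtain \<phi> where \<phi>: "graph_iso \<phi> (ball_graph G (\<omega> 0) r) (ball_graph H (\<eta> 0) r)" "\<forall>n\<le>r. \<phi> (\<omega> n) = \<eta> n"
    using assms w w' by (auto simp: same_path_ball_abs)
  show ?thesis
    by (rule that[OF w w' _ _ \<phi>(1)])
      (use \<phi>(2) w w' in \<open>auto intro: connected_ball_graph is_path_verts is_path_ball_verts\<close>)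
qed

lemma measurable_path_dist [measurable]: "path_dist n \<in> borel \<rightarrow>\<^sub>M count_space UNIV"
proof (rule measurable_path_ball_function[of n])
  fix w w' assume "same_path_ball n w w'"
  then show "path_dist n w = path_dist n w'"
  proof (rule same_path_ballE)
    fix G \<omega> H \<eta> \<phi>
    assume a: "w = abs_path_graph (G, \<omega>)" "connected_graph G" "is_path G \<omega>"
      "w' = abs_path_graph (H, \<eta>)" "connected_graph H" "is_path H \<eta>"
      "connected_graph (ball_graph G (\<omega> 0) n)" "connected_graph (ball_graph H (\<eta> 0) n)"
      "graph_iso \<phi> (ball_graph G (\<omega> 0) n) (ball_graph H (\<eta> 0) n)" "\<And>i. i \<le> n \<Longrightarrow> \<phi> (\<omega> i) = \<eta> i"
      "\<And>i. i \<le> n \<Longrightarrow> \<omega> i \<in> ball_verts G (\<omega> 0) n" "\<And>i. i \<le> n \<Longrightarrow> \<eta> i \<in> ball_verts H (\<eta> 0) n"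
    have "gdist G (\<omega> 0) (\<omega> n) = gdist (ball_graph G (\<omega> 0) n) (\<omega> 0) (\<omega> n)"
      using a by (intro gdist_ball_graph[symmetric]) (auto intro: is_path_verts)
    also have "\<dots> = gdist (ball_graph H (\<eta> 0) n) (\<phi> (\<omega> 0)) (\<phi> (\<omega> n))"
      using a by (intro graph_iso_gdist[OF a(7-9), symmetric]) auto
    also have "\<dots> = gdist H (\<eta> 0) (\<eta> n)"
      using a(10)[of 0] a(10)[of n] a(5,6) a(12)[of n]
      by (simp add: gdist_ball_graph is_path_verts)
    finally show "path_dist n w = path_dist n w'"
      using a by (simp add: path_dist.abs_eq path_iso_refl)
  qed
qed

lemma measurable_path_prob [measurable]: "path_prob n \<in> borel_measurable borel"
proof -
  have "path_prob n \<in> borel \<rightarrow>\<^sub>M count_space UNIV"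
  proof (rule measurable_path_ball_function[of n])
    fix w w' assume "same_path_ball n w w'"
    then show "path_prob n w = path_prob n w'"
    proof (rule same_path_ballE)
      fix G \<omega> H \<eta> \<phi>
      assume a: "w = abs_path_graph (G, \<omega>)" "connected_graph G" "is_path G \<omega>"
        "w' = abs_path_graph (H, \<eta>)" "connected_graph H" "is_path H \<eta>"
        "connected_graph (ball_graph G (\<omega> 0) n)" "connected_graph (ball_graph H (\<eta> 0) n)"
        "graph_iso \<phi> (ball_graph G (\<omega> 0) n) (ball_graph H (\<eta> 0) n)" "\<And>i. i \<le> n \<Longrightarrow> \<phi> (\<omega> i) = \<eta> i"
        "\<And>i. i \<le> n \<Longrightarrow> \<omega> i \<in> ball_verts G (\<omega> 0) n" "\<And>i. i \<le> n \<Longrightarrow> \<eta> i \<in> ball_verts H (\<eta> 0) n"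
      have "pmf (steps G n (\<omega> 0)) (\<omega> n) = pmf (steps (ball_graph G (\<omega> 0) n) n (\<omega> 0)) (\<omega> n)"
        using a by (subst steps_ball_graph) (auto simp: gdist_self intro: is_path_verts)
      also have "\<dots> = pmf (steps (ball_graph H (\<eta> 0) n) n (\<phi> (\<omega> 0))) (\<phi> (\<omega> n))"
        using a by (intro graph_iso_pmf_steps[OF a(7-9), symmetric]) auto
      also have "\<dots> = pmf (steps H n (\<eta> 0)) (\<eta> n)"
        using a(10)[of 0] a(10)[of n] a(5,6)
        by (simp add: steps_ball_graph gdist_self is_path_verts)
      finally show "path_prob n w = path_prob n w'"
        using a by (simp add: path_prob.abs_eq path_iso_refl)
    qed
  qed
  then show ?thesis by (rule measurable_compose) simp
qed

lemma measurable_root_weight [measurable]: "root_weight \<in> borel_measurable borel"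
proof -
  have "root_weight \<in> borel \<rightarrow>\<^sub>M count_space UNIV"
  proof (rule measurable_path_ball_function[of 1])
    fix w w' assume "same_path_ball 1 w w'"
    then show "root_weight w = root_weight w'"
    proof (rule same_path_ballE)
      fix G \<omega> H \<eta> \<phi>
      assume a: "w = abs_path_graph (G, \<omega>)" "connected_graph G" "is_path G \<omega>"
        "w' = abs_path_graph (H, \<eta>)" "connected_graph H" "is_path H \<eta>"
        "connected_graph (ball_graph G (\<omega> 0) 1)" "connected_graph (ball_graph H (\<eta> 0) 1)"
        "graph_iso \<phi> (ball_graph G (\<omega> 0) 1) (ball_graph H (\<eta> 0) 1)" "\<And>i. i \<le> 1 \<Longrightarrow> \<phi> (\<omega> i) = \<eta> i"
        "\<And>i. i \<le> 1 \<Longrightarrow> \<omega> i \<in> ball_verts G (\<omega> 0) 1" "\<And>i. i \<le> 1 \<Longrightarrow> \<eta> i \<in> ball_verts H (\<eta> 0) 1"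
      have "nbrs H (\<eta> 0) = nbrs (ball_graph H (\<eta> 0) 1) (\<phi> (\<omega> 0))"
        using a(10)[of 0] a(5,6) by (simp add: nbrs_ball_graph gdist_self is_path_verts)
      also have "\<dots> = image_mset \<phi> (nbrs (ball_graph G (\<omega> 0) 1) (\<omega> 0))"
        using a(11)[of 0] by (intro graph_iso_nbrs[OF a(7-9)]) simp
      also have "\<dots> = image_mset \<phi> (nbrs G (\<omega> 0))"
        using a(2,3) by (simp add: nbrs_ball_graph gdist_self is_path_verts)
      finally show "root_weight w = root_weight w'"
        using a by (simp add: root_weight.abs_eq path_iso_refl weight_def)
    qed
  qed
  then show ?thesis by (rule measurable_compose) simp
qed

lemma same_ballE:
  assumes "same_ball r g h"
  obtains G x H y \<phi> where "rep_rooted_graph g = (G, x)" "g = abs_rooted_graph (G, x)"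
    "connected_graph G" "x \<in> verts G" "rep_rooted_graph h = (H, y)" "h = abs_rooted_graph (H, y)"
    "connected_graph H" "y \<in> verts H" "graph_iso \<phi> (ball_graph G x r) (ball_graph H y r)" "\<phi> x = y"
proof -
  obtain G x where g: "rep_rooted_graph g = (G, x)" "g = abs_rooted_graph (G, x)"
    "connected_graph G" "x \<in> verts G" by (rule rep_rooted_graphE)
  obtain H y where h: "rep_rooted_graph h = (H, y)" "h = abs_rooted_graph (H, y)"
    "connected_graph H" "y \<in> verts H" by (rule rep_rooted_graphE)
  have "\<exists>\<phi>. graph_iso \<phi> (ball_graph G x r) (ball_graph H y r) \<and> \<phi> x = y"
    using assms g h by (simp add: same_ball.abs_eq rooted_iso_refl)
  then show ?thesis using that[OF g h] by blast
qed

lemma measurable_ball_size [measurable]: "ball_size r \<in> borel \<rightarrow>\<^sub>M count_space UNIV"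
proof (rule measurable_rooted_ball_function[of r])
  fix g h assume "same_ball r g h"
  then show "ball_size r g = ball_size r h"
  proof (rule same_ballE)
    fix G x H y \<phi>
    assume a: "g = abs_rooted_graph (G, x)" "connected_graph G" "x \<in> verts G"
      "h = abs_rooted_graph (H, y)" "connected_graph H" "y \<in> verts H"
      "graph_iso \<phi> (ball_graph G x r) (ball_graph H y r)"
    have "card (ball_verts G x r) = card (ball_verts H y r)"
      using a(7) by (auto simp: graph_iso_def dest: bij_betw_same_card)
    then show "ball_size r g = ball_size r h"
      using a by (simp add: ball_size.abs_eq rooted_iso_refl)
  qed
qed

section \<open>Measurability of the law of the walk\<close>

definition cylinder :: "nat \<Rightarrow> path_graph \<Rightarrow> path_graph set" where
  "cylinder r w = {w'. same_path_ball r w w'}"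

text \<open>The ball and the first \<open>r\<close> steps in a chosen representative are finite
  data, coded by lists of numbers. Equal codes force equal cylinders; the converse may fail, because
  isomorphic balls can carry different labels.\<close>

lemma countable_range_cylinder: "countable (range (cylinder r))"
proof -
  define enc where "enc w = (case rep_path_graph w of (G, \<omega>) \<Rightarrow>
    (sorted_list_of_set (ball_verts G (\<omega> 0) r),
     map (\<lambda>u. sorted_list_of_multiset (nbrs (ball_graph G (\<omega> 0) r) u))
       (sorted_list_of_set (ball_verts G (\<omega> 0) r)),
     map \<omega> [0..<Suc r]))" for w
  have same: "same_path_ball r w w'" if enc: "enc w = enc w'" for w w'
  proof -
    obtain G \<omega> where w: "rep_path_graph w = (G, \<omega>)" "w = abs_path_graph (G, \<omega>)"
      "connected_graph G" "is_path G \<omega>" by (rule rep_path_graphE)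
    obtain H \<eta> where w': "rep_path_graph w' = (H, \<eta>)" "w' = abs_path_graph (H, \<eta>)"
      "connected_graph H" "is_path H \<eta>" by (rule rep_path_graphE)
    have fin: "finite (ball_verts G (\<omega> 0) r)" "finite (ball_verts H (\<eta> 0) r)"
      using finite_ball_verts[OF w(3) is_path_verts[OF w(3,4)]]
        finite_ball_verts[OF w'(3) is_path_verts[OF w'(3,4)]] by auto
    have e1: "sorted_list_of_set (ball_verts G (\<omega> 0) r) = sorted_list_of_set (ball_verts H (\<eta> 0) r)"
      and e2: "map (\<lambda>u. sorted_list_of_multiset (nbrs (ball_graph G (\<omega> 0) r) u))
          (sorted_list_of_set (ball_verts G (\<omega> 0) r))
        = map (\<lambda>u. sorted_list_of_multiset (nbrs (ball_graph H (\<eta> 0) r) u))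
          (sorted_list_of_set (ball_verts G (\<omega> 0) r))"
      and e3: "map \<omega> [0..<Suc r] = map \<eta> [0..<Suc r]"
      using enc w(1) w'(1) by (auto simp: enc_def simp del: upt_Suc)
    have verts: "ball_verts G (\<omega> 0) r = ball_verts H (\<eta> 0) r"
      using fin arg_cong[OF e1, of set] by simp
    have "nbrs (ball_graph G (\<omega> 0) r) u = nbrs (ball_graph H (\<eta> 0) r) u"
      if "u \<in> ball_verts G (\<omega> 0) r" for u
    proof -
      have "sorted_list_of_multiset (nbrs (ball_graph G (\<omega> 0) r) u)
          = sorted_list_of_multiset (nbrs (ball_graph H (\<eta> 0) r) u)"
        using e2 that fin by simp
      from arg_cong[OF this, of mset] show ?thesis by simp
    qed
    then have "graph_iso id (ball_graph G (\<omega> 0) r) (ball_graph H (\<eta> 0) r)"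
      using verts by (simp add: graph_iso_def)
    moreover have "\<forall>n\<le>r. id (\<omega> n) = \<eta> n"
    proof (intro allI impI)
      fix n assume "n \<le> r"
      then have "n \<in> set [0..<Suc r]" by auto
      with e3 show "id (\<omega> n) = \<eta> n" unfolding map_eq_conv id_def by blast
    qed
    ultimately show ?thesis using w w' by (auto simp: same_path_ball_abs)
  qed
  have sub: "cylinder r w \<subseteq> cylinder r w'" if "enc w = enc w'" for w w'
    using same_path_ball_trans[OF same[OF that[symmetric]]] unfolding cylinder_def by blast
  \<comment> \<open>\<open>inv enc\<close> picks one point for each code, so that
    \<open>cylinder r\<close> factors through the countable type of codes.\<close>
  have "cylinder r w = cylinder r (inv enc (enc w))" for w
  proof -
    have e: "enc (inv enc (enc w)) = enc w" by (rule f_inv_into_f) (rule rangeI)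
    show ?thesis by (rule subset_antisym[OF sub[OF e[symmetric]] sub[OF e]])
  qed
  then have "range (cylinder r) \<subseteq> (\<lambda>c. cylinder r (inv enc c)) ` UNIV"
    by blast
  then show ?thesis by (rule countable_subset) simp
qed

text \<open>The empty set is added because disjoint cylinders occur and the family has to be a
  \<pi>-system.\<close>

definition cylinders :: "path_graph set set" where
  "cylinders = insert {} (\<Union>r. range (cylinder r))"

lemma open_cylinder: "open (cylinder r w)"
  unfolding open_path_graph_def cylinder_def using same_path_ball_trans by blast

text \<open>Every open set is a union of cylinders, and a countable one by
  \<open>countable_range_cylinder\<close>.\<close>

lemma sets_borel_path_graph: "sets (borel :: path_graph measure) = sigma_sets UNIV cylinders"
proof
  have "U \<in> sigma_sets UNIV cylinders" if U: "open U" for U :: "path_graph set"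
  proof -
    have "U = \<Union>{C \<in> cylinders. C \<subseteq> U}"
    proof (intro equalityI subsetI)
      fix w assume "w \<in> U"
      then obtain r where "cylinder r w \<subseteq> U"
        using U unfolding open_path_graph_def cylinder_def by blast
      moreover have "w \<in> cylinder r w" by (simp add: cylinder_def same_path_ball_refl)
      moreover have "cylinder r w \<in> cylinders" by (auto simp: cylinders_def)
      ultimately show "w \<in> \<Union>{C \<in> cylinders. C \<subseteq> U}" by blast
    qed blast
    also have "\<dots> \<in> sigma_sets UNIV cylinders"
    proof (rule sigma_sets_UNION)
      have "countable cylinders" by (simp add: cylinders_def countable_range_cylinder)
      then show "countable {C \<in> cylinders. C \<subseteq> U}" by (rule countable_subset[rotated]) blast
    qed (auto intro: sigma_sets.Basic)
    finally show ?thesis .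
  qed
  then show "sets (borel :: path_graph measure) \<subseteq> sigma_sets UNIV cylinders"
    unfolding borel_def by (subst sets_measure_of) (auto intro!: sigma_sets_mono)
  show "sigma_sets UNIV cylinders \<subseteq> sets (borel :: path_graph measure)"
    using open_cylinder sets.sigma_sets_subset[of cylinders "borel :: path_graph measure"]
    by (force simp: cylinders_def)
qed

text \<open>As with the balls of an ultrametric, two cylinders that meet are nested, the one with
  the larger \<open>r\<close> lying inside.\<close>

lemma Int_stable_cylinders: "Int_stable cylinders"
proof (rule Int_stableI)
  have *: "cylinder r v \<inter> cylinder s w \<in> cylinders" if "r \<le> s" for r s v w
  proof (cases "cylinder r v \<inter> cylinder s w = {}")
    case False
    then obtain u where u: "same_path_ball r v u" "same_path_ball s w u"
      by (auto simp: cylinder_def)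
    have "same_path_ball r v u'" if "same_path_ball s w u'" for u'
    proof -
      have "same_path_ball s u u'"
        using same_path_ball_trans[OF same_path_ball_sym[OF u(2)] that] .
      then show ?thesis
        using same_path_ball_trans[OF u(1)] same_path_ball_antimono[OF _ \<open>r \<le> s\<close>] by blast
    qed
    then have "cylinder r v \<inter> cylinder s w = cylinder s w"
      by (auto simp: cylinder_def)
    then show ?thesis by (auto simp: cylinders_def)
  qed (simp add: cylinders_def)
  fix A B assume "A \<in> cylinders" "B \<in> cylinders"
  then consider "A = {}" | "B = {}" | r v s w where "A = cylinder r v" "B = cylinder s w"
    by (auto simp: cylinders_def)
  then show "A \<inter> B \<in> cylinders"
  proof cases
    case 3
    then show ?thesis using *[of r s v w] *[of s r w v] by (cases "r \<le> s") (auto simp: Int_commute)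
  qed (simp_all add: cylinders_def)
qed

text \<open>Membership in a cylinder expressed through the first \<open>r + 1\<close> vertices only,
  so that its probability can be read off \<open>walk\<close>.\<close>

definition in_cylinder :: "nat \<Rightarrow> path_graph \<Rightarrow> graph \<Rightarrow> nat list \<Rightarrow> bool" where
  "in_cylinder r w G l \<longleftrightarrow> (case rep_path_graph w of (G0, \<eta>) \<Rightarrow>
    \<exists>\<phi>. graph_iso \<phi> (ball_graph G0 (\<eta> 0) r) (ball_graph G (l ! 0) r) \<and> (\<forall>n\<le>r. \<phi> (\<eta> n) = l ! n))"

lemma abs_path_graph_in_cylinder:
  assumes "connected_graph G" "is_path G \<omega>"
  shows "abs_path_graph (G, \<omega>) \<in> cylinder r w \<longleftrightarrow> in_cylinder r w G (map \<omega> [0..<Suc r])"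
proof -
  obtain H \<eta> where w: "rep_path_graph w = (H, \<eta>)" "w = abs_path_graph (H, \<eta>)"
    "connected_graph H" "is_path H \<eta>" by (rule rep_path_graphE)
  have "abs_path_graph (G, \<omega>) \<in> cylinder r w \<longleftrightarrow> same_path_ball r (abs_path_graph (H, \<eta>)) (abs_path_graph (G, \<omega>))"
    using w(2) by (simp add: cylinder_def)
  also have "\<dots> \<longleftrightarrow> in_cylinder r w G (map \<omega> [0..<Suc r])"
    using assms w by (auto simp: same_path_ball_abs in_cylinder_def less_Suc_eq_le nth_append
        simp del: upt_Suc)
  finally show ?thesis .
qed

lemma measurable_abs_path_graph [measurable]:
  assumes G: "connected_graph G"
  shows "(\<lambda>\<omega>. abs_path_graph (G, \<omega>)) \<in> chain_law G x \<rightarrow>\<^sub>M borel"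
proof -
  let ?M = "\<Pi>\<^sub>M i\<in>UNIV. count_space (UNIV :: nat set)"
  have space: "space ?M = UNIV" by (simp add: space_PiM)
  have comp [measurable]: "(\<lambda>\<omega>. \<omega> i) \<in> ?M \<rightarrow>\<^sub>M count_space UNIV" for i
    by (rule measurable_component_singleton) simp
  have path: "{\<omega>. is_path G \<omega>} \<in> sets ?M"
  proof -
    have "{\<omega> \<in> space ?M. \<omega> 0 \<in> verts G \<and> (\<forall>n. \<omega> (Suc n) \<in> set_pmf (step G (\<omega> n)))} \<in> sets ?M"
      by measurable
    then show ?thesis by (simp add: space is_path_def)
  qed
  have "(\<lambda>\<omega>. abs_path_graph (G, \<omega>)) -` cylinder r w \<inter> space ?M \<in> sets ?M" for r w
  proof -
    let ?L = "(\<lambda>\<omega>. map \<omega> [0..<Suc r]) -` {l. in_cylinder r w G l} \<inter> space ?M"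
    have L: "?L \<in> sets ?M"
      by (rule measurable_sets[OF measurable_map_upt]) auto
    \<comment> \<open>All sequences that are not paths have one image, so the preimage contains
      either none or all of them.\<close>
    have "(\<lambda>\<omega>. abs_path_graph (G, \<omega>)) -` cylinder r w \<inter> space ?M = ?L \<inter> {\<omega>. is_path G \<omega>} \<or>
      (\<lambda>\<omega>. abs_path_graph (G, \<omega>)) -` cylinder r w \<inter> space ?M
        = (?L \<inter> {\<omega>. is_path G \<omega>}) \<union> (space ?M - {\<omega>. is_path G \<omega>})"
    proof (cases "\<exists>\<eta>. \<not> is_path G \<eta> \<and> abs_path_graph (G, \<eta>) \<in> cylinder r w")
      case True
      then have "\<And>\<eta>. \<not> is_path G \<eta> \<Longrightarrow> abs_path_graph (G, \<eta>) \<in> cylinder r w"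
        using abs_path_graph_not_path by metis
      then show ?thesis
        using abs_path_graph_in_cylinder[OF G] by (intro disjI2) (auto simp: space simp del: upt_Suc)
    next
      case False
      then show ?thesis
        using abs_path_graph_in_cylinder[OF G] by (intro disjI1) (auto simp: space simp del: upt_Suc)
    qed
    then show ?thesis
      by (elim disjE; simp only:) (intro sets.Int sets.Un sets.Diff sets.top L path)+
  qed
  then have "(\<lambda>\<omega>. abs_path_graph (G, \<omega>)) \<in> ?M \<rightarrow>\<^sub>M sigma UNIV cylinders"
    by (intro measurable_measure_of) (auto simp: cylinders_def)
  moreover have "chain_law G x \<rightarrow>\<^sub>M borel = ?M \<rightarrow>\<^sub>M sigma UNIV cylinders"
    by (rule measurable_cong_sets[OF sets_chain_law]) (simp add: sets_borel_path_graph)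
  ultimately show ?thesis by (simp only:)
qed

lemma prob_space_srw_from: "prob_space (srw_from g)"
proof -
  obtain G x where g: "rep_rooted_graph g = (G, x)" "connected_graph G"
    by (rule rep_rooted_graphE)
  show ?thesis
    unfolding srw_from_def g(1) prod.case
    by (rule prob_space.prob_space_distr[OF prob_space_chain_law measurable_abs_path_graph[OF g(2)]])
qed

lemma sets_srw_from: "sets (srw_from g) = sets borel"
  by (simp add: srw_from_def split_def)

lemma emeasure_srw_from_cylinder:
  assumes "rep_rooted_graph g = (G, x)" "connected_graph G" "x \<in> verts G"
  shows "emeasure (srw_from g) (cylinder r w) = emeasure (measure_pmf (walk G x r)) {l. in_cylinder r w G l}"
proof -
  let ?L = "(\<lambda>\<omega>. map \<omega> [0..<Suc r]) -` {l. in_cylinder r w G l} \<inter> space (chain_law G x)"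
  have map [measurable]: "(\<lambda>\<omega>. map \<omega> [0..<Suc r]) \<in> chain_law G x \<rightarrow>\<^sub>M count_space UNIV"
    unfolding measurable_cong_sets[OF sets_chain_law refl] by (rule measurable_map_upt) simp
  have "emeasure (srw_from g) (cylinder r w)
      = emeasure (chain_law G x) ((\<lambda>\<omega>. abs_path_graph (G, \<omega>)) -` cylinder r w \<inter> space (chain_law G x))"
    unfolding srw_from_def assms(1) prod.case
    by (rule emeasure_distr[OF measurable_abs_path_graph[OF assms(2)]]) (simp add: open_cylinder)
  also have "\<dots> = emeasure (chain_law G x) ?L"
  proof (rule emeasure_eq_AE)
    show "AE \<omega> in chain_law G x.
        \<omega> \<in> (\<lambda>\<omega>. abs_path_graph (G, \<omega>)) -` cylinder r w \<inter> space (chain_law G x) \<longleftrightarrow> \<omega> \<in> ?L"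
      using AE_chain_law_path[OF assms(3)]
      by eventually_elim (simp add: abs_path_graph_in_cylinder[OF assms(2)] del: upt_Suc)
    show "(\<lambda>\<omega>. abs_path_graph (G, \<omega>)) -` cylinder r w \<inter> space (chain_law G x) \<in> sets (chain_law G x)"
      by (rule measurable_sets[OF measurable_abs_path_graph[OF assms(2)]]) (simp add: open_cylinder)
    show "?L \<in> sets (chain_law G x)" by (rule measurable_sets[OF map]) simp
  qed
  also have "\<dots> = emeasure (distr (chain_law G x) (count_space UNIV) (\<lambda>\<omega>. map \<omega> [0..<Suc r]))
      {l. in_cylinder r w G l}"
    by (rule emeasure_distr[OF map, symmetric]) simp
  finally show ?thesis unfolding distr_chain_law_walk .
qed

text \<open>In \<open>r\<close> steps the walk neither leaves the ball nor reads an edge outside it,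
  so the isomorphism of balls carries the law of the lists, and membership in the cylinder, from one
  graph to the other.\<close>

lemma emeasure_srw_from_cylinder_cong:
  assumes "same_ball r g h"
  shows "emeasure (srw_from g) (cylinder r w) = emeasure (srw_from h) (cylinder r w)"
  using assms
proof (rule same_ballE)
  fix G x H y \<phi>
  assume g: "rep_rooted_graph g = (G, x)" "connected_graph G" "x \<in> verts G"
    and h: "rep_rooted_graph h = (H, y)" "connected_graph H" "y \<in> verts H"
    and \<phi>: "graph_iso \<phi> (ball_graph G x r) (ball_graph H y r)" "\<phi> x = y"
  obtain G0 \<eta> where w: "rep_path_graph w = (G0, \<eta>)" by fastforce
  have "walk H y r = walk (ball_graph H y r) (\<phi> x) r"
    using h \<phi>(2) by (simp add: walk_ball_graph)
  also have "\<dots> = map_pmf (map \<phi>) (walk (ball_graph G x r) x r)"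
    using g h \<phi>(1) by (intro graph_iso_walk) (simp_all add: connected_ball_graph root_in_ball_verts)
  also have "\<dots> = map_pmf (map \<phi>) (walk G x r)"
    using g by (simp add: walk_ball_graph)
  finally have walk: "walk H y r = map_pmf (map \<phi>) (walk G x r)" .
  \<comment> \<open>Restricted to lists in the support, whose entries all lie in the ball, where
    \<phi> can be inverted.\<close>
  have "in_cylinder r w G l \<longleftrightarrow> in_cylinder r w H (map \<phi> l)" if l: "l \<in> set_pmf (walk G x r)" for l
  proof -
    have len: "n < length l" if "n \<le> r" for n using length_walk[OF l] that by simp
    have ball: "l ! n \<in> ball_verts G x r" if "n \<le> r" for n
      using walk_verts[OF g(2,3) l] nth_mem[OF len[OF that]] by auto
    have root: "l ! 0 = x" by (rule hd_walk[OF l])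
    have inv: "inv_into (ball_verts G x r) \<phi> (\<phi> (l ! n)) = l ! n" if "n \<le> r" for n
      using \<phi>(1) ball[OF that] by (auto simp: graph_iso_def intro: bij_betw_inv_into_left)
    have root': "map \<phi> l ! 0 = y" using len[of 0] root \<phi>(2) by simp
    show ?thesis
    proof
      assume "in_cylinder r w G l"
      then obtain \<psi> where \<psi>: "graph_iso \<psi> (ball_graph G0 (\<eta> 0) r) (ball_graph G x r)"
        "\<forall>n\<le>r. \<psi> (\<eta> n) = l ! n"
        unfolding in_cylinder_def w prod.case root by blast
      then show "in_cylinder r w H (map \<phi> l)"
        unfolding in_cylinder_def w prod.case root'
        using graph_iso_comp[OF \<psi>(1) \<phi>(1)] len
        by (intro exI[of _ "\<phi> \<circ> \<psi>"]) simp
    next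
      assume "in_cylinder r w H (map \<phi> l)"
      then obtain \<psi> where \<psi>: "graph_iso \<psi> (ball_graph G0 (\<eta> 0) r) (ball_graph H y r)"
        "\<forall>n\<le>r. \<psi> (\<eta> n) = \<phi> (l ! n)"
        using len unfolding in_cylinder_def w prod.case root' by auto
      then show "in_cylinder r w G l"
        unfolding in_cylinder_def w prod.case root
        using graph_iso_comp[OF \<psi>(1) graph_iso_inv[OF \<phi>(1)]] inv
        by (intro exI[of _ "inv_into (verts (ball_graph G x r)) \<phi> \<circ> \<psi>"]) simp
    qed
  qed
  then have "emeasure (measure_pmf (walk G x r)) {l. in_cylinder r w G l}
      = emeasure (measure_pmf (walk G x r)) (map \<phi> -` {l. in_cylinder r w H l})"
    by (intro emeasure_eq_AE) (auto simp: AE_measure_pmf_iff)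
  also have "\<dots> = emeasure (measure_pmf (walk H y r)) {l. in_cylinder r w H l}"
    unfolding walk by simp
  finally show ?thesis
    by (simp add: emeasure_srw_from_cylinder[OF g] emeasure_srw_from_cylinder[OF h])
qed

text \<open>By the \<pi>-system argument only cylinders have to be tested, and their probabilities
  are locally constant in the graph.\<close>

lemma measurable_srw_from [measurable]: "srw_from \<in> borel \<rightarrow>\<^sub>M prob_algebra borel"
proof (rule measurable_prob_algebra_generated[OF sets_borel_path_graph Int_stable_cylinders])
  fix A assume "A \<in> cylinders"
  then consider "A = {}" | r w where "A = cylinder r w" by (auto simp: cylinders_def)
  then show "(\<lambda>g. emeasure (srw_from g) A) \<in> borel_measurable borel"
  proof cases
    case 2
    have "(\<lambda>g. emeasure (srw_from g) A) \<in> borel \<rightarrow>\<^sub>M count_space UNIV"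
      unfolding 2 by (rule measurable_rooted_ball_function[OF emeasure_srw_from_cylinder_cong])
    then show ?thesis by (rule measurable_compose) simp
  qed simp
qed (simp_all add: prob_space_srw_from sets_srw_from)

section \<open>Distances and probabilities along a path\<close>

lemma steps_add: "steps G (m + n) u = bind_pmf (steps G m u) (steps G n)"
proof (induction m arbitrary: u)
  case 0
  then show ?case by (simp add: bind_return_pmf)
next
  case (Suc m)
  have "steps G (Suc m + n) u = bind_pmf (step G u) (steps G (m + n))" by simp
  also have "\<dots> = bind_pmf (step G u) (\<lambda>v. bind_pmf (steps G m v) (steps G n))"
    by (intro bind_pmf_cong refl Suc)
  finally show ?case by (simp add: bind_assoc_pmf)
qed

text \<open>One term of the Chapman-Kolmogorov sum is kept; taking \<open>- ln\<close> will give the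
  subadditivity of the information.\<close>

lemma pmf_steps_add_ge:
  "pmf (steps G m u) v * pmf (steps G n v) z \<le> pmf (steps G (m + n) u) z"
proof (cases "v \<in> set_pmf (steps G m u)")
  case True
  have "pmf (steps G (m + n) u) z
      = (\<Sum>a\<in>set_pmf (steps G m u). pmf (steps G n a) z * pmf (steps G m u) a)"
    unfolding steps_add pmf_bind by (rule integral_measure_pmf_real) (auto simp: finite_set_pmf_steps)
  moreover have "pmf (steps G n v) z * pmf (steps G m u) v \<le> \<dots>"
    by (rule member_le_sum[OF True]) (auto simp: finite_set_pmf_steps)
  ultimately show ?thesis by (simp add: mult.commute)
qed (simp add: set_pmf_iff)

lemma is_path_shift:
  assumes "connected_graph G" "is_path G \<omega>"
  shows "is_path G (\<lambda>k. \<omega> (m + k))"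
  using assms is_path_verts[OF assms] by (auto simp: is_path_def)

lemma shift_funpow_abs:
  assumes "connected_graph G" "is_path G \<omega>"
  shows "(shift ^^ m) (abs_path_graph (G, \<omega>)) = abs_path_graph (G, \<lambda>k. \<omega> (m + k))"
proof (induction m)
  case (Suc m)
  then show ?case
    using shift.abs_eq[of "(G, \<lambda>k. \<omega> (m + k))"] is_path_shift[OF assms] assms(1)
    by (simp add: path_iso_refl)
qed simp

lemma is_path_pmf_steps_pos:
  assumes "is_path G \<omega>"
  shows "0 < pmf (steps G n (\<omega> 0)) (\<omega> n)"
proof -
  have "\<omega> n \<in> set_pmf (steps G n (\<omega> 0))"
    using assms by (induction n) (auto simp: steps_Suc_right is_path_def simp del: steps.simps(2))
  then show ?thesis by (rule pmf_positive)
qed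

lemma path_dist_0: "path_dist 0 w = 0"
proof -
  obtain G \<omega> where "w = abs_path_graph (G, \<omega>)" "connected_graph G" "is_path G \<omega>"
    using rep_path_graphE by blast
  then show ?thesis by (simp add: path_dist.abs_eq path_iso_refl gdist_self)
qed

lemma path_dist_le: "path_dist n w \<le> n"
proof -
  obtain G \<omega> where "w = abs_path_graph (G, \<omega>)" "connected_graph G" "is_path G \<omega>"
    using rep_path_graphE by blast
  then show ?thesis by (simp add: path_dist.abs_eq path_iso_refl is_path_gdist_le)
qed

lemma path_dist_add: "path_dist (m + n) w \<le> path_dist m w + path_dist n ((shift ^^ m) w)"
proof -
  obtain G \<omega> where w: "w = abs_path_graph (G, \<omega>)" "connected_graph G" "is_path G \<omega>"
    using rep_path_graphE by blast
  then show ?thesis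
    using gdist_triangle[OF w(2), of "\<omega> 0" "\<omega> m" "\<omega> (m + n)"] is_path_shift[OF w(2,3), of m]
    by (simp add: shift_funpow_abs path_dist.abs_eq path_iso_refl is_path_verts)
qed

lemma path_prob_0: "path_prob 0 w = 1"
proof -
  obtain G \<omega> where "w = abs_path_graph (G, \<omega>)" "connected_graph G" "is_path G \<omega>"
    using rep_path_graphE by blast
  then show ?thesis by (simp add: path_prob.abs_eq path_iso_refl)
qed

lemma path_prob_pos: "0 < path_prob n w"
proof -
  obtain G \<omega> where "w = abs_path_graph (G, \<omega>)" "connected_graph G" "is_path G \<omega>"
    using rep_path_graphE by blast
  then show ?thesis by (simp add: path_prob.abs_eq path_iso_refl is_path_pmf_steps_pos)
qed

lemma path_prob_le_1: "path_prob n w \<le> 1"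
proof -
  obtain G \<omega> where "w = abs_path_graph (G, \<omega>)" "connected_graph G" "is_path G \<omega>"
    using rep_path_graphE by blast
  then show ?thesis by (simp add: path_prob.abs_eq path_iso_refl pmf_le_1)
qed

lemma path_prob_add: "path_prob m w * path_prob n ((shift ^^ m) w) \<le> path_prob (m + n) w"
proof -
  obtain G \<omega> where w: "w = abs_path_graph (G, \<omega>)" "connected_graph G" "is_path G \<omega>"
    using rep_path_graphE by blast
  then show ?thesis
    using pmf_steps_add_ge[of G m "\<omega> 0" "\<omega> m" n "\<omega> (m + n)"] is_path_shift[OF w(2,3), of m]
    by (simp add: shift_funpow_abs path_prob.abs_eq path_iso_refl)
qed

lemma root_weight_ge_1: "1 \<le> root_weight w"
proof -
  obtain G \<omega> where "w = abs_path_graph (G, \<omega>)" "connected_graph G" "is_path G \<omega>"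
    using rep_path_graphE by blast
  then show ?thesis by (simp add: root_weight.abs_eq path_iso_refl weight_def)
qed

text \<open>Varopoulos-Carne after taking \<open>- ln\<close>. The weight of the root is at least 1
  and is dropped; that of the endpoint is written as \<open>root_weight\<close> after
  \<open>n\<close> shifts, ready for stationarity.\<close>

lemma path_prob_carne:
  assumes "0 \<le> l"
  shows "l * real (path_dist n w) - real n * (l\<^sup>2 / 2) - ln 2 - ln (root_weight ((shift ^^ n) w)) / 2
    \<le> - ln (path_prob n w)"
proof -
  obtain G \<omega> where w: "w = abs_path_graph (G, \<omega>)" "connected_graph G" "is_path G \<omega>"
    using rep_path_graphE by blast
  let ?d = "real (gdist G (\<omega> 0) (\<omega> n))" and ?W = "weight G (\<omega> n)"
  have W: "1 \<le> weight G u" for u by (simp add: weight_def)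
  have "pmf (steps G n (\<omega> 0)) (\<omega> n) \<le> 2 * sqrt (?W / weight G (\<omega> 0)) * cosh l ^ n * exp (- l * ?d)"
    by (rule varopoulos_carne) (use w assms is_path_verts in auto)
  also have "\<dots> \<le> 2 * sqrt ?W * exp (l\<^sup>2 / 2) ^ n * exp (- l * ?d)"
  proof (intro mult_mono mult_left_mono power_mono)
    show "sqrt (?W / weight G (\<omega> 0)) \<le> sqrt ?W"
      using W[of "\<omega> 0"] W[of "\<omega> n"] by (simp add: divide_le_eq mult_le_cancel_left1)
  qed (use W assms cosh_le_exp_half_square in \<open>auto simp: cosh_real_nonneg order_trans[OF zero_le_one W]\<close>)
  finally have "ln (pmf (steps G n (\<omega> 0)) (\<omega> n)) \<le> ln (2 * sqrt ?W * exp (l\<^sup>2 / 2) ^ n * exp (- l * ?d))"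
    using is_path_pmf_steps_pos[OF w(3)] by (meson ln_le_cancel_iff less_le_trans)
  also have "\<dots> = ln 2 + ln ?W / 2 + real n * (l\<^sup>2 / 2) - l * ?d"
  proof -
    have "ln (a * b * c * d) = ln a + ln b + ln c + ln d" if "0 < a" "0 < b" "0 < c" "0 < d"
      for a b c d :: real
      using that by (simp add: ln_mult)
    from this[of 2 "sqrt ?W" "exp (l\<^sup>2 / 2) ^ n" "exp (- l * ?d)"] show ?thesis
      using W[of "\<omega> n"] by (simp add: ln_sqrt ln_realpow)
  qed
  finally have "l * ?d - real n * (l\<^sup>2 / 2) - ln 2 - ln ?W / 2 \<le> - ln (pmf (steps G n (\<omega> 0)) (\<omega> n))"
    by simp
  then show ?thesis
    using w is_path_shift[OF w(2,3), of n]
    by (simp add: shift_funpow_abs path_prob.abs_eq path_dist.abs_eq root_weight.abs_eq path_iso_refl)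
qed

section \<open>Estimates for the walk on a fixed rooted graph\<close>

lemma nn_integral_srw_from:
  assumes g: "rep_rooted_graph g = (G, x)" "connected_graph G" "x \<in> verts G"
    and F: "F \<in> borel_measurable borel"
    and f: "\<And>\<omega>. is_path G \<omega> \<Longrightarrow> \<omega> 0 = x \<Longrightarrow> F (abs_path_graph (G, \<omega>)) = f (\<omega> n)"
  shows "(\<integral>\<^sup>+w. F w \<partial>srw_from g) = (\<integral>\<^sup>+v. f v \<partial>measure_pmf (steps G n x))"
proof -
  have comp: "(\<lambda>\<omega>. \<omega> n) \<in> chain_law G x \<rightarrow>\<^sub>M count_space UNIV"
    unfolding measurable_cong_sets[OF sets_chain_law refl]
    by (rule measurable_component_singleton) simp
  have "(\<integral>\<^sup>+w. F w \<partial>srw_from g) = (\<integral>\<^sup>+\<omega>. F (abs_path_graph (G, \<omega>)) \<partial>chain_law G x)"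
    unfolding srw_from_def g(1) prod.case
    by (rule nn_integral_distr[OF measurable_abs_path_graph[OF g(2)]]) (simp add: F)
  also have "\<dots> = (\<integral>\<^sup>+\<omega>. f (\<omega> n) \<partial>chain_law G x)"
  proof (rule nn_integral_cong_AE)
    show "AE \<omega> in chain_law G x. F (abs_path_graph (G, \<omega>)) = f (\<omega> n)"
      using AE_chain_law_path[OF g(3)] by eventually_elim (simp add: f)
  qed
  also have "\<dots> = (\<integral>\<^sup>+v. f v \<partial>distr (chain_law G x) (count_space UNIV) (\<lambda>\<omega>. \<omega> n))"
    by (rule nn_integral_distr[OF comp, symmetric]) simp
  finally show ?thesis unfolding distr_chain_law_steps .
qed

lemma set_pmf_steps_ball_verts:
  assumes "connected_graph G" "x \<in> verts G"
  shows "set_pmf (steps G n x) \<subseteq> ball_verts G x n"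
  using walk_verts[OF assms] by (auto simp: map_last_walk[symmetric])

text \<open>Gibbs' inequality against the uniform distribution on \<open>A\<close>, from
  \<open>ln t \<le> t - 1\<close> at \<open>t = 1 / (pmf p v * card A)\<close>.\<close>

lemma entropy_le_ln_card:
  assumes A: "set_pmf p \<subseteq> A" "finite A"
  shows "(\<integral>\<^sup>+v. ennreal (- ln (pmf p v)) \<partial>measure_pmf p) \<le> ennreal (ln (real (card A)))"
proof -
  have fin: "finite (set_pmf p)" using A by (rule finite_subset)
  have "A \<noteq> {}" using A(1) set_pmf_not_empty[of p] by blast
  then have pos: "0 < real (card A)" using A(2) by (simp add: card_gt_0_iff)
  have "pmf p v * - ln (pmf p v) \<le> 1 / real (card A) - pmf p v + pmf p v * ln (real (card A))"
    if "v \<in> set_pmf p" for v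
  proof -
    have p: "0 < pmf p v" using that by (rule pmf_positive)
    have "ln (1 / (pmf p v * real (card A))) \<le> 1 / (pmf p v * real (card A)) - 1"
      using p pos by (intro ln_le_minus_one) simp
    then have "pmf p v * ln (1 / (pmf p v * real (card A))) \<le> pmf p v * (1 / (pmf p v * real (card A)) - 1)"
      using p by (intro mult_left_mono) auto
    then show ?thesis using p pos by (simp add: ln_div ln_mult algebra_simps)
  qed
  then have "(\<Sum>v\<in>set_pmf p. pmf p v * - ln (pmf p v))
      \<le> (\<Sum>v\<in>set_pmf p. 1 / real (card A) - pmf p v + pmf p v * ln (real (card A)))"
    by (rule sum_mono)
  also have "\<dots> = real (card (set_pmf p)) / real (card A) - 1 + ln (real (card A))"
    using sum_pmf_eq_1[OF fin, of p] by (simp add: sum.distrib sum_subtractf sum_distrib_right[symmetric])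
  also have "\<dots> \<le> ln (real (card A))"
    using pos card_mono[OF A(2,1)] by simp
  finally have le: "(\<Sum>v\<in>set_pmf p. pmf p v * - ln (pmf p v)) \<le> ln (real (card A))" .
  have "(\<integral>\<^sup>+v. ennreal (- ln (pmf p v)) \<partial>measure_pmf p)
      = (\<Sum>v\<in>set_pmf p. ennreal (- ln (pmf p v)) * ennreal (pmf p v))"
    by (rule nn_integral_measure_pmf_finite[OF fin]) simp
  also have "\<dots> = (\<Sum>v\<in>set_pmf p. ennreal (pmf p v * - ln (pmf p v)))"
    by (intro sum.cong refl)
      (simp add: ennreal_mult'[symmetric] mult.commute ln_le_zero_iff pmf_le_1 pmf_positive)
  also have "\<dots> = ennreal (\<Sum>v\<in>set_pmf p. pmf p v * - ln (pmf p v))"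
    by (rule sum_ennreal) (simp add: mult_nonneg_nonpos ln_le_zero_iff pmf_le_1 pmf_positive)
  finally show ?thesis using le by (simp add: ennreal_leI)
qed

lemma ball_size_abs:
  assumes "rep_rooted_graph g = (G, x)" "g = abs_rooted_graph (G, x)" "connected_graph G" "x \<in> verts G"
  shows "ball_size r g = card (ball_verts G x r)"
  using assms by (simp add: ball_size.abs_eq rooted_iso_refl)

lemma ball_size_ge_1: "1 \<le> ball_size r g"
proof -
  obtain G x where g: "rep_rooted_graph g = (G, x)" "g = abs_rooted_graph (G, x)"
    "connected_graph G" "x \<in> verts G" by (rule rep_rooted_graphE)
  have "ball_verts G x r \<noteq> {}" using root_in_ball_verts[OF g(4)] by blast
  then have "0 < card (ball_verts G x r)"
    using finite_ball_verts[OF g(3,4)] by (simp add: card_gt_0_iff)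
  then show ?thesis by (simp add: ball_size_abs[OF g])
qed

lemma ball_size_mono:
  assumes "r \<le> s"
  shows "ball_size r g \<le> ball_size s g"
proof -
  obtain G x where g: "rep_rooted_graph g = (G, x)" "g = abs_rooted_graph (G, x)"
    "connected_graph G" "x \<in> verts G" by (rule rep_rooted_graphE)
  have "ball_verts G x r \<subseteq> ball_verts G x s" using assms by (auto simp: ball_verts_def)
  then show ?thesis
    using finite_ball_verts[OF g(3,4)] by (simp add: ball_size_abs[OF g] card_mono)
qed

lemma srw_from_one_step_entropy:
  "(\<integral>\<^sup>+w. ennreal (- ln (path_prob 1 w)) \<partial>srw_from g) \<le> ennreal (ln (real (ball_size 1 g)))"
proof -
  obtain G x where g: "rep_rooted_graph g = (G, x)" "g = abs_rooted_graph (G, x)"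
    "connected_graph G" "x \<in> verts G" by (rule rep_rooted_graphE)
  have "(\<integral>\<^sup>+w. ennreal (- ln (path_prob 1 w)) \<partial>srw_from g)
      = (\<integral>\<^sup>+v. ennreal (- ln (pmf (steps G 1 x) v)) \<partial>measure_pmf (steps G 1 x))"
  proof (rule nn_integral_srw_from[OF g(1,3,4)])
    show "(\<lambda>w. ennreal (- ln (path_prob 1 w))) \<in> borel_measurable borel" by measurable
    show "ennreal (- ln (path_prob 1 (abs_path_graph (G, \<omega>)))) = ennreal (- ln (pmf (steps G 1 x) (\<omega> 1)))"
      if "is_path G \<omega>" "\<omega> 0 = x" for \<omega>
      using that g by (simp add: path_prob.abs_eq path_iso_refl del: steps.simps)
  qed
  also have "\<dots> \<le> ennreal (ln (real (card (ball_verts G x 1))))"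
    by (intro entropy_le_ln_card set_pmf_steps_ball_verts finite_ball_verts g)
  finally show ?thesis by (simp add: ball_size_abs[OF g])
qed

lemma srw_from_small_prob:
  assumes "0 \<le> \<delta>"
  shows "emeasure (srw_from g) {w. path_dist n w \<le> r \<and> path_prob n w \<le> \<delta>}
    \<le> ennreal (real (ball_size r g) * \<delta>)"
proof -
  obtain G x where g: "rep_rooted_graph g = (G, x)" "g = abs_rooted_graph (G, x)"
    "connected_graph G" "x \<in> verts G" by (rule rep_rooted_graphE)
  let ?E = "{w. path_dist n w \<le> r \<and> path_prob n w \<le> \<delta>}"
  let ?V = "{v. gdist G x v \<le> r \<and> pmf (steps G n x) v \<le> \<delta>}"
  \<comment> \<open>The distance to a label that is not a vertex is a default value, so
    \<open>?V\<close> may contain infinitely many such labels; they carry no mass and the ball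
    removes them.\<close>
  let ?S = "?V \<inter> ball_verts G x r"
  have E: "?E \<in> sets borel" by measurable
  have fin: "finite ?S" using finite_ball_verts[OF g(3,4)] by simp
  have "emeasure (srw_from g) ?E = (\<integral>\<^sup>+w. indicator ?E w \<partial>srw_from g)"
    using E by (simp add: sets_srw_from)
  also have "\<dots> = (\<integral>\<^sup>+v. indicator ?V v \<partial>measure_pmf (steps G n x))"
  proof (rule nn_integral_srw_from[OF g(1,3,4)])
    show "(indicator ?E :: _ \<Rightarrow> ennreal) \<in> borel_measurable borel" using E by measurable
    show "indicator ?E (abs_path_graph (G, \<omega>)) = indicator ?V (\<omega> n)"
      if "is_path G \<omega>" "\<omega> 0 = x" for \<omega>
      using that g by (simp add: path_prob.abs_eq path_dist.abs_eq path_iso_refl indicator_def)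
  qed
  also have "\<dots> = emeasure (measure_pmf (steps G n x)) ?V" by simp
  also have "\<dots> = emeasure (measure_pmf (steps G n x)) ?S"
    using set_pmf_steps_verts[OF g(3,4), of n]
    by (intro emeasure_eq_AE) (auto simp: AE_measure_pmf_iff ball_verts_def)
  also have "\<dots> = ennreal (\<Sum>v\<in>?S. pmf (steps G n x) v)"
    by (simp add: measure_pmf.emeasure_eq_measure measure_measure_pmf_finite[OF fin])
  also have "\<dots> \<le> ennreal (real (ball_size r g) * \<delta>)"
  proof (rule ennreal_leI)
    have "(\<Sum>v\<in>?S. pmf (steps G n x) v) \<le> (\<Sum>v\<in>?S. \<delta>)" by (rule sum_mono) simp
    also have "\<dots> = real (card ?S) * \<delta>" by simp
    also have "\<dots> \<le> real (ball_size r g) * \<delta>"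
      unfolding ball_size_abs[OF g]
      by (intro mult_right_mono of_nat_mono card_mono finite_ball_verts g assms) auto
    finally show "(\<Sum>v\<in>?S. pmf (steps G n x) v) \<le> real (ball_size r g) * \<delta>" .
  qed
  finally show ?thesis .
qed

definition mean_log_ball :: "rooted_graph measure \<Rightarrow> nat \<Rightarrow> ennreal" where
  "mean_log_ball \<mu> r = (\<integral>\<^sup>+g. ennreal (ln (real (ball_size r g))) \<partial>\<mu>)"

lemma mean_log_ball_mono: "r \<le> s \<Longrightarrow> mean_log_ball \<mu> r \<le> mean_log_ball \<mu> s"
  unfolding mean_log_ball_def
  using ball_size_mono ball_size_ge_1
  by (intro nn_integral_mono ennreal_leI) (simp add: Suc_le_eq)

section \<open>Averages over the random graph\<close>

context
  fixes \<mu> :: "rooted_graph measure"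
  assumes \<mu>: "random_graph \<mu>"
begin

lemma sets_random_graph [measurable_cong]: "sets \<mu> = sets borel"
  using \<mu> by (simp add: random_graph_def)

lemma in_prob_algebra: "\<mu> \<in> space (prob_algebra borel)"
  using \<mu> by (simp add: random_graph_def space_prob_algebra)

lemma prob_space_srw_law: "prob_space (srw_law \<mu>)"
  unfolding srw_law_def by (rule prob_space_bind'[OF in_prob_algebra measurable_srw_from])

lemma sets_srw_law [measurable_cong]: "sets (srw_law \<mu>) = sets borel"
  unfolding srw_law_def by (rule sets_bind'[OF in_prob_algebra measurable_srw_from])

lemma nn_integral_srw_law:
  assumes "F \<in> borel_measurable borel"
  shows "(\<integral>\<^sup>+w. F w \<partial>srw_law \<mu>) = (\<integral>\<^sup>+g. \<integral>\<^sup>+w. F w \<partial>srw_from g \<partial>\<mu>)"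
  unfolding srw_law_def
  by (rule nn_integral_bind[OF assms])
    (use measurable_prob_algebraD[OF measurable_srw_from] in \<open>simp add: measurable_cong_sets[OF sets_random_graph refl]\<close>)

lemma srw_law_one_step_entropy:
  "(\<integral>\<^sup>+w. ennreal (- ln (path_prob 1 w)) \<partial>srw_law \<mu>) \<le> mean_log_ball \<mu> 1"
  unfolding mean_log_ball_def
  by (subst nn_integral_srw_law) (simp, intro nn_integral_mono srw_from_one_step_entropy)

text \<open>The union bound involves the ball size, of which only the mean logarithm is controlled.
  Hence the split at \<open>ln (ball_size r g) = a - b\<close>: below it the union bound gives
  \<open>exp (- b)\<close>, above it the trivial bound 1 is absorbed as in Markov's
  inequality.\<close>

lemma srw_law_small_prob:
  assumes "0 \<le> b" "b < a"
  shows "emeasure (srw_law \<mu>) {w. path_dist n w \<le> r \<and> path_prob n w \<le> exp (- a)}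
    \<le> ennreal (exp (- b)) + mean_log_ball \<mu> r / ennreal (a - b)"
proof -
  interpret prob_space \<mu> using \<mu> by (simp add: random_graph_def)
  let ?E = "{w. path_dist n w \<le> r \<and> path_prob n w \<le> exp (- a)}"
  let ?L = "\<lambda>g. ln (real (ball_size r g))"
  have E: "?E \<in> sets borel" by measurable
  have L [measurable]: "?L \<in> borel_measurable \<mu>" by measurable
  have pointwise: "emeasure (srw_from g) ?E \<le> ennreal (exp (- b)) + ennreal (?L g) / ennreal (a - b)" for g
  proof -
    have N: "1 \<le> real (ball_size r g)" using ball_size_ge_1[of r g] by simp
    show ?thesis
    proof (cases "?L g \<le> a - b")
      case True
      have "real (ball_size r g) * exp (- a) = exp (?L g - a)"
        using N by (simp add: exp_diff exp_minus divide_inverse)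
      also have "\<dots> \<le> exp (- b)" using True by simp
      finally have "emeasure (srw_from g) ?E \<le> ennreal (exp (- b))"
        using srw_from_small_prob[of "exp (- a)" g n r] by (auto intro: order_trans ennreal_leI)
      then show ?thesis by (auto intro: order_trans)
    next
      case False
      interpret S: prob_space "srw_from g" by (rule prob_space_srw_from)
      have "emeasure (srw_from g) ?E \<le> ennreal 1" using S.emeasure_le_1 by simp
      also have "\<dots> \<le> ennreal (?L g / (a - b))"
        using False assms by (intro ennreal_leI) (simp add: field_simps)
      also have "\<dots> = ennreal (?L g) / ennreal (a - b)"
        using assms N by (simp add: divide_ennreal)
      finally show ?thesis by (auto intro: order_trans)
    qed
  qed
  have "emeasure (srw_law \<mu>) ?E = (\<integral>\<^sup>+w. indicator ?E w \<partial>srw_law \<mu>)"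
    using E by (simp add: sets_srw_law)
  also have "\<dots> = (\<integral>\<^sup>+g. emeasure (srw_from g) ?E \<partial>\<mu>)"
    using E by (subst nn_integral_srw_law) (auto simp: sets_srw_from intro!: nn_integral_cong)
  also have "\<dots> \<le> (\<integral>\<^sup>+g. ennreal (exp (- b)) + ennreal (?L g) / ennreal (a - b) \<partial>\<mu>)"
    by (intro nn_integral_mono pointwise)
  also have "\<dots> = ennreal (exp (- b)) + mean_log_ball \<mu> r / ennreal (a - b)"
    by (simp add: nn_integral_add nn_integral_divide emeasure_space_1 mean_log_ball_def)
  finally show ?thesis .
qed

end

section \<open>Drift and entropy\<close>

lemma growth_nonneg: "0 \<le> growth \<mu>"
  unfolding growth_def
  by (intro Liminf_bounded always_eventually allI) simp

lemma growth_finite_imp_mean_log_ball: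
  assumes "growth \<mu> < \<infinity>"
  shows "mean_log_ball \<mu> 1 < \<infinity>"
proof -
  have "\<exists>\<^sub>F r in sequentially. enn2ereal (mean_log_ball \<mu> r) / ereal (real r) < \<infinity>"
  proof (rule ccontr)
    assume "\<not> ?thesis"
    then have "\<forall>\<^sub>F r in sequentially. \<infinity> \<le> enn2ereal (mean_log_ball \<mu> r) / ereal (real r)"
      by (simp add: not_frequently not_less)
    then have "\<infinity> \<le> growth \<mu>"
      unfolding growth_def mean_log_ball_def by (rule Liminf_bounded)
    then show False using assms by simp
  qed
  then obtain r where r: "1 \<le> r" "enn2ereal (mean_log_ball \<mu> r) / ereal (real r) < \<infinity>"
    unfolding frequently_sequentially by blast
  have "mean_log_ball \<mu> r \<noteq> \<infinity>"
    using r by auto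
  then show ?thesis
    using mean_log_ball_mono[OF r(1), of \<mu>] by (auto simp: less_top top_unique)
qed

locale ergodic_random_graph =
  fixes \<mu> :: "rooted_graph measure"
  assumes ergodic_stationary: "ergodic_stationary \<mu>"
    and growth_finite: "growth \<mu> < \<infinity>"
begin

abbreviation M :: "path_graph measure" where "M \<equiv> srw_law \<mu>"

lemma random_graph: "random_graph \<mu>"
  using ergodic_stationary by (simp add: ergodic_stationary_def)

sublocale ergodic_system M shift
proof -
  interpret prob_space M by (rule prob_space_srw_law[OF random_graph])
  show "ergodic_system M shift"
    by unfold_locales (use ergodic_stationary in \<open>simp add: ergodic_stationary_def\<close>)
qed

lemma sets_M [measurable_cong]: "sets M = sets borel"
  by (rule sets_srw_law[OF random_graph])

lemma space_M [simp]: "space M = UNIV"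
  using sets_eq_imp_space_eq[OF sets_M] by simp

lemma speed_converges: "\<exists>l. converges_to_const M speed l"
proof -
  have "\<exists>l. converges_to_const M (\<lambda>n w. real (path_dist n w) / real n) l"
  proof (rule kingman)
    show "integrable M (\<lambda>w. real (path_dist 1 w))"
      by (rule integrable_const_bound[of _ 1]) (use path_dist_le[of 1] in auto)
    show "real (path_dist (m + n) w) \<le> real (path_dist m w) + real (path_dist n ((shift ^^ m) w))"
      for m n w
      using path_dist_add[of m n w] by linarith
  qed (auto simp: path_dist_0)
  then show ?thesis by (simp add: speed_def[abs_def])
qed

lemma info_rate_converges: "\<exists>h. converges_to_const M info_rate h"
proof -
  have "\<exists>h. converges_to_const M (\<lambda>n w. - ln (path_prob n w) / real n) h"
  proof (rule kingman)
    have "(\<integral>\<^sup>+w. ennreal (norm (- ln (path_prob 1 w))) \<partial>M) = (\<integral>\<^sup>+w. ennreal (- ln (path_prob 1 w)) \<partial>M)"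
      by (intro nn_integral_cong) (simp add: path_prob_pos path_prob_le_1)
    also have "\<dots> \<le> mean_log_ball \<mu> 1" by (rule srw_law_one_step_entropy[OF random_graph])
    also have "\<dots> < \<infinity>" by (rule growth_finite_imp_mean_log_ball[OF growth_finite])
    finally show "integrable M (\<lambda>w. - ln (path_prob 1 w))"
      by (intro integrableI_bounded) auto
    show "- ln (path_prob (m + n) w) \<le> - ln (path_prob m w) + - ln (path_prob n ((shift ^^ m) w))"
      for m n w
    proof -
      have "ln (path_prob m w * path_prob n ((shift ^^ m) w)) \<le> ln (path_prob (m + n) w)"
        by (subst ln_le_cancel_iff) (simp_all add: path_prob_add path_prob_pos)
      then show ?thesis by (simp add: ln_mult path_prob_pos less_imp_neq[OF path_prob_pos, symmetric])
    qed
    show "0 \<le> - ln (path_prob n w)" for n w by (simp add: path_prob_pos path_prob_le_1)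
  qed (auto simp: path_prob_0)
  then show ?thesis by (simp add: info_rate_def[abs_def])
qed

text \<open>This constant and the next are supplied by Kingman's theorem. Uniqueness of almost sure
  limits identifies them with the definite descriptions \<open>linear_drift\<close> and
  \<open>srw_entropy\<close>.\<close>

definition drift :: real where "drift = (SOME l. converges_to_const M speed l)"

definition walk_entropy :: real where "walk_entropy = (SOME h. converges_to_const M info_rate h)"

lemma speed_converges_drift: "converges_to_const M speed drift"
  unfolding drift_def using speed_converges by (rule someI_ex)

lemma info_rate_converges_entropy: "converges_to_const M info_rate walk_entropy"
  unfolding walk_entropy_def using info_rate_converges by (rule someI_ex)

lemma AE_ex: "AE w in M. P w \<Longrightarrow> \<exists>w. P w"
  using eventually_happens'[OF ae_filter_bot] by blast

lemma AE_speed: "AE w in M. (\<lambda>n. speed n w) \<longlonglongrightarrow> drift"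
  using speed_converges_drift by (simp add: converges_to_const_def)

lemma AE_info_rate: "AE w in M. (\<lambda>n. info_rate n w) \<longlonglongrightarrow> walk_entropy"
  using info_rate_converges_entropy by (simp add: converges_to_const_def)

lemma linear_drift_eq: "linear_drift \<mu> = drift"
  unfolding linear_drift_def
proof (rule the_equality)
  show "AE w in M. (\<lambda>n. speed n w) \<longlonglongrightarrow> drift" by (rule AE_speed)
  fix l assume "AE w in M. (\<lambda>n. speed n w) \<longlonglongrightarrow> l"
  with AE_speed have "AE w in M. l = drift"
    by eventually_elim (rule LIMSEQ_unique)
  then show "l = drift" using AE_ex by blast
qed

lemma srw_entropy_eq: "srw_entropy \<mu> = ereal walk_entropy"
  unfolding srw_entropy_def
proof (rule the_equality)
  show lim: "AE w in M. (\<lambda>n. ereal (info_rate n w)) \<longlonglongrightarrow> ereal walk_entropy"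
    using AE_info_rate by eventually_elim simp
  fix h assume "AE w in M. (\<lambda>n. ereal (info_rate n w)) \<longlonglongrightarrow> h"
  with lim have "AE w in M. h = ereal walk_entropy"
    by eventually_elim (rule LIMSEQ_unique)
  then show "h = ereal walk_entropy" using AE_ex by blast
qed

lemma drift_nonneg: "0 \<le> drift"
proof -
  obtain w where "(\<lambda>n. speed n w) \<longlonglongrightarrow> drift" using AE_ex[OF AE_speed] by blast
  then show ?thesis by (rule LIMSEQ_le_const) (auto simp: speed_def)
qed

section \<open>The lower bound for the entropy\<close>

lemma half_drift_square_le_entropy: "drift\<^sup>2 / 2 \<le> walk_entropy"
proof -
  \<comment> \<open>Truncation at 1 supplies the dominating function that
    \<open>ln (root_weight w)\<close> itself may lack.\<close>
  define u where "u n w = min 1 (ln (root_weight w) / real n)" for n w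
  have meas [measurable]: "u n \<in> borel_measurable M" for n unfolding u_def by measurable
  have u: "0 \<le> u n w" "u n w \<le> 1" for n w using root_weight_ge_1[of w] by (auto simp: u_def)
  have int: "integrable M (u n)" for n
    by (rule integrable_const_bound[of _ 1]) (use u in auto)
  have "(\<lambda>n. \<integral>w. u n w \<partial>M) \<longlonglongrightarrow> (\<integral>w. 0 \<partial>M)"
  proof (rule integral_dominated_convergence[where w="\<lambda>_. 1"])
    show "AE w in M. (\<lambda>n. u n w) \<longlonglongrightarrow> 0"
    proof (intro AE_I2)
      fix w
      have "(\<lambda>n. u n w) \<longlonglongrightarrow> min 1 0"
        unfolding u_def by (intro tendsto_intros lim_const_over_n)
      then show "(\<lambda>n. u n w) \<longlonglongrightarrow> 0" by simp
    qed
  qed (use u in auto)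
  \<comment> \<open>The shift preserves the law, so the truncated term at the endpoint has the mean
    computed at the root; mean convergence then yields an almost surely convergent
    subsequence.\<close>
  then have "(\<lambda>n. \<integral>w. norm (u n ((shift ^^ n) w)) \<partial>M) \<longlonglongrightarrow> 0"
    using u by (simp add: expectation_T_funpow)
  then obtain r where r: "strict_mono r" "AE w in M. (\<lambda>n. u (r n) ((shift ^^ r n) w)) \<longlonglongrightarrow> 0"
    using tendsto_L1_AE_subseq[of M "\<lambda>n w. u n ((shift ^^ n) w)"] integrable_T_funpow[OF int] by blast
  have "AE w in M. (\<lambda>n. speed n w) \<longlonglongrightarrow> drift \<and> (\<lambda>n. info_rate n w) \<longlonglongrightarrow> walk_entropy
      \<and> (\<lambda>n. u (r n) ((shift ^^ r n) w)) \<longlonglongrightarrow> 0"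
    using AE_speed AE_info_rate r(2) by eventually_elim blast
  then obtain w where w: "(\<lambda>n. speed n w) \<longlonglongrightarrow> drift" "(\<lambda>n. info_rate n w) \<longlonglongrightarrow> walk_entropy"
    "(\<lambda>n. u (r n) ((shift ^^ r n) w)) \<longlonglongrightarrow> 0"
    using AE_ex by blast
  have r_top: "filterlim r at_top sequentially" using r(1) by (rule filterlim_subseq)
  have "\<forall>\<^sub>F n in sequentially. drift * speed (r n) w - drift\<^sup>2 / 2 - ln 2 / real (r n)
      - u (r n) ((shift ^^ r n) w) / 2 \<le> info_rate (r n) w"
    \<comment> \<open>Along the subsequence \<open>u\<close> is eventually below 1, where its
      truncation is inactive.\<close>
    using order_tendstoD(2)[OF w(3) zero_less_one]
      filterlim_at_top_dense[THEN iffD1, OF filterlim_compose[OF filterlim_real_sequentially r_top], rule_format, of 0]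
  proof eventually_elim
    case (elim n)
    let ?W = "root_weight ((shift ^^ r n) w)"
    have "u (r n) ((shift ^^ r n) w) = ln ?W / real (r n)"
      using elim(1) by (auto simp: u_def min_def split: if_splits)
    moreover have "(drift * real (path_dist (r n) w) - real (r n) * (drift\<^sup>2 / 2) - ln 2 - ln ?W / 2) / real (r n)
        \<le> info_rate (r n) w"
      unfolding info_rate_def by (intro divide_right_mono path_prob_carne drift_nonneg) simp
    ultimately show ?case
      using elim(2) by (simp add: speed_def diff_divide_distrib)
  qed
  \<comment> \<open>The parameter \<open>l = drift\<close> maximizes the limit
    \<open>l * drift - l\<^sup>2 / 2\<close> of the bound, with value
    \<open>drift\<^sup>2 / 2\<close>.\<close>
  moreover have "(\<lambda>n. drift * speed (r n) w - drift\<^sup>2 / 2 - ln 2 / real (r n) - u (r n) ((shift ^^ r n) w) / 2)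
      \<longlonglongrightarrow> drift * drift - drift\<^sup>2 / 2 - 0 - 0 / 2"
    by (intro tendsto_intros w(3) filterlim_compose[OF w(1) r_top] filterlim_compose[OF lim_const_over_n r_top])
      simp
  moreover have "(\<lambda>n. info_rate (r n) w) \<longlonglongrightarrow> walk_entropy"
    by (rule filterlim_compose[OF w(2) r_top])
  ultimately have "drift * drift - drift\<^sup>2 / 2 - 0 - 0 / 2 \<le> walk_entropy"
    by (intro tendsto_le[OF sequentially_bot])
  then show ?thesis by (simp add: power2_eq_square)
qed

section \<open>The upper bound for the entropy\<close>

lemma prob_deviation:
  assumes f: "converges_to_const M f c" and meas: "\<And>n. f n \<in> borel_measurable M" and "0 < \<epsilon>"
  shows "(\<lambda>n. prob {w. \<bar>f n w - c\<bar> < \<epsilon>}) \<longlonglongrightarrow> 1"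
proof -
  note [measurable] = meas
  have A [measurable]: "{w \<in> space M. \<bar>f n w - c\<bar> < \<epsilon>} \<in> sets M" for n by measurable
  have "(\<lambda>n. \<integral>w. indicator {w. \<bar>f n w - c\<bar> < \<epsilon>} w \<partial>M) \<longlonglongrightarrow> (\<integral>w. (1 :: real) \<partial>M)"
  proof (rule integral_dominated_convergence[where w="\<lambda>_. 1"])
    show "AE w in M. (\<lambda>n. indicator {w. \<bar>f n w - c\<bar> < \<epsilon>} w :: real) \<longlonglongrightarrow> 1"
    proof -
      have "AE w in M. (\<lambda>n. f n w) \<longlonglongrightarrow> c" using f by (simp add: converges_to_const_def)
      then show ?thesis
      proof eventually_elim
        case (elim w)
        then have "\<forall>\<^sub>F n in sequentially. \<bar>f n w - c\<bar> < \<epsilon>"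
          using \<open>0 < \<epsilon>\<close> by (simp add: tendsto_iff dist_real_def)
        then have "\<forall>\<^sub>F n in sequentially. indicator {w. \<bar>f n w - c\<bar> < \<epsilon>} w = (1 :: real)"
          by eventually_elim simp
        then show ?case by (rule tendsto_eventually)
      qed
    qed
  qed (use A in \<open>auto simp: indicator_def\<close>)
  then show ?thesis using A prob_space by simp
qed

text \<open>The two probabilities stay explicit, so that the limit can be taken later with
  \<open>n\<close> depending on \<open>r\<close>. Values are extended because the mean may be
  infinite at a particular radius.\<close>

lemma mean_log_ball_ge:
  assumes \<epsilon>: "0 < \<epsilon>" "2 * \<epsilon> < walk_entropy" and n: "1 \<le> n" "real n * (drift + \<epsilon>) \<le> real r"
  shows "ereal ((walk_entropy - 2 * \<epsilon>) * real n * (prob {w. \<bar>speed n w - drift\<bar> < \<epsilon>}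
      + prob {w. \<bar>info_rate n w - walk_entropy\<bar> < \<epsilon>} - 1 - exp (- \<epsilon> * real n)))
    \<le> enn2ereal (mean_log_ball \<mu> r)"
proof (cases "mean_log_ball \<mu> r")
  case top
  then show ?thesis by simp
next
  case (real e)
  let ?A = "{w. \<bar>speed n w - drift\<bar> < \<epsilon>}" and ?B = "{w. \<bar>info_rate n w - walk_entropy\<bar> < \<epsilon>}"
  let ?a = "(walk_entropy - \<epsilon>) * real n" and ?b = "\<epsilon> * real n"
  let ?E = "{w. path_dist n w \<le> r \<and> path_prob n w \<le> exp (- ?a)}"
  have ab: "0 < ?a - ?b" using \<epsilon> n(1) by (simp add: left_diff_distrib[symmetric])
  have [measurable]: "speed n \<in> borel_measurable M" "info_rate n \<in> borel_measurable M"
    unfolding speed_def[abs_def] info_rate_def[abs_def] by measurable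
  have A: "?A \<in> sets M" using measurable_sets[of "\<lambda>w. \<bar>speed n w - drift\<bar>" M borel "{..<\<epsilon>}"]
    by (simp add: vimage_def lessThan_def)
  have B: "?B \<in> sets M" using measurable_sets[of "\<lambda>w. \<bar>info_rate n w - walk_entropy\<bar>" M borel "{..<\<epsilon>}"]
    by (simp add: vimage_def lessThan_def)
  have E: "?E \<in> sets M" unfolding sets_M by measurable
  have "?A \<inter> ?B \<subseteq> ?E"
  proof clarify
    fix w assume w: "\<bar>speed n w - drift\<bar> < \<epsilon>" "\<bar>info_rate n w - walk_entropy\<bar> < \<epsilon>"
    have "speed n w \<le> drift + \<epsilon>" using w(1) by simp
    then have "real (path_dist n w) \<le> real n * (drift + \<epsilon>)"
      using n(1) by (simp add: speed_def field_simps)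
    moreover have "walk_entropy - \<epsilon> \<le> info_rate n w" using w(2) by simp
    then have "ln (path_prob n w) \<le> - ?a"
      using n(1) by (simp add: info_rate_def field_simps)
    then have "exp (ln (path_prob n w)) \<le> exp (- ?a)" by simp
    ultimately show "path_dist n w \<le> r \<and> path_prob n w \<le> exp (- ?a)"
      using n(2) by (simp add: path_prob_pos)
  qed
  then have "prob (?A \<inter> ?B) \<le> prob ?E" using E by (rule finite_measure_mono)
  \<comment> \<open>Inclusion-exclusion, since nothing is known about the dependence of the two
    events.\<close>
  moreover have "prob ?A + prob ?B - 1 \<le> prob (?A \<inter> ?B)"
    using finite_measure_Union'[OF A B] A B prob_le_1[of "?A \<union> ?B"]
      finite_measure_Diff'[OF B A] by (simp add: Int_commute)
  moreover have "prob ?E \<le> exp (- ?b) + e / (?a - ?b)"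
  proof -
    have "ennreal (prob ?E) \<le> ennreal (exp (- ?b)) + ennreal e / ennreal (?a - ?b)"
      using srw_law_small_prob[OF random_graph, of ?b ?a n r] ab \<epsilon> real
      by (simp add: emeasure_eq_measure)
    also have "\<dots> = ennreal (exp (- ?b) + e / (?a - ?b))"
      using ab real by (simp add: divide_ennreal)
    finally show ?thesis using ab real by (subst (asm) ennreal_le_iff) auto
  qed
  ultimately have "prob ?A + prob ?B - 1 - exp (- \<epsilon> * real n) \<le> e / (?a - ?b)" by simp
  then have "(?a - ?b) * (prob ?A + prob ?B - 1 - exp (- \<epsilon> * real n)) \<le> e"
    using ab by (simp add: pos_le_divide_eq mult.commute)
  moreover have "?a - ?b = (walk_entropy - 2 * \<epsilon>) * real n" by (simp add: algebra_simps)
  ultimately show ?thesis using real by simp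
qed

lemma entropy_le_growth:
  assumes \<epsilon>: "0 < \<epsilon>" "2 * \<epsilon> < walk_entropy"
  shows "ereal ((walk_entropy - 2 * \<epsilon>) / (drift + \<epsilon>)) \<le> growth \<mu>"
proof -
  have d: "0 < drift + \<epsilon>" using \<epsilon> drift_nonneg by simp
  \<comment> \<open>The largest time whose typical ball, of radius
    \<open>(drift + \<epsilon>) * n\<close>, fits into radius \<open>r\<close>. Taking \<epsilon>
    positive also covers zero drift.\<close>
  define k where "k r = nat \<lfloor>real r / (drift + \<epsilon>)\<rfloor>" for r
  define p where "p n = prob {w. \<bar>speed n w - drift\<bar> < \<epsilon>} + prob {w. \<bar>info_rate n w - walk_entropy\<bar> < \<epsilon>}
    - 1 - exp (- \<epsilon> * real n)" for n
  have k_le: "real (k r) \<le> real r / (drift + \<epsilon>)" for r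
    using d by (simp add: k_def)
  have k_ge: "real r / (drift + \<epsilon>) - 1 \<le> real (k r)" for r
    using d by (simp add: k_def)
  have k_ratio: "(\<lambda>r. real (k r) / real r) \<longlonglongrightarrow> 1 / (drift + \<epsilon>)"
  proof (rule tendsto_sandwich)
    show "(\<lambda>r. 1 / (drift + \<epsilon>) - 1 / real r) \<longlonglongrightarrow> 1 / (drift + \<epsilon>)"
      using tendsto_diff[OF tendsto_const lim_const_over_n] by fastforce
    show "\<forall>\<^sub>F r in sequentially. 1 / (drift + \<epsilon>) - 1 / real r \<le> real (k r) / real r"
      using eventually_gt_at_top[of 0]
    proof eventually_elim
      case (elim r)
      have "(real r / (drift + \<epsilon>) - 1) / real r \<le> real (k r) / real r"
        by (intro divide_right_mono k_ge) simp
      then show ?case using elim by (simp add: diff_divide_distrib)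
    qed
    show "\<forall>\<^sub>F r in sequentially. real (k r) / real r \<le> 1 / (drift + \<epsilon>)"
      using eventually_gt_at_top[of 0]
    proof eventually_elim
      case (elim r)
      have "real (k r) / real r \<le> (real r / (drift + \<epsilon>)) / real r"
        by (intro divide_right_mono k_le) simp
      then show ?case using elim by simp
    qed
  qed simp
  have k_top: "filterlim k at_top sequentially"
    unfolding filterlim_at_top
  proof
    fix N :: nat
    obtain R :: nat where R: "(real N + 1) * (drift + \<epsilon>) \<le> real R" using real_arch_simple by blast
    have "N \<le> k r" if "R \<le> r" for r
    proof -
      have "(real N + 1) * (drift + \<epsilon>) \<le> real r" using R that by (meson of_nat_mono order_trans)
      then have "real N + 1 \<le> real r / (drift + \<epsilon>)" using d by (simp add: pos_le_divide_eq)
      then show ?thesis using k_ge[of r] by simp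
    qed
    then show "\<forall>\<^sub>F r in sequentially. N \<le> k r" by (rule eventually_sequentiallyI)
  qed
  have p_lim: "p \<longlonglongrightarrow> 1 + 1 - 1 - 0"
    unfolding p_def
  proof (intro tendsto_intros)
    show "(\<lambda>n. prob {w. \<bar>speed n w - drift\<bar> < \<epsilon>}) \<longlonglongrightarrow> 1"
      by (rule prob_deviation[OF speed_converges_drift _ \<epsilon>(1)]) (simp add: speed_def[abs_def])
    show "(\<lambda>n. prob {w. \<bar>info_rate n w - walk_entropy\<bar> < \<epsilon>}) \<longlonglongrightarrow> 1"
      by (rule prob_deviation[OF info_rate_converges_entropy _ \<epsilon>(1)]) (simp add: info_rate_def[abs_def])
    show "(\<lambda>n. exp (- \<epsilon> * real n)) \<longlonglongrightarrow> 0"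
      unfolding exp_of_nat2_mult using \<epsilon>(1) by (intro LIMSEQ_realpow_zero) auto
  qed
  have "(\<lambda>r. (walk_entropy - 2 * \<epsilon>) * (real (k r) / real r) * p (k r))
      \<longlonglongrightarrow> (walk_entropy - 2 * \<epsilon>) * (1 / (drift + \<epsilon>)) * (1 + 1 - 1 - 0)"
    by (intro tendsto_intros k_ratio filterlim_compose[OF p_lim k_top])
  then have lim: "(\<lambda>r. ereal ((walk_entropy - 2 * \<epsilon>) * (real (k r) / real r) * p (k r)))
      \<longlonglongrightarrow> ereal ((walk_entropy - 2 * \<epsilon>) / (drift + \<epsilon>))"
    by simp
  have "ereal ((walk_entropy - 2 * \<epsilon>) / (drift + \<epsilon>))
      = liminf (\<lambda>r. ereal ((walk_entropy - 2 * \<epsilon>) * (real (k r) / real r) * p (k r)))"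
    using lim_imp_Liminf[OF sequentially_bot lim] by simp
  also have "\<dots> \<le> growth \<mu>"
    unfolding growth_def mean_log_ball_def[symmetric]
  proof (rule Liminf_mono)
    have "\<forall>\<^sub>F r in sequentially. 1 \<le> k r" using k_top by (simp add: filterlim_at_top)
    then show "\<forall>\<^sub>F r in sequentially. ereal ((walk_entropy - 2 * \<epsilon>) * (real (k r) / real r) * p (k r))
        \<le> enn2ereal (mean_log_ball \<mu> r) / ereal (real r)"
      using eventually_gt_at_top[of 0]
    proof eventually_elim
      case (elim r)
      have "real (k r) * (drift + \<epsilon>) \<le> real r"
        using k_le[of r] d by (simp add: field_simps)
      from mean_log_ball_ge[OF \<epsilon> elim(1) this]
      have "ereal ((walk_entropy - 2 * \<epsilon>) * real (k r) * p (k r)) \<le> enn2ereal (mean_log_ball \<mu> r)"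
        by (simp add: p_def)
      then have "ereal ((walk_entropy - 2 * \<epsilon>) * real (k r) * p (k r)) / ereal (real r)
          \<le> enn2ereal (mean_log_ball \<mu> r) / ereal (real r)"
        by (rule ereal_divide_right_mono) (use elim in simp)
      then show ?case using elim by simp
    qed
  qed
  finally show ?thesis .
qed

lemma entropy_le_drift_growth: "ereal walk_entropy \<le> ereal drift * growth \<mu>"
proof -
  obtain v where v: "growth \<mu> = ereal v" "0 \<le> v"
    using growth_nonneg[of \<mu>] growth_finite by (cases "growth \<mu>") auto
  have "walk_entropy \<le> drift * v"
  proof (rule ccontr)
    assume "\<not> walk_entropy \<le> drift * v"
    \<comment> \<open>With this \<epsilon> the gap
      \<open>walk_entropy - 2 * \<epsilon> - v * (drift + \<epsilon>)\<close> equals \<epsilon> and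
      is positive, against \<open>entropy_le_growth\<close>.\<close>
    define \<epsilon> where "\<epsilon> = (walk_entropy - drift * v) / (3 + v)"
    have \<epsilon>: "0 < \<epsilon>" "(3 + v) * \<epsilon> = walk_entropy - drift * v"
      using \<open>\<not> walk_entropy \<le> drift * v\<close> v(2) by (simp_all add: \<epsilon>_def)
    have "0 \<le> drift * v" "0 \<le> v * \<epsilon>" using v(2) drift_nonneg \<epsilon>(1) by simp_all
    then have "2 * \<epsilon> < walk_entropy" using \<epsilon> by (simp add: distrib_right)
    from entropy_le_growth[OF \<epsilon>(1) this] have "(walk_entropy - 2 * \<epsilon>) / (drift + \<epsilon>) \<le> v"
      by (simp add: v)
    then have "walk_entropy - 2 * \<epsilon> \<le> v * (drift + \<epsilon>)"
      using \<epsilon>(1) drift_nonneg by (simp add: pos_divide_le_eq)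
    then show False using \<epsilon> by (simp add: algebra_simps)
  qed
  then show ?thesis by (simp add: v)
qed

end

text \<open>The drift and the entropy are definite descriptions; the convergence clauses certify
  that they denote the limits, and finiteness makes \<open>real_of_ereal\<close> faithful.\<close>

theorem lemma5p1:
  fixes \<mu> :: "rooted_graph measure"
  assumes "ergodic_stationary \<mu>"
    and "growth \<mu> < \<infinity>"
  shows "converges_to_const (srw_law \<mu>) speed (linear_drift \<mu>) \<and>
    \<bar>srw_entropy \<mu>\<bar> \<noteq> \<infinity> \<and>
    converges_to_const (srw_law \<mu>) info_rate (real_of_ereal (srw_entropy \<mu>)) \<and>
    ereal (1 / 2 * (linear_drift \<mu>)\<^sup>2) \<le> srw_entropy \<mu> \<and>
    srw_entropy \<mu> \<le> ereal (linear_drift \<mu>) * growth \<mu>"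
proof -
  interpret ergodic_random_graph \<mu> using assms by (rule ergodic_random_graph.intro)
  show ?thesis
    using speed_converges_drift info_rate_converges_entropy half_drift_square_le_entropy
      entropy_le_drift_growth
    by (simp add: linear_drift_eq srw_entropy_eq)
qed

end
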